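(* Let $T$ be a pseudomonad on a bicategory $\mathcal{C}$. Then $T$ is lax idempotent as a pseudomonad in the usual sense if and only if it is lax idempotent as a relative pseudomonad over the identity $1_{\mathcal{C}}\colon\mathcal{C}\to\mathcal{C}$.
   Context: Associativity and unit isomorphisms of bicategories are suppressed; "$\cdot$" is vertical composition of 2-cells, juxtaposition is composition and whiskering. A pseudomonad on $\mathcal{C}$ is a pseudofunctor $T\colon\mathcal{C}\to\mathcal{C}$ with pseudonatural transformations $n\colon T^2\to T$, $i\colon1_{\mathcal{C}}\to T$ and invertible modifications $\alpha\colon n\,(Tn)\to n\,(nT)$, $\lambda\colon 1\to n\,(iT)$, $\rho\colon n\,(Ti)\to1$ satisfying the usual two coherence conditions. It is lax idempotent in the usual sense if, for every $X\in\mathcal{C}$, $n_X$ is left adjoint to $i_{TX}$ with counit $\lambda_X^{-1}\colon n_X\,i_{TX}\to1_{TX}$. Associated relative pseudomonad. A pseudomonad $T$ is regarded as a relative pseudomonad over $1_{\mathcal{C}}$ as follows: objects $TX$ and morphisms $i_X\colon X\to TX$ are as given; $f^*=n_Y\,T(f)\colon TX\to TY$ for $f\colon X\to TY$; $\eta_f\colon f\to f^*i_X$ is the composite $f\to n_Y\,i_{TY}\,f\cong n_Y\,T(f)\,i_X$ of $\lambda$ and pseudonaturality of $i$; $\mu_{g,f}\colon(g^*f)^*\to g^*f^*$ is the composite of $\alpha$ with pseudofunctoriality of $T$ and pseudonaturality of $n$: $n\,T(n\,T(g)\,f)\cong n\,T(n)\,T^2(g)\,T(f)\cong n\,n_T\,T^2(g)\,T(f)\cong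 n\,T(g)\,n\,T(f)$; $\theta_X\colon(i_X)^*=n_X\,T(i_X)\to1_{TX}$ is given by $\rho$. Lax idempotent relative pseudomonad (over $1_{\mathcal{C}}$). In a bicategory, $\eta\colon f\to f'i$ exhibits $f'$ as a left extension of $f$ along $i$ if for every $g$ the map $\phi\mapsto(\phi i)\cdot\eta$ is a bijection from 2-cells $f'\to g$ to 2-cells $f\to gi$. The relative pseudomonad $T$ is lax idempotent if: for all $f\colon X\to TY$, $\eta_f\colon f\to f^*i_X$ exhibits $f^*$ as a left extension of $f$ along $i_X$; for all $f\colon X\to TY$, $g\colon Y\to TZ$, $(\mu_{g,f}i_X)\cdot\eta_{g^*f}=g^*\eta_f$; for all $X$, $(\theta_Xi_X)\cdot\eta_{i_X}=1_{i_X}$. *)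

theory Defs
  imports Main
begin

section \<open>Bicategories\<close>

text \<open>
  1-cells and 2-cells are taken from single carriers with source and target maps, so hom-sets are
  automatically disjoint. All operations are total on the underlying types and only constrained on
  composable cells. \<open>g \<odot> f\<close> is "f, then g"; \<open>\<psi> \<cdot> \<phi>\<close> is "\<phi>, then \<psi>".
\<close>

record ('o, 'm, 'c) bicat =
  Obj :: "'o set"
  Arr :: "'m set"
  Cell :: "'c set"
  src :: "'m \<Rightarrow> 'o"
  trg :: "'m \<Rightarrow> 'o"
  dom2 :: "'c \<Rightarrow> 'm"
  cod2 :: "'c \<Rightarrow> 'm"
  id1 :: "'o \<Rightarrow> 'm"
  comp1 :: "'m \<Rightarrow> 'm \<Rightarrow> 'm" (infixr "\<odot>\<index>" 80)
  id2 :: "'m \<Rightarrow> 'c"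
  vcomp :: "'c \<Rightarrow> 'c \<Rightarrow> 'c" (infixr "\<cdot>\<index>" 55)
  hcomp :: "'c \<Rightarrow> 'c \<Rightarrow> 'c" (infixr "\<star>\<index>" 75)
  assoc :: "'m \<Rightarrow> 'm \<Rightarrow> 'm \<Rightarrow> 'c"
  lunit :: "'m \<Rightarrow> 'c"
  runit :: "'m \<Rightarrow> 'c"

definition hom1 :: "('o, 'm, 'c) bicat \<Rightarrow> 'o \<Rightarrow> 'o \<Rightarrow> 'm set" where
  "hom1 C X Y = {f \<in> Arr C. src C f = X \<and> trg C f = Y}"

definition hom2 :: "('o, 'm, 'c) bicat \<Rightarrow> 'm \<Rightarrow> 'm \<Rightarrow> 'c set" where
  "hom2 C f g = {\<phi> \<in> Cell C. dom2 C \<phi> = f \<and> cod2 C \<phi> = g}"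

definition inverse2 :: "('o, 'm, 'c) bicat \<Rightarrow> 'c \<Rightarrow> 'c \<Rightarrow> bool" where
  "inverse2 C \<phi> \<psi> \<longleftrightarrow>
     \<phi> \<in> Cell C \<and> \<psi> \<in> hom2 C (cod2 C \<phi>) (dom2 C \<phi>) \<and>
     \<psi> \<cdot>\<^bsub>C\<^esub> \<phi> = id2 C (dom2 C \<phi>) \<and> \<phi> \<cdot>\<^bsub>C\<^esub> \<psi> = id2 C (cod2 C \<phi>)"

definition iso2 :: "('o, 'm, 'c) bicat \<Rightarrow> 'm \<Rightarrow> 'm \<Rightarrow> 'c set" where
  "iso2 C f g = {\<phi> \<in> hom2 C f g. \<exists>\<psi>. inverse2 C \<phi> \<psi>}"

definition inv2 :: "('o, 'm, 'c) bicat \<Rightarrow> 'c \<Rightarrow> 'c" where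
  "inv2 C \<phi> = (THE \<psi>. inverse2 C \<phi> \<psi>)"

abbreviation lwhisker :: "('o, 'm, 'c) bicat \<Rightarrow> 'm \<Rightarrow> 'c \<Rightarrow> 'c" (infixr "\<lhd>\<index>" 70) where
  "g \<lhd>\<^bsub>C\<^esub> \<phi> \<equiv> id2 C g \<star>\<^bsub>C\<^esub> \<phi>"

abbreviation rwhisker :: "('o, 'm, 'c) bicat \<Rightarrow> 'c \<Rightarrow> 'm \<Rightarrow> 'c" (infixl "\<rhd>\<index>" 71) where
  "\<phi> \<rhd>\<^bsub>C\<^esub> f \<equiv> \<phi> \<star>\<^bsub>C\<^esub> id2 C f"

abbreviation assoc_inv :: "('o, 'm, 'c) bicat \<Rightarrow> 'm \<Rightarrow> 'm \<Rightarrow> 'm \<Rightarrow> 'c" where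
  "assoc_inv C h g f \<equiv> inv2 C (assoc C h g f)"

locale bicategory =
  fixes C :: "('o, 'm, 'c) bicat" (structure)
  assumes src_trg: "f \<in> Arr C \<Longrightarrow> src C f \<in> Obj C \<and> trg C f \<in> Obj C"
    and dom_cod: "\<phi> \<in> Cell C \<Longrightarrow> dom2 C \<phi> \<in> Arr C \<and>
          cod2 C \<phi> \<in> hom1 C (src C (dom2 C \<phi>)) (trg C (dom2 C \<phi>))"
    and id1_hom: "X \<in> Obj C \<Longrightarrow> id1 C X \<in> hom1 C X X"
    and comp1_hom: "\<lbrakk>f \<in> hom1 C X Y; g \<in> hom1 C Y Z\<rbrakk> \<Longrightarrow> g \<odot> f \<in> hom1 C X Z"
    and id2_hom: "f \<in> Arr C \<Longrightarrow> id2 C f \<in> hom2 C f f"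
    and vcomp_hom: "\<lbrakk>\<phi> \<in> hom2 C f g; \<psi> \<in> hom2 C g h\<rbrakk> \<Longrightarrow> \<psi> \<cdot> \<phi> \<in> hom2 C f h"
    and vcomp_id: "\<phi> \<in> hom2 C f g \<Longrightarrow> \<phi> \<cdot> id2 C f = \<phi> \<and> id2 C g \<cdot> \<phi> = \<phi>"
    and vcomp_assoc: "\<lbrakk>\<phi> \<in> hom2 C f g; \<psi> \<in> hom2 C g h; \<chi> \<in> hom2 C h k\<rbrakk>
          \<Longrightarrow> (\<chi> \<cdot> \<psi>) \<cdot> \<phi> = \<chi> \<cdot> (\<psi> \<cdot> \<phi>)"
    and hcomp_hom: "\<lbrakk>\<phi> \<in> hom2 C f f'; \<psi> \<in> hom2 C g g'; src C g = trg C f\<rbrakk>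
          \<Longrightarrow> \<psi> \<star> \<phi> \<in> hom2 C (g \<odot> f) (g' \<odot> f')"
    and hcomp_id: "\<lbrakk>f \<in> hom1 C X Y; g \<in> hom1 C Y Z\<rbrakk> \<Longrightarrow> id2 C g \<star> id2 C f = id2 C (g \<odot> f)"
    and interchange: "\<lbrakk>\<phi> \<in> hom2 C f f'; \<phi>' \<in> hom2 C f' f''; \<psi> \<in> hom2 C g g'; \<psi>' \<in> hom2 C g' g'';
          src C g = trg C f\<rbrakk> \<Longrightarrow> (\<psi>' \<cdot> \<psi>) \<star> (\<phi>' \<cdot> \<phi>) = (\<psi>' \<star> \<phi>') \<cdot> (\<psi> \<star> \<phi>)"
    and assoc_iso: "\<lbrakk>f \<in> hom1 C W X; g \<in> hom1 C X Y; h \<in> hom1 C Y Z\<rbrakk>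
          \<Longrightarrow> assoc C h g f \<in> iso2 C ((h \<odot> g) \<odot> f) (h \<odot> (g \<odot> f))"
    and assoc_natural: "\<lbrakk>\<phi> \<in> hom2 C f f'; \<psi> \<in> hom2 C g g'; \<chi> \<in> hom2 C h h';
          src C g = trg C f; src C h = trg C g\<rbrakk>
          \<Longrightarrow> assoc C h' g' f' \<cdot> ((\<chi> \<star> \<psi>) \<star> \<phi>) = (\<chi> \<star> (\<psi> \<star> \<phi>)) \<cdot> assoc C h g f"
    and lunit_iso: "f \<in> hom1 C X Y \<Longrightarrow> lunit C f \<in> iso2 C (id1 C Y \<odot> f) f"
    and lunit_natural: "\<lbrakk>f \<in> hom1 C X Y; \<phi> \<in> hom2 C f f'\<rbrakk>
          \<Longrightarrow> lunit C f' \<cdot> (id1 C Y \<lhd> \<phi>) = \<phi> \<cdot> lunit C f"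
    and runit_iso: "f \<in> hom1 C X Y \<Longrightarrow> runit C f \<in> iso2 C (f \<odot> id1 C X) f"
    and runit_natural: "\<lbrakk>f \<in> hom1 C X Y; \<phi> \<in> hom2 C f f'\<rbrakk>
          \<Longrightarrow> runit C f' \<cdot> (\<phi> \<rhd> id1 C X) = \<phi> \<cdot> runit C f"
    and pentagon: "\<lbrakk>f \<in> hom1 C V W; g \<in> hom1 C W X; h \<in> hom1 C X Y; k \<in> hom1 C Y Z\<rbrakk>
          \<Longrightarrow> assoc C k h (g \<odot> f) \<cdot> assoc C (k \<odot> h) g f
              = (k \<lhd> assoc C h g f) \<cdot> assoc C k (h \<odot> g) f \<cdot> (assoc C k h g \<rhd> f)"
    and triangle: "\<lbrakk>f \<in> hom1 C X Y; g \<in> hom1 C Y Z\<rbrakk>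
          \<Longrightarrow> (g \<lhd> lunit C f) \<cdot> assoc C g (id1 C Y) f = runit C g \<rhd> f"


section \<open>Pseudofunctors from a bicategory to itself\<close>

text \<open>\<open>fmult F g f : F g \<odot> F f \<rightarrow> F (g \<odot> f)\<close> and \<open>funit F X : 1 \<rightarrow> F 1\<close> are the structural
  2-isomorphisms.\<close>

record ('o, 'm, 'c) psfun =
  fobj :: "'o \<Rightarrow> 'o"
  farr :: "'m \<Rightarrow> 'm"
  fcell :: "'c \<Rightarrow> 'c"
  fmult :: "'m \<Rightarrow> 'm \<Rightarrow> 'c"
  funit :: "'o \<Rightarrow> 'c"

locale pseudofunctor = bicategory C
  for C :: "('o, 'm, 'c) bicat" (structure) +
  fixes F :: "('o, 'm, 'c) psfun"
  assumes fobj_obj: "X \<in> Obj C \<Longrightarrow> fobj F X \<in> Obj C"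
    and farr_hom: "f \<in> hom1 C X Y \<Longrightarrow> farr F f \<in> hom1 C (fobj F X) (fobj F Y)"
    and fcell_hom: "\<phi> \<in> hom2 C f g \<Longrightarrow> fcell F \<phi> \<in> hom2 C (farr F f) (farr F g)"
    and fcell_id: "f \<in> Arr C \<Longrightarrow> fcell F (id2 C f) = id2 C (farr F f)"
    and fcell_vcomp: "\<lbrakk>\<phi> \<in> hom2 C f g; \<psi> \<in> hom2 C g h\<rbrakk>
          \<Longrightarrow> fcell F (\<psi> \<cdot> \<phi>) = fcell F \<psi> \<cdot> fcell F \<phi>"
    and fmult_iso: "\<lbrakk>f \<in> hom1 C X Y; g \<in> hom1 C Y Z\<rbrakk>
          \<Longrightarrow> fmult F g f \<in> iso2 C (farr F g \<odot> farr F f) (farr F (g \<odot> f))"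
    and fmult_natural: "\<lbrakk>\<phi> \<in> hom2 C f f'; \<psi> \<in> hom2 C g g'; src C g = trg C f\<rbrakk>
          \<Longrightarrow> fmult F g' f' \<cdot> (fcell F \<psi> \<star> fcell F \<phi>) = fcell F (\<psi> \<star> \<phi>) \<cdot> fmult F g f"
    and funit_iso: "X \<in> Obj C \<Longrightarrow> funit F X \<in> iso2 C (id1 C (fobj F X)) (farr F (id1 C X))"
    and fmult_assoc: "\<lbrakk>f \<in> hom1 C W X; g \<in> hom1 C X Y; h \<in> hom1 C Y Z\<rbrakk>
          \<Longrightarrow> fcell F (assoc C h g f) \<cdot> fmult F (h \<odot> g) f \<cdot> (fmult F h g \<rhd> farr F f)
              = fmult F h (g \<odot> f) \<cdot> (farr F h \<lhd> fmult F g f)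
                \<cdot> assoc C (farr F h) (farr F g) (farr F f)"
    and fmult_lunit: "f \<in> hom1 C X Y
          \<Longrightarrow> fcell F (lunit C f) \<cdot> fmult F (id1 C Y) f \<cdot> (funit F Y \<rhd> farr F f)
              = lunit C (farr F f)"
    and fmult_runit: "f \<in> hom1 C X Y
          \<Longrightarrow> fcell F (runit C f) \<cdot> fmult F f (id1 C X) \<cdot> (farr F f \<lhd> funit F X)
              = runit C (farr F f)"

definition psfun_id :: "('o, 'm, 'c) bicat \<Rightarrow> ('o, 'm, 'c) psfun" where
  "psfun_id C = \<lparr>
     fobj = (\<lambda>X. X),
     farr = (\<lambda>f. f),
     fcell = (\<lambda>\<phi>. \<phi>),
     fmult = (\<lambda>g f. id2 C (g \<odot>\<^bsub>C\<^esub> f)),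
     funit = (\<lambda>X. id2 C (id1 C X)) \<rparr>"

definition psfun_comp ::
  "('o, 'm, 'c) bicat \<Rightarrow> ('o, 'm, 'c) psfun \<Rightarrow> ('o, 'm, 'c) psfun \<Rightarrow> ('o, 'm, 'c) psfun" where
  "psfun_comp C G F = \<lparr>
     fobj = (\<lambda>X. fobj G (fobj F X)),
     farr = (\<lambda>f. farr G (farr F f)),
     fcell = (\<lambda>\<phi>. fcell G (fcell F \<phi>)),
     fmult = (\<lambda>g f. fcell G (fmult F g f) \<cdot>\<^bsub>C\<^esub> fmult G (farr F g) (farr F f)),
     funit = (\<lambda>X. fcell G (funit F X) \<cdot>\<^bsub>C\<^esub> funit G (fobj F X)) \<rparr>"


section \<open>Pseudonatural transformations\<close>

text \<open>The naturality 2-cell of \<open>\<sigma> : F \<rightarrow> G\<close> at \<open>f : X \<rightarrow> Y\<close> is oriented as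
  \<open>tcell \<sigma> f : \<sigma>\<^sub>Y \<odot> F f \<rightarrow> G f \<odot> \<sigma>\<^sub>X\<close>.\<close>

record ('o, 'm, 'c) pstrans =
  tarr :: "'o \<Rightarrow> 'm"
  tcell :: "'m \<Rightarrow> 'c"

locale pseudonatural = bicategory C + F: pseudofunctor C F + G: pseudofunctor C G
  for C :: "('o, 'm, 'c) bicat" (structure)
    and F :: "('o, 'm, 'c) psfun" and G :: "('o, 'm, 'c) psfun" +
  fixes \<sigma> :: "('o, 'm, 'c) pstrans"
  assumes tarr_hom: "X \<in> Obj C \<Longrightarrow> tarr \<sigma> X \<in> hom1 C (fobj F X) (fobj G X)"
    and tcell_iso: "f \<in> hom1 C X Y
          \<Longrightarrow> tcell \<sigma> f \<in> iso2 C (tarr \<sigma> Y \<odot> farr F f) (farr G f \<odot> tarr \<sigma> X)"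
    and tcell_natural: "\<lbrakk>f \<in> hom1 C X Y; \<phi> \<in> hom2 C f g\<rbrakk>
          \<Longrightarrow> tcell \<sigma> g \<cdot> (tarr \<sigma> Y \<lhd> fcell F \<phi>) = (fcell G \<phi> \<rhd> tarr \<sigma> X) \<cdot> tcell \<sigma> f"
    and tcell_comp: "\<lbrakk>f \<in> hom1 C X Y; g \<in> hom1 C Y Z\<rbrakk>
          \<Longrightarrow> tcell \<sigma> (g \<odot> f) \<cdot> (tarr \<sigma> Z \<lhd> fmult F g f)
              = (fmult G g f \<rhd> tarr \<sigma> X)
                \<cdot> assoc_inv C (farr G g) (farr G f) (tarr \<sigma> X)
                \<cdot> (farr G g \<lhd> tcell \<sigma> f)
                \<cdot> assoc C (farr G g) (tarr \<sigma> Y) (farr F f)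
                \<cdot> (tcell \<sigma> g \<rhd> farr F f)
                \<cdot> assoc_inv C (tarr \<sigma> Z) (farr F g) (farr F f)"
    and tcell_unit: "X \<in> Obj C
          \<Longrightarrow> tcell \<sigma> (id1 C X) \<cdot> (tarr \<sigma> X \<lhd> funit F X)
              = (funit G X \<rhd> tarr \<sigma> X) \<cdot> inv2 C (lunit C (tarr \<sigma> X)) \<cdot> runit C (tarr \<sigma> X)"

definition pstrans_id ::
  "('o, 'm, 'c) bicat \<Rightarrow> ('o, 'm, 'c) psfun \<Rightarrow> ('o, 'm, 'c) pstrans" where
  "pstrans_id C F = \<lparr>
     tarr = (\<lambda>X. id1 C (fobj F X)),
     tcell = (\<lambda>f. inv2 C (runit C (farr F f)) \<cdot>\<^bsub>C\<^esub> lunit C (farr F f)) \<rparr>"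

text \<open>The vertical composite of \<open>\<sigma> : F \<rightarrow> G\<close> and \<open>\<tau> : G \<rightarrow> H\<close>.\<close>

definition pstrans_comp ::
  "('o, 'm, 'c) bicat \<Rightarrow> ('o, 'm, 'c) psfun \<Rightarrow> ('o, 'm, 'c) psfun \<Rightarrow> ('o, 'm, 'c) psfun
    \<Rightarrow> ('o, 'm, 'c) pstrans \<Rightarrow> ('o, 'm, 'c) pstrans \<Rightarrow> ('o, 'm, 'c) pstrans" where
  "pstrans_comp C F G H \<tau> \<sigma> = \<lparr>
     tarr = (\<lambda>X. tarr \<tau> X \<odot>\<^bsub>C\<^esub> tarr \<sigma> X),
     tcell = (\<lambda>f. let X = src C f; Y = trg C f in
       assoc C (farr H f) (tarr \<tau> X) (tarr \<sigma> X)
       \<cdot>\<^bsub>C\<^esub> (tcell \<tau> f \<rhd>\<^bsub>C\<^esub> tarr \<sigma> X)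
       \<cdot>\<^bsub>C\<^esub> assoc_inv C (tarr \<tau> Y) (farr G f) (tarr \<sigma> X)
       \<cdot>\<^bsub>C\<^esub> (tarr \<tau> Y \<lhd>\<^bsub>C\<^esub> tcell \<sigma> f)
       \<cdot>\<^bsub>C\<^esub> assoc C (tarr \<tau> Y) (tarr \<sigma> Y) (farr F f)) \<rparr>"

text \<open>\<open>H \<sigma> : H F \<rightarrow> H G\<close> and \<open>\<sigma> K : F K \<rightarrow> G K\<close> for \<open>\<sigma> : F \<rightarrow> G\<close>.\<close>

definition psfun_pstrans ::
  "('o, 'm, 'c) bicat \<Rightarrow> ('o, 'm, 'c) psfun \<Rightarrow> ('o, 'm, 'c) psfun \<Rightarrow> ('o, 'm, 'c) psfun
    \<Rightarrow> ('o, 'm, 'c) pstrans \<Rightarrow> ('o, 'm, 'c) pstrans" where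
  "psfun_pstrans C F G H \<sigma> = \<lparr>
     tarr = (\<lambda>X. farr H (tarr \<sigma> X)),
     tcell = (\<lambda>f. let X = src C f; Y = trg C f in
       inv2 C (fmult H (farr G f) (tarr \<sigma> X))
       \<cdot>\<^bsub>C\<^esub> fcell H (tcell \<sigma> f)
       \<cdot>\<^bsub>C\<^esub> fmult H (tarr \<sigma> Y) (farr F f)) \<rparr>"

definition pstrans_psfun ::
  "('o, 'm, 'c) pstrans \<Rightarrow> ('o, 'm, 'c) psfun \<Rightarrow> ('o, 'm, 'c) pstrans" where
  "pstrans_psfun \<sigma> K = \<lparr>
     tarr = (\<lambda>X. tarr \<sigma> (fobj K X)),
     tcell = (\<lambda>f. tcell \<sigma> (farr K f)) \<rparr>"

definition invertible_modification ::
  "('o, 'm, 'c) bicat \<Rightarrow> ('o, 'm, 'c) psfun \<Rightarrow> ('o, 'm, 'c) psfun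
    \<Rightarrow> ('o, 'm, 'c) pstrans \<Rightarrow> ('o, 'm, 'c) pstrans \<Rightarrow> ('o \<Rightarrow> 'c) \<Rightarrow> bool" where
  "invertible_modification C F G \<sigma> \<tau> \<Gamma> \<longleftrightarrow>
     (\<forall>X \<in> Obj C. \<Gamma> X \<in> iso2 C (tarr \<sigma> X) (tarr \<tau> X)) \<and>
     (\<forall>X \<in> Obj C. \<forall>Y \<in> Obj C. \<forall>f \<in> hom1 C X Y.
        tcell \<tau> f \<cdot>\<^bsub>C\<^esub> (\<Gamma> Y \<rhd>\<^bsub>C\<^esub> farr F f) = (farr G f \<lhd>\<^bsub>C\<^esub> \<Gamma> X) \<cdot>\<^bsub>C\<^esub> tcell \<sigma> f)"


section \<open>Pseudomonads\<close>

text \<open>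
  Composition of pseudofunctors is strictly associative and unital on the cells of \<open>C\<close>, so
  \<open>T n\<close> and \<open>n T\<close> are parallel transformations \<open>T\<^sup>3 \<rightarrow> T\<^sup>2\<close>, and \<open>i T\<close>, \<open>T i\<close> are
  transformations \<open>T \<rightarrow> T\<^sup>2\<close>. The invertible modifications are
  \<open>\<alpha> : n (T n) \<rightarrow> n (n T)\<close>, \<open>\<l> : 1 \<rightarrow> n (i T)\<close> and \<open>\<rho> : n (T i) \<rightarrow> 1\<close>.

  \<open>coherence_assoc\<close> equates two composites
  \<open>n\<^sub>X \<odot> T n\<^sub>X \<odot> T\<^sup>2 n\<^sub>X \<rightarrow> n\<^sub>X \<odot> n\<^bsub>T X\<^esub> \<odot> n\<^bsub>T T X\<^esub>\<close>; \<open>coherence_unit\<close> says that the composite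
  \<open>n\<^sub>X \<rightarrow> n\<^sub>X \<odot> T n\<^sub>X \<odot> T i\<^bsub>T X\<^esub> \<rightarrow> n\<^sub>X \<odot> n\<^bsub>T X\<^esub> \<odot> T i\<^bsub>T X\<^esub> \<rightarrow> n\<^sub>X\<close> is the identity.
\<close>

locale pseudomonad = bicategory C
  for C :: "('o, 'm, 'c) bicat" (structure) +
  fixes T :: "('o, 'm, 'c) psfun"
    and n :: "('o, 'm, 'c) pstrans" and i :: "('o, 'm, 'c) pstrans"
    and \<alpha> :: "'o \<Rightarrow> 'c" and \<l> :: "'o \<Rightarrow> 'c" and \<rho> :: "'o \<Rightarrow> 'c"
  assumes pseudofunctor_T: "pseudofunctor C T"
    and pseudonatural_n: "pseudonatural C (psfun_comp C T T) T n"
    and pseudonatural_i: "pseudonatural C (psfun_id C) T i"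
    and modification_\<alpha>: "let T2 = psfun_comp C T T; T3 = psfun_comp C T T2 in
          invertible_modification C T3 T
            (pstrans_comp C T3 T2 T n (psfun_pstrans C T2 T T n))
            (pstrans_comp C T3 T2 T n (pstrans_psfun n T)) \<alpha>"
    and modification_\<l>: "let T2 = psfun_comp C T T in
          invertible_modification C T T
            (pstrans_id C T)
            (pstrans_comp C T T2 T n (pstrans_psfun i T)) \<l>"
    and modification_\<rho>: "let T2 = psfun_comp C T T in
          invertible_modification C T T
            (pstrans_comp C T T2 T n (psfun_pstrans C (psfun_id C) T T i))
            (pstrans_id C T) \<rho>"
    and coherence_assoc: "X \<in> Obj C \<Longrightarrow>
          (let TX = fobj T X; TTX = fobj T TX; nX = tarr n X; nTX = tarr n TX; nTTX = tarr n TTX;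
               TnX = farr T nX; TTnX = farr T TnX; TnTX = farr T nTX in
            (nX \<lhd> \<alpha> TX)
            \<cdot> assoc C nX nTX TnTX
            \<cdot> (\<alpha> X \<rhd> TnTX)
            \<cdot> assoc_inv C nX TnX TnTX
            \<cdot> (nX \<lhd> (inv2 C (fmult T nX nTX) \<cdot> fcell T (\<alpha> X) \<cdot> fmult T nX TnX))
            = assoc C nX nTX nTTX
              \<cdot> (\<alpha> X \<rhd> nTTX)
              \<cdot> assoc_inv C nX TnX nTTX
              \<cdot> (nX \<lhd> tcell n nX)
              \<cdot> assoc C nX nTX TTnX
              \<cdot> (\<alpha> X \<rhd> TTnX)
              \<cdot> assoc_inv C nX TnX TTnX)"
    and coherence_unit: "X \<in> Obj C \<Longrightarrow>
          (let TX = fobj T X; nX = tarr n X; nTX = tarr n TX; iTX = tarr i TX;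
               TnX = farr T nX; TiTX = farr T iTX in
            runit C nX
            \<cdot> (nX \<lhd> \<rho> TX)
            \<cdot> assoc C nX nTX TiTX
            \<cdot> (\<alpha> X \<rhd> TiTX)
            \<cdot> assoc_inv C nX TnX TiTX
            \<cdot> (nX \<lhd> (inv2 C (fmult T nX iTX) \<cdot> fcell T (\<l> X) \<cdot> funit T TX))
            \<cdot> inv2 C (runit C nX)
            = id2 C nX)"

text \<open>\<open>l : A \<rightarrow> B\<close> is left adjoint to \<open>r : B \<rightarrow> A\<close> with counit \<open>\<epsilon> : l \<odot> r \<rightarrow> 1\<close>.\<close>

definition left_adjoint_with_counit ::
  "('o, 'm, 'c) bicat \<Rightarrow> 'o \<Rightarrow> 'o \<Rightarrow> 'm \<Rightarrow> 'm \<Rightarrow> 'c \<Rightarrow> bool" where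
  "left_adjoint_with_counit C A B l r \<epsilon> \<longleftrightarrow>
     l \<in> hom1 C A B \<and> r \<in> hom1 C B A \<and> \<epsilon> \<in> hom2 C (l \<odot>\<^bsub>C\<^esub> r) (id1 C B) \<and>
     (\<exists>\<eta> \<in> hom2 C (id1 C A) (r \<odot>\<^bsub>C\<^esub> l).
        lunit C l \<cdot>\<^bsub>C\<^esub> (\<epsilon> \<rhd>\<^bsub>C\<^esub> l) \<cdot>\<^bsub>C\<^esub> assoc_inv C l r l \<cdot>\<^bsub>C\<^esub> (l \<lhd>\<^bsub>C\<^esub> \<eta>) \<cdot>\<^bsub>C\<^esub> inv2 C (runit C l)
          = id2 C l \<and>
        runit C r \<cdot>\<^bsub>C\<^esub> (r \<lhd>\<^bsub>C\<^esub> \<epsilon>) \<cdot>\<^bsub>C\<^esub> assoc C r l r \<cdot>\<^bsub>C\<^esub> (\<eta> \<rhd>\<^bsub>C\<^esub> r) \<cdot>\<^bsub>C\<^esub> inv2 C (lunit C r)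
          = id2 C r)"

definition lax_idempotent_pseudomonad ::
  "('o, 'm, 'c) bicat \<Rightarrow> ('o, 'm, 'c) psfun \<Rightarrow> ('o, 'm, 'c) pstrans \<Rightarrow> ('o, 'm, 'c) pstrans
    \<Rightarrow> ('o \<Rightarrow> 'c) \<Rightarrow> bool" where
  "lax_idempotent_pseudomonad C T n i \<l> \<longleftrightarrow>
     (\<forall>X \<in> Obj C. left_adjoint_with_counit C (fobj T (fobj T X)) (fobj T X)
        (tarr n X) (tarr i (fobj T X)) (inv2 C (\<l> X)))"


section \<open>Relative pseudomonads over the identity\<close>

text \<open>
  The data \<open>T\<close>, \<open>i\<close>, \<open>(-)\<^sup>*\<close>, \<open>\<eta>\<close>, \<open>\<mu>\<close>, \<open>\<theta>\<close>. As \<open>T\<close> need not be injective on objects, a 1-cell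
  \<open>f : X \<rightarrow> T Y\<close> does not determine \<open>Y\<close>, so the objects are explicit arguments: for
  \<open>f : X \<rightarrow> T Y\<close> and \<open>g : Y \<rightarrow> T Z\<close> one has \<open>rext R X Y f = f\<^sup>*\<close>, \<open>r\<eta> R X Y f = \<eta>\<^sub>f\<close> and
  \<open>r\<mu> R X Y Z g f : (g\<^sup>* f)\<^sup>* \<rightarrow> g\<^sup>* f\<^sup>*\<close>.
\<close>

record ('o, 'm, 'c) rel_psmonad =
  robj :: "'o \<Rightarrow> 'o"
  rarr :: "'o \<Rightarrow> 'm"
  rext :: "'o \<Rightarrow> 'o \<Rightarrow> 'm \<Rightarrow> 'm"
  r\<eta> :: "'o \<Rightarrow> 'o \<Rightarrow> 'm \<Rightarrow> 'c"
  r\<mu> :: "'o \<Rightarrow> 'o \<Rightarrow> 'o \<Rightarrow> 'm \<Rightarrow> 'm \<Rightarrow> 'c"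
  r\<theta> :: "'o \<Rightarrow> 'c"

text \<open>\<open>\<eta> : f \<rightarrow> f' \<odot> i\<close> exhibits \<open>f' : X' \<rightarrow> Y\<close> as a left extension of \<open>f : X \<rightarrow> Y\<close> along
  \<open>i : X \<rightarrow> X'\<close>.\<close>

definition left_extension ::
  "('o, 'm, 'c) bicat \<Rightarrow> 'o \<Rightarrow> 'o \<Rightarrow> 'o \<Rightarrow> 'm \<Rightarrow> 'm \<Rightarrow> 'm \<Rightarrow> 'c \<Rightarrow> bool" where
  "left_extension C X X' Y i f f' \<eta> \<longleftrightarrow>
     i \<in> hom1 C X X' \<and> f \<in> hom1 C X Y \<and> f' \<in> hom1 C X' Y \<and> \<eta> \<in> hom2 C f (f' \<odot>\<^bsub>C\<^esub> i) \<and>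
     (\<forall>g \<in> hom1 C X' Y.
        bij_betw (\<lambda>\<phi>. (\<phi> \<rhd>\<^bsub>C\<^esub> i) \<cdot>\<^bsub>C\<^esub> \<eta>) (hom2 C f' g) (hom2 C f (g \<odot>\<^bsub>C\<^esub> i)))"

definition lax_idempotent_relative ::
  "('o, 'm, 'c) bicat \<Rightarrow> ('o, 'm, 'c) rel_psmonad \<Rightarrow> bool" where
  "lax_idempotent_relative C R \<longleftrightarrow>
     (\<forall>X \<in> Obj C. \<forall>Y \<in> Obj C. \<forall>f \<in> hom1 C X (robj R Y).
        left_extension C X (robj R X) (robj R Y) (rarr R X) f (rext R X Y f) (r\<eta> R X Y f)) \<and>
     (\<forall>X \<in> Obj C. \<forall>Y \<in> Obj C. \<forall>Z \<in> Obj C.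
        \<forall>f \<in> hom1 C X (robj R Y). \<forall>g \<in> hom1 C Y (robj R Z).
        assoc C (rext R Y Z g) (rext R X Y f) (rarr R X)
          \<cdot>\<^bsub>C\<^esub> (r\<mu> R X Y Z g f \<rhd>\<^bsub>C\<^esub> rarr R X)
          \<cdot>\<^bsub>C\<^esub> r\<eta> R X Z (rext R Y Z g \<odot>\<^bsub>C\<^esub> f)
        = rext R Y Z g \<lhd>\<^bsub>C\<^esub> r\<eta> R X Y f) \<and>
     (\<forall>X \<in> Obj C.
        lunit C (rarr R X) \<cdot>\<^bsub>C\<^esub> (r\<theta> R X \<rhd>\<^bsub>C\<^esub> rarr R X) \<cdot>\<^bsub>C\<^esub> r\<eta> R X X (rarr R X)
        = id2 C (rarr R X))"

text \<open>The 2-cell \<open>f \<rightarrow> n\<^sub>Y \<odot> i\<^bsub>T Y\<^esub> \<odot> f \<cong> (n\<^sub>Y \<odot> T f) \<odot> i\<^sub>X\<close>.\<close>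

definition associated_\<eta> ::
  "('o, 'm, 'c) bicat \<Rightarrow> ('o, 'm, 'c) psfun \<Rightarrow> ('o, 'm, 'c) pstrans \<Rightarrow> ('o, 'm, 'c) pstrans
    \<Rightarrow> ('o \<Rightarrow> 'c) \<Rightarrow> 'o \<Rightarrow> 'o \<Rightarrow> 'm \<Rightarrow> 'c" where
  "associated_\<eta> C T n i \<l> X Y f =
     assoc_inv C (tarr n Y) (farr T f) (tarr i X)
     \<cdot>\<^bsub>C\<^esub> (tarr n Y \<lhd>\<^bsub>C\<^esub> tcell i f)
     \<cdot>\<^bsub>C\<^esub> assoc C (tarr n Y) (tarr i (fobj T Y)) f
     \<cdot>\<^bsub>C\<^esub> (\<l> Y \<rhd>\<^bsub>C\<^esub> f)
     \<cdot>\<^bsub>C\<^esub> inv2 C (lunit C f)"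

text \<open>The 2-cell \<open>n\<^sub>Z \<odot> T ((n\<^sub>Z \<odot> T g) \<odot> f) \<cong> n\<^sub>Z \<odot> T n\<^sub>Z \<odot> T\<^sup>2 g \<odot> T f \<cong>
  n\<^sub>Z \<odot> n\<^bsub>T Z\<^esub> \<odot> T\<^sup>2 g \<odot> T f \<cong> (n\<^sub>Z \<odot> T g) \<odot> (n\<^sub>Y \<odot> T f)\<close>.\<close>

definition associated_\<mu> ::
  "('o, 'm, 'c) bicat \<Rightarrow> ('o, 'm, 'c) psfun \<Rightarrow> ('o, 'm, 'c) pstrans
    \<Rightarrow> ('o \<Rightarrow> 'c) \<Rightarrow> 'o \<Rightarrow> 'o \<Rightarrow> 'o \<Rightarrow> 'm \<Rightarrow> 'm \<Rightarrow> 'c" where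
  "associated_\<mu> C T n \<alpha> X Y Z g f =
     (let nZ = tarr n Z; nY = tarr n Y; nTZ = tarr n (fobj T Z); TnZ = farr T nZ;
          Tg = farr T g; TTg = farr T Tg; Tf = farr T f in
       assoc_inv C nZ Tg (nY \<odot>\<^bsub>C\<^esub> Tf)
       \<cdot>\<^bsub>C\<^esub> (nZ \<lhd>\<^bsub>C\<^esub> assoc C Tg nY Tf)
       \<cdot>\<^bsub>C\<^esub> (nZ \<lhd>\<^bsub>C\<^esub> (tcell n g \<rhd>\<^bsub>C\<^esub> Tf))
       \<cdot>\<^bsub>C\<^esub> (nZ \<lhd>\<^bsub>C\<^esub> assoc_inv C nTZ TTg Tf)
       \<cdot>\<^bsub>C\<^esub> assoc C nZ nTZ (TTg \<odot>\<^bsub>C\<^esub> Tf)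
       \<cdot>\<^bsub>C\<^esub> (\<alpha> Z \<rhd>\<^bsub>C\<^esub> (TTg \<odot>\<^bsub>C\<^esub> Tf))
       \<cdot>\<^bsub>C\<^esub> assoc_inv C nZ TnZ (TTg \<odot>\<^bsub>C\<^esub> Tf)
       \<cdot>\<^bsub>C\<^esub> (nZ \<lhd>\<^bsub>C\<^esub> assoc C TnZ TTg Tf)
       \<cdot>\<^bsub>C\<^esub> (nZ \<lhd>\<^bsub>C\<^esub> (inv2 C (fmult T nZ Tg) \<rhd>\<^bsub>C\<^esub> Tf))
       \<cdot>\<^bsub>C\<^esub> (nZ \<lhd>\<^bsub>C\<^esub> inv2 C (fmult T (nZ \<odot>\<^bsub>C\<^esub> Tg) f)))"

definition associated_relative ::
  "('o, 'm, 'c) bicat \<Rightarrow> ('o, 'm, 'c) psfun \<Rightarrow> ('o, 'm, 'c) pstrans \<Rightarrow> ('o, 'm, 'c) pstrans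
    \<Rightarrow> ('o \<Rightarrow> 'c) \<Rightarrow> ('o \<Rightarrow> 'c) \<Rightarrow> ('o \<Rightarrow> 'c) \<Rightarrow> ('o, 'm, 'c) rel_psmonad" where
  "associated_relative C T n i \<alpha> \<l> \<rho> = \<lparr>
     robj = fobj T,
     rarr = tarr i,
     rext = (\<lambda>X Y f. tarr n Y \<odot>\<^bsub>C\<^esub> farr T f),
     r\<eta> = associated_\<eta> C T n i \<l>,
     r\<mu> = associated_\<mu> C T n \<alpha>,
     r\<theta> = \<rho> \<rparr>"

end

(*
  Evaluate 2-cells on a generic 1-cell h at the right-hand end of right-nested composites. The data
  become natural isomorphisms

    L(h) : h -> n (i h),      R(h) : n (Ti h) -> h,        A(h) : n (Tn h) -> n (nT h),
    N_f(h) : n (TTf h) -> Tf (n h),      I_f(h) : i (f h) -> Tf (i h),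

  and no associativity isomorphism survives in an equation between them.

  As for monoidal categories (Kelly), the two coherence axioms imply that L is compatible with A
  and that i -> n i i = n Ti i -> i is the identity: n T(-) is faithful because the unit cell
  f -> n Tf i is invertible. This gives the conditions on mu and theta for every pseudomonad.

  Given n -| i, each g : TX -> TY carries a cell n Tg -> g n, the mate of I_g. A cell f -> g i
  extends to n Tf -> n T(g i) -> n Tg Ti -> g n Ti -> g, and this is inverse to restriction along
  the unit; for the cell belonging to n Tf, which is A followed by N_f, the extension of the unit
  is the identity by the unit axiom. Conversely, the unit 1 -> i n is the extension of i L, as 1 is
  a left extension of i along itself by the condition on theta; one triangle identity is its
  defining equation, the other follows from uniqueness of extensions to n, the left extension of 1.
*)

theory Submission
  imports Defs
begin

section \<open>Labelled partial 2-cells\<close>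

text \<open>In the unit axiom \<lambda> occurs only under T and to the right of n, while
  compatibility of \<lambda> with \<alpha> has it outermost and bare. For monoidal categories the
  remedy is to tensor with the unit object and cancel it. T itself need not be faithful, so the
  cancellation must come from elsewhere: n T(-) for the first derived condition, and n (Ti), which
  \<rho> identifies with the identity, for the second. The conditions on \<mu> and \<theta> being
  automatic, only the universal property of \<eta> is at stake, and there the two triangle
  identities have separate roles. The one on i gives existence of extensions
  (\<open>lax_alg_I\<close>, used in \<open>lax_ext_eta\<close>); the one on n gives their
  uniqueness (\<open>lax_alg_comp\<close>, used in \<open>lax_ext_restrict\<close>). The converse
  matches this: existence of an extension yields the adjunction unit together with the triangle on
  i, and uniqueness yields the triangle on n.\<close>

text \<open>A 2-cell with explicit source and target, undefined when a composite is ill-typed. Equations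
  such as associativity and naturality then hold with no typing hypothesis beyond equality of
  labels, which rewriting can decide.\<close>

datatype ('m, 'c) wcell = W (wdom: 'm) (wcod: 'm) (wopt: "'c option")

context bicategory
begin

section \<open>Typing of 1-cells and 2-cells\<close>

lemma hom1_iff: "f \<in> hom1 C X Y \<longleftrightarrow> f \<in> Arr C \<and> src C f = X \<and> trg C f = Y"
  by (auto simp: hom1_def)

lemma src_obj [simp]: "f \<in> Arr C \<Longrightarrow> src C f \<in> Obj C"
  and trg_obj [simp]: "f \<in> Arr C \<Longrightarrow> trg C f \<in> Obj C"
  using src_trg by auto

lemma comp1_arr [simp]:
  assumes "g \<in> Arr C" "f \<in> Arr C" "src C g = trg C f"
  shows "g \<odot> f \<in> Arr C" "src C (g \<odot> f) = src C f" "trg C (g \<odot> f) = trg C g"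
  using comp1_hom[of f "src C f" "trg C f" g "trg C g"] assms by (auto simp: hom1_iff)

lemma id1_arr [simp]:
  assumes "X \<in> Obj C"
  shows "id1 C X \<in> Arr C" "src C (id1 C X) = X" "trg C (id1 C X) = X"
  using id1_hom[OF assms] by (auto simp: hom1_iff)

lemma hom2_arr:
  assumes "\<phi> \<in> hom2 C f g"
  shows "f \<in> Arr C" "g \<in> Arr C" "src C g = src C f" "trg C g = trg C f"
  using assms dom_cod[of \<phi>] by (auto simp: hom2_def hom1_def)

section \<open>Operations on labelled cells\<close>

definition valid where
  "valid w \<longleftrightarrow> (\<exists>\<phi>. wopt w = Some \<phi> \<and> \<phi> \<in> hom2 C (wdom w) (wcod w))"

definition wval where "wval w = the (wopt w)"

text \<open>Excludes a \<open>Some\<close> outside the labelled hom-set. The operations below return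
  \<open>None\<close> on invalid arguments, so cancelling an identity or an inverse is sound only
  for normal cells; hence this side condition in those rules.\<close>

definition wnormal where "wnormal w \<longleftrightarrow> valid w \<or> wopt w = None"

definition wr where
  "wr f g \<phi> = W f g (if \<phi> \<in> hom2 C f g then Some \<phi> else None)"

definition vc (infixr "\<bullet>" 55) where
  "\<psi> \<bullet> \<phi> = W (wdom \<phi>) (wcod \<psi>)
     (if valid \<psi> \<and> valid \<phi> \<and> wdom \<psi> = wcod \<phi> then Some (wval \<psi> \<cdot> wval \<phi>) else None)"

definition lw (infixr "\<triangleleft>" 70) where
  "a \<triangleleft> \<phi> = W (a \<odot> wdom \<phi>) (a \<odot> wcod \<phi>)
     (if valid \<phi> \<and> a \<in> Arr C \<and> src C a = trg C (wdom \<phi>) then Some (a \<lhd> wval \<phi>) else None)"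

definition rw (infixl "\<triangleright>" 71) where
  "\<phi> \<triangleright> h = W (wdom \<phi> \<odot> h) (wcod \<phi> \<odot> h)
     (if valid \<phi> \<and> h \<in> Arr C \<and> src C (wdom \<phi>) = trg C h then Some (wval \<phi> \<rhd> h) else None)"

definition wid where "wid f = wr f f (id2 C f)"

definition wiso where
  "wiso \<phi> \<longleftrightarrow> valid \<phi> \<and> wval \<phi> \<in> iso2 C (wdom \<phi>) (wcod \<phi>)"

definition winv where
  "winv \<phi> = W (wcod \<phi>) (wdom \<phi>) (if wiso \<phi> then Some (inv2 C (wval \<phi>)) else None)"

definition comp3 where
  "comp3 a b h \<longleftrightarrow> a \<in> Arr C \<and> b \<in> Arr C \<and> h \<in> Arr C \<and> src C a = trg C b \<and> src C b = trg C h"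

text \<open>Guarded by composability and not by \<open>wr\<close>: outside composable triples
  \<open>assoc\<close> is unconstrained and might still lie in the hom-set of the labels, while
  naturality without typing hypotheses needs validity to be exactly \<open>comp3\<close>.\<close>

definition as where
  "as a b h = W ((a \<odot> b) \<odot> h) (a \<odot> b \<odot> h) (if comp3 a b h then Some (assoc C a b h) else None)"

definition lu where "lu f = wr (id1 C (trg C f) \<odot> f) f (lunit C f)"

definition ru where "ru f = wr (f \<odot> id1 C (src C f)) f (runit C f)"

lemma wlabels [simp]:
  "wdom (wr f g x) = f" "wcod (wr f g x) = g"
  "wdom (\<psi> \<bullet> \<phi>) = wdom \<phi>" "wcod (\<psi> \<bullet> \<phi>) = wcod \<psi>"
  "wdom (a \<triangleleft> \<phi>) = a \<odot> wdom \<phi>" "wcod (a \<triangleleft> \<phi>) = a \<odot> wcod \<phi>"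
  "wdom (\<phi> \<triangleright> h) = wdom \<phi> \<odot> h" "wcod (\<phi> \<triangleright> h) = wcod \<phi> \<odot> h"
  "wdom (wid f) = f" "wcod (wid f) = f"
  "wdom (winv \<phi>) = wcod \<phi>" "wcod (winv \<phi>) = wdom \<phi>"
  "wdom (as a b h) = (a \<odot> b) \<odot> h" "wcod (as a b h) = a \<odot> b \<odot> h"
  "wdom (lu f) = id1 C (trg C f) \<odot> f" "wcod (lu f) = f"
  "wdom (ru f) = f \<odot> id1 C (src C f)" "wcod (ru f) = f"
  by (simp_all add: wr_def vc_def lw_def rw_def wid_def winv_def as_def lu_def ru_def)

lemma valid_W [simp]: "\<not> valid (W f g None)" "valid (W f g (Some \<phi>)) \<longleftrightarrow> \<phi> \<in> hom2 C f g"
  by (auto simp: valid_def)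

lemma validD:
  assumes "valid \<phi>"
  shows "wval \<phi> \<in> hom2 C (wdom \<phi>) (wcod \<phi>)" "wopt \<phi> = Some (wval \<phi>)"
    "wdom \<phi> \<in> Arr C" "wcod \<phi> \<in> Arr C" "src C (wcod \<phi>) = src C (wdom \<phi>)"
    "trg C (wcod \<phi>) = trg C (wdom \<phi>)"
  using assms hom2_arr by (fastforce simp: valid_def wval_def)+

lemma valid_wr [simp]: "valid (wr f g \<phi>) \<longleftrightarrow> \<phi> \<in> hom2 C f g"
  and wval_wr [simp]: "\<phi> \<in> hom2 C f g \<Longrightarrow> wval (wr f g \<phi>) = \<phi>"
  by (auto simp: valid_def wr_def wval_def)

lemma lwhisker_hom:
  assumes "\<phi> \<in> hom2 C f g" "a \<in> Arr C" "src C a = trg C f"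
  shows "a \<lhd> \<phi> \<in> hom2 C (a \<odot> f) (a \<odot> g)"
  using hcomp_hom[OF assms(1) id2_hom[OF assms(2)]] assms by auto

lemma rwhisker_hom:
  assumes "\<phi> \<in> hom2 C f g" "h \<in> Arr C" "src C f = trg C h"
  shows "\<phi> \<rhd> h \<in> hom2 C (f \<odot> h) (g \<odot> h)"
  using hcomp_hom[OF id2_hom[OF assms(2)] assms(1)] assms by auto

lemma valid_vc [simp]: "valid (\<psi> \<bullet> \<phi>) \<longleftrightarrow> valid \<psi> \<and> valid \<phi> \<and> wdom \<psi> = wcod \<phi>"
  using validD(1)[of \<psi>] validD(1)[of \<phi>] vcomp_hom by (auto simp: vc_def)

lemma wval_vc [simp]:
  "\<lbrakk>valid \<psi>; valid \<phi>; wdom \<psi> = wcod \<phi>\<rbrakk> \<Longrightarrow> wval (\<psi> \<bullet> \<phi>) = wval \<psi> \<cdot> wval \<phi>"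
  by (simp add: vc_def wval_def)

lemma valid_lw [simp]:
  "valid (a \<triangleleft> \<phi>) \<longleftrightarrow> valid \<phi> \<and> a \<in> Arr C \<and> src C a = trg C (wdom \<phi>)"
  using validD(1)[of \<phi>] lwhisker_hom by (auto simp: lw_def)

lemma wval_lw [simp]:
  "\<lbrakk>valid \<phi>; a \<in> Arr C; src C a = trg C (wdom \<phi>)\<rbrakk> \<Longrightarrow> wval (a \<triangleleft> \<phi>) = a \<lhd> wval \<phi>"
  by (simp add: lw_def wval_def)

lemma valid_rw [simp]:
  "valid (\<phi> \<triangleright> h) \<longleftrightarrow> valid \<phi> \<and> h \<in> Arr C \<and> src C (wdom \<phi>) = trg C h"
  using validD(1)[of \<phi>] rwhisker_hom by (auto simp: rw_def)

lemma wval_rw [simp]: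
  "\<lbrakk>valid \<phi>; h \<in> Arr C; src C (wdom \<phi>) = trg C h\<rbrakk> \<Longrightarrow> wval (\<phi> \<triangleright> h) = wval \<phi> \<rhd> h"
  by (simp add: rw_def wval_def)

lemma valid_wid [simp]: "valid (wid f) \<longleftrightarrow> f \<in> Arr C"
  using id2_hom hom2_arr by (auto simp: wid_def)

lemma wval_wid [simp]: "f \<in> Arr C \<Longrightarrow> wval (wid f) = id2 C f"
  using id2_hom by (simp add: wid_def)

lemma wcell_eqI:
  assumes "wnormal x" "wnormal y" "wdom x = wdom y" "wcod x = wcod y" "valid x \<longleftrightarrow> valid y"
    "valid x \<Longrightarrow> wval x = wval y"
  shows "x = y"
  using assms by (cases x; cases y) (auto simp: wnormal_def valid_def wval_def)

section \<open>Inverses of 2-cells\<close>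

lemma inverse2_unique:
  assumes "inverse2 C \<phi> \<psi>" "inverse2 C \<phi> \<psi>'"
  shows "\<psi>' = \<psi>"
proof -
  let ?f = "dom2 C \<phi>" and ?g = "cod2 C \<phi>"
  have h: "\<phi> \<in> hom2 C ?f ?g" "\<psi> \<in> hom2 C ?g ?f" "\<psi>' \<in> hom2 C ?g ?f"
    using assms by (auto simp: inverse2_def hom2_def)
  have "\<psi>' = \<psi>' \<cdot> (\<phi> \<cdot> \<psi>)"
    using assms h vcomp_id by (simp add: inverse2_def)
  also have "\<dots> = (\<psi>' \<cdot> \<phi>) \<cdot> \<psi>"
    using vcomp_assoc h by metis
  also have "\<dots> = \<psi>"
    using assms h vcomp_id by (simp add: inverse2_def)
  finally show ?thesis .
qed

lemma inv2_eq: "inverse2 C \<phi> \<psi> \<Longrightarrow> inv2 C \<phi> = \<psi>"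
  unfolding inv2_def using inverse2_unique by blast

lemma wiso_inverse2:
  assumes "wiso \<phi>"
  shows "inverse2 C (wval \<phi>) (inv2 C (wval \<phi>))"
  using assms inv2_eq by (force simp: wiso_def iso2_def)

lemma dom2_wval: "valid \<phi> \<Longrightarrow> dom2 C (wval \<phi>) = wdom \<phi>"
  and cod2_wval: "valid \<phi> \<Longrightarrow> cod2 C (wval \<phi>) = wcod \<phi>"
  using validD(1) by (auto simp: hom2_def)

lemma valid_winv [simp]: "valid (winv \<phi>) \<longleftrightarrow> wiso \<phi>"
proof
  assume "wiso \<phi>"
  then have "inv2 C (wval \<phi>) \<in> hom2 C (wcod \<phi>) (wdom \<phi>)"
    using wiso_inverse2[of \<phi>] by (auto simp: inverse2_def wiso_def dom2_wval cod2_wval)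
  then show "valid (winv \<phi>)"
    using \<open>wiso \<phi>\<close> by (simp add: valid_def winv_def)
qed (auto simp: valid_def winv_def split: if_splits)

lemma wval_winv: "wiso \<phi> \<Longrightarrow> wval (winv \<phi>) = inv2 C (wval \<phi>)"
  by (simp add: winv_def wval_def)

lemma wiso_valid [simp]: "wiso \<phi> \<Longrightarrow> valid \<phi>"
  by (simp add: wiso_def)

lemma wnormal_simps [simp]:
  "wnormal (wr f g x)" "wnormal (\<psi> \<bullet> \<phi>)" "wnormal (a \<triangleleft> \<phi>)" "wnormal (\<phi> \<triangleright> h)" "wnormal (wid f)"
  "wnormal (winv \<phi>)" "wnormal (lu f)" "wnormal (ru f)"
proof -
  show "wnormal (winv \<phi>)"
    unfolding wnormal_def valid_winv by (simp add: winv_def)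
  show "wnormal (wr f g x)" for f g x
    unfolding wnormal_def valid_wr by (simp add: wr_def)
  then show "wnormal (wid f)" "wnormal (lu f)" "wnormal (ru f)"
    by (simp_all only: wid_def lu_def ru_def)
  show "wnormal (\<psi> \<bullet> \<phi>)"
    unfolding wnormal_def valid_vc by (auto simp: vc_def)
  show "wnormal (a \<triangleleft> \<phi>)"
    unfolding wnormal_def valid_lw by (auto simp: lw_def)
  show "wnormal (\<phi> \<triangleright> h)"
    unfolding wnormal_def valid_rw by (auto simp: rw_def)
qed

lemma valid_wnormal [simp]: "valid x \<Longrightarrow> wnormal x"
  by (simp add: wnormal_def)

lemma comp3_hom:
  "comp3 a b h \<Longrightarrow> h \<in> hom1 C (src C h) (trg C h) \<and> b \<in> hom1 C (trg C h) (src C a)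
    \<and> a \<in> hom1 C (src C a) (trg C a)"
  by (auto simp: comp3_def hom1_iff)

lemma comp3_src [simp]:
  assumes "comp3 a b h"
  shows "src C ((a \<odot> b) \<odot> h) = src C h" "src C (a \<odot> b \<odot> h) = src C h"
    "trg C ((a \<odot> b) \<odot> h) = trg C a" "trg C (a \<odot> b \<odot> h) = trg C a"
  using assms by (auto simp: comp3_def)

lemma assoc_iso_comp3:
  "comp3 a b h \<Longrightarrow> assoc C a b h \<in> iso2 C ((a \<odot> b) \<odot> h) (a \<odot> b \<odot> h)"
  using comp3_hom assoc_iso by blast

lemma valid_as [simp]: "valid (as a b h) \<longleftrightarrow> comp3 a b h"
  using assoc_iso_comp3 by (auto simp: valid_def as_def iso2_def)

lemma wval_as [simp]: "comp3 a b h \<Longrightarrow> wval (as a b h) = assoc C a b h"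
  by (simp add: wval_def as_def)

lemma wnormal_as [simp]: "wnormal (as a b h)"
  unfolding wnormal_def valid_as by (simp add: as_def)

lemma wiso_as [simp]: "wiso (as a b h) \<longleftrightarrow> comp3 a b h"
  using assoc_iso_comp3 by (auto simp: wiso_def)

lemma wiso_lu [simp]: "f \<in> Arr C \<Longrightarrow> wiso (lu f)"
  using lunit_iso[of f "src C f" "trg C f"] by (auto simp: wiso_def lu_def iso2_def hom1_iff)

lemma wiso_ru [simp]: "f \<in> Arr C \<Longrightarrow> wiso (ru f)"
  using runit_iso[of f "src C f" "trg C f"] by (auto simp: wiso_def ru_def iso2_def hom1_iff)

lemma valid_lu [simp]: "f \<in> Arr C \<Longrightarrow> valid (lu f)"
  and valid_ru [simp]: "f \<in> Arr C \<Longrightarrow> valid (ru f)"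
  using wiso_lu wiso_ru wiso_valid by auto

lemma wval_lu [simp]: "f \<in> Arr C \<Longrightarrow> wval (lu f) = lunit C f"
  and wval_ru [simp]: "f \<in> Arr C \<Longrightarrow> wval (ru f) = runit C f"
  using valid_lu[of f] valid_ru[of f] by (auto simp: lu_def ru_def)

section \<open>Equational calculus of labelled cells\<close>

lemma vc_assoc [simp]: "(\<chi> \<bullet> \<psi>) \<bullet> \<phi> = \<chi> \<bullet> \<psi> \<bullet> \<phi>"
  by (rule wcell_eqI) (auto intro!: vcomp_assoc dest: validD(1))

lemma vc_wid [simp]: "\<lbrakk>wdom \<phi> = f; wnormal \<phi>\<rbrakk> \<Longrightarrow> \<phi> \<bullet> wid f = \<phi>"
  using vcomp_id[of "wval \<phi>"] validD[of \<phi>]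
  by (intro wcell_eqI) auto

lemma wid_vc [simp]: "\<lbrakk>wcod \<phi> = f; wnormal \<phi>\<rbrakk> \<Longrightarrow> wid f \<bullet> \<phi> = \<phi>"
  using vcomp_id[of "wval \<phi>"] validD[of \<phi>]
  by (intro wcell_eqI) auto

text \<open>Composition with \<open>a\<close> need not be injective on 1-cells, so the right side
  could be valid while the left is not; hence the hypothesis on the labels.\<close>

lemma lw_vc [simp]:
  assumes "wdom \<psi> = wcod \<phi>"
  shows "a \<triangleleft> (\<psi> \<bullet> \<phi>) = (a \<triangleleft> \<psi>) \<bullet> (a \<triangleleft> \<phi>)"
proof (rule wcell_eqI)
  show "valid (a \<triangleleft> (\<psi> \<bullet> \<phi>)) \<longleftrightarrow> valid ((a \<triangleleft> \<psi>) \<bullet> (a \<triangleleft> \<phi>))"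
    using assms validD[of \<phi>] by auto
  assume v: "valid (a \<triangleleft> (\<psi> \<bullet> \<phi>))"
  have "id2 C a \<cdot> id2 C a = id2 C a"
    using v vcomp_id id2_hom by auto
  then show "wval (a \<triangleleft> (\<psi> \<bullet> \<phi>)) = wval ((a \<triangleleft> \<psi>) \<bullet> (a \<triangleleft> \<phi>))"
    using v assms validD[of \<phi>] validD[of \<psi>]
      interchange[of "wval \<phi>" "wdom \<phi>" "wcod \<phi>" "wval \<psi>" "wcod \<psi>" "id2 C a" a a "id2 C a" a] id2_hom[of a]
    by simp
qed (use assms in auto)

lemma rw_vc [simp]:
  assumes "wdom \<psi> = wcod \<phi>"
  shows "(\<psi> \<bullet> \<phi>) \<triangleright> h = (\<psi> \<triangleright> h) \<bullet> (\<phi> \<triangleright> h)"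
proof (rule wcell_eqI)
  show "valid ((\<psi> \<bullet> \<phi>) \<triangleright> h) \<longleftrightarrow> valid ((\<psi> \<triangleright> h) \<bullet> (\<phi> \<triangleright> h))"
    using assms validD[of \<phi>] by auto
  assume v: "valid ((\<psi> \<bullet> \<phi>) \<triangleright> h)"
  have "id2 C h \<cdot> id2 C h = id2 C h"
    using v vcomp_id id2_hom by auto
  then show "wval ((\<psi> \<bullet> \<phi>) \<triangleright> h) = wval ((\<psi> \<triangleright> h) \<bullet> (\<phi> \<triangleright> h))"
    using v assms validD[of \<phi>] validD[of \<psi>] id2_hom[of h]
      interchange[of "id2 C h" h h "id2 C h" h "wval \<phi>" "wdom \<phi>" "wcod \<phi>" "wval \<psi>" "wcod \<psi>"]
    by simp
qed (use assms in auto)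

lemma lw_wid [simp]: "\<lbrakk>a \<in> Arr C; f \<in> Arr C; src C a = trg C f\<rbrakk> \<Longrightarrow> a \<triangleleft> wid f = wid (a \<odot> f)"
  by (rule wcell_eqI) (auto simp: hcomp_id hom1_iff)

lemma rw_wid [simp]: "\<lbrakk>a \<in> Arr C; f \<in> Arr C; src C a = trg C f\<rbrakk> \<Longrightarrow> wid a \<triangleright> f = wid (a \<odot> f)"
  by (rule wcell_eqI) (auto simp: hcomp_id hom1_iff)

text \<open>Either order of whiskering computes the horizontal composite of \<open>\<psi>\<close>
  and \<open>\<phi>\<close>.\<close>

lemma whisker_interchange:
  assumes "wdom \<psi> = a" "wcod \<psi> = b" "wdom \<phi> = f" "wcod \<phi> = g"
  shows "(\<psi> \<triangleright> g) \<bullet> (a \<triangleleft> \<phi>) = (b \<triangleleft> \<phi>) \<bullet> (\<psi> \<triangleright> f)"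
proof (rule wcell_eqI)
  show "valid ((\<psi> \<triangleright> g) \<bullet> (a \<triangleleft> \<phi>)) \<longleftrightarrow> valid ((b \<triangleleft> \<phi>) \<bullet> (\<psi> \<triangleright> f))"
    using assms validD[of \<phi>] validD[of \<psi>] by auto
  assume "valid ((\<psi> \<triangleright> g) \<bullet> (a \<triangleleft> \<phi>))"
  then have v: "valid \<psi>" "valid \<phi>" "src C a = trg C f"
    using assms validD[of \<phi>] validD[of \<psi>] by auto
  note t = validD[OF v(1)] validD[OF v(2)]
  have "(wval \<psi> \<cdot> id2 C a) \<star> (id2 C g \<cdot> wval \<phi>) = (id2 C b \<cdot> wval \<psi>) \<star> (wval \<phi> \<cdot> id2 C f)"
    using t assms vcomp_id by simp
  then show "wval ((\<psi> \<triangleright> g) \<bullet> (a \<triangleleft> \<phi>)) = wval ((b \<triangleleft> \<phi>) \<bullet> (\<psi> \<triangleright> f))"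
    using v t assms interchange[of "wval \<phi>" f g "id2 C g" g "id2 C a" a a "wval \<psi>" b] id2_hom
      interchange[of "id2 C f" f f "wval \<phi>" g "wval \<psi>" a b "id2 C b" b] by simp
qed (use assms in auto)

text \<open>Letting one argument of the associator vary at a time gives rewrite rules free of
  identity 2-cells; the next two lemmas treat the other arguments.\<close>

lemma as_natural:
  assumes "wdom \<chi> = h" "wcod \<chi> = h'"
  shows "as a b h' \<bullet> ((a \<odot> b) \<triangleleft> \<chi>) = (a \<triangleleft> b \<triangleleft> \<chi>) \<bullet> as a b h"
proof (rule wcell_eqI)
  show "valid (as a b h' \<bullet> ((a \<odot> b) \<triangleleft> \<chi>)) \<longleftrightarrow> valid ((a \<triangleleft> b \<triangleleft> \<chi>) \<bullet> as a b h)"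
    using assms validD[of \<chi>] by (auto simp: comp3_def)
  assume "valid (as a b h' \<bullet> ((a \<odot> b) \<triangleleft> \<chi>))"
  then have "valid \<chi>" "comp3 a b h" "comp3 a b h'"
    using assms validD[of \<chi>] by (auto simp: comp3_def)
  then show "wval (as a b h' \<bullet> ((a \<odot> b) \<triangleleft> \<chi>)) = wval ((a \<triangleleft> b \<triangleleft> \<chi>) \<bullet> as a b h)"
    using assms validD[of \<chi>] assoc_natural[of "wval \<chi>" h h' "id2 C b" b b "id2 C a" a a]
      id2_hom hcomp_id[of b "src C b" "trg C b" a "trg C a"]
    by (auto simp: comp3_def hom1_iff)
qed (use assms in auto)

lemma as_natural_mid:
  assumes "wdom \<chi> = b" "wcod \<chi> = b'"
  shows "as a b' h \<bullet> ((a \<triangleleft> \<chi>) \<triangleright> h) = (a \<triangleleft> (\<chi> \<triangleright> h)) \<bullet> as a b h"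
proof (rule wcell_eqI)
  show "valid (as a b' h \<bullet> ((a \<triangleleft> \<chi>) \<triangleright> h)) \<longleftrightarrow> valid ((a \<triangleleft> (\<chi> \<triangleright> h)) \<bullet> as a b h)"
    using assms validD[of \<chi>] by (auto simp: comp3_def)
  assume "valid (as a b' h \<bullet> ((a \<triangleleft> \<chi>) \<triangleright> h))"
  then have "valid \<chi>" "comp3 a b h" "comp3 a b' h"
    using assms validD[of \<chi>] by (auto simp: comp3_def)
  then show "wval (as a b' h \<bullet> ((a \<triangleleft> \<chi>) \<triangleright> h)) = wval ((a \<triangleleft> (\<chi> \<triangleright> h)) \<bullet> as a b h)"
    using assms validD[of \<chi>] assoc_natural[of "id2 C h" h h "wval \<chi>" b b' "id2 C a" a a]
      id2_hom by (auto simp: comp3_def)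
qed (use assms in auto)

lemma as_natural_left:
  assumes "wdom \<chi> = a" "wcod \<chi> = a'"
  shows "as a' b h \<bullet> ((\<chi> \<triangleright> b) \<triangleright> h) = (\<chi> \<triangleright> (b \<odot> h)) \<bullet> as a b h"
proof (rule wcell_eqI)
  show "valid (as a' b h \<bullet> ((\<chi> \<triangleright> b) \<triangleright> h)) \<longleftrightarrow> valid ((\<chi> \<triangleright> (b \<odot> h)) \<bullet> as a b h)"
    using assms validD[of \<chi>] by (auto simp: comp3_def)
  assume "valid (as a' b h \<bullet> ((\<chi> \<triangleright> b) \<triangleright> h))"
  then have "valid \<chi>" "comp3 a b h" "comp3 a' b h"
    using assms validD[of \<chi>] by (auto simp: comp3_def)
  then show "wval (as a' b h \<bullet> ((\<chi> \<triangleright> b) \<triangleright> h)) = wval ((\<chi> \<triangleright> (b \<odot> h)) \<bullet> as a b h)"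
    using assms validD[of \<chi>] assoc_natural[of "id2 C h" h h "id2 C b" b b "wval \<chi>" a a']
      id2_hom hcomp_id[of h "src C h" "trg C h" b "trg C b"] by (auto simp: comp3_def hom1_iff)
qed (use assms in auto)

lemma lu_natural:
  assumes "valid \<phi>" "wdom \<phi> = f" "wcod \<phi> = g"
  shows "lu g \<bullet> (id1 C (trg C f) \<triangleleft> \<phi>) = \<phi> \<bullet> lu f"
  using assms validD[of \<phi>] lunit_natural[of f "src C f" "trg C f" "wval \<phi>" g]
  by (intro wcell_eqI) (auto simp: hom1_iff)

lemma ru_natural:
  assumes "valid \<phi>" "wdom \<phi> = f" "wcod \<phi> = g"
  shows "ru g \<bullet> (\<phi> \<triangleright> id1 C (src C f)) = \<phi> \<bullet> ru f"
  using assms validD[of \<phi>] runit_natural[of f "src C f" "trg C f" "wval \<phi>" g]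
  by (intro wcell_eqI) (auto simp: hom1_iff)

lemma pentagon_as:
  assumes "comp3 k h g" "comp3 h g f"
  shows "as k h (g \<odot> f) \<bullet> as (k \<odot> h) g f
    = (k \<triangleleft> as h g f) \<bullet> as k (h \<odot> g) f \<bullet> (as k h g \<triangleright> f)"
  using assms pentagon[of f "src C f" "src C g" g "src C h" h "src C k" k "trg C k"]
  by (intro wcell_eqI) (auto simp: comp3_def hom1_iff)

lemma triangle_as:
  assumes "g \<in> Arr C" "f \<in> Arr C" "src C g = X" "trg C f = X"
  shows "(g \<triangleleft> lu f) \<bullet> as g (id1 C X) f = ru g \<triangleright> f"
  using assms triangle[of f "src C f" X g "trg C g"] src_trg[of g]
  by (intro wcell_eqI) (auto simp: comp3_def hom1_iff)

lemma winv_left [simp]: "wiso \<phi> \<Longrightarrow> winv \<phi> \<bullet> \<phi> = wid (wdom \<phi>)"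
  using wiso_inverse2[of \<phi>] wiso_valid[of \<phi>] validD[of \<phi>]
  by (intro wcell_eqI) (auto simp: inverse2_def wval_winv dom2_wval)

lemma winv_right [simp]: "wiso \<phi> \<Longrightarrow> \<phi> \<bullet> winv \<phi> = wid (wcod \<phi>)"
  using wiso_inverse2[of \<phi>] wiso_valid[of \<phi>] validD[of \<phi>]
  by (intro wcell_eqI) (auto simp: inverse2_def wval_winv cod2_wval)

lemma winv_left_tail [simp]:
  "\<lbrakk>wiso \<phi>; wcod x = wdom \<phi>; wnormal x\<rbrakk> \<Longrightarrow> winv \<phi> \<bullet> \<phi> \<bullet> x = x"
  by (simp flip: vc_assoc)

lemma winv_right_tail [simp]:
  "\<lbrakk>wiso \<phi>; wcod x = wcod \<phi>; wnormal x\<rbrakk> \<Longrightarrow> \<phi> \<bullet> winv \<phi> \<bullet> x = x"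
  by (simp flip: vc_assoc)

text \<open>One two-sided inverse both shows invertibility and computes \<open>winv\<close>. The
  closure rules for composition, whiskering, inverses and identities come from it.\<close>

lemma wiso_winvI:
  assumes "valid \<phi>" "valid \<psi>" "wdom \<psi> = wcod \<phi>" "wcod \<psi> = wdom \<phi>"
    "\<psi> \<bullet> \<phi> = wid (wdom \<phi>)" "\<phi> \<bullet> \<psi> = wid (wcod \<phi>)"
  shows "wiso \<phi>" "winv \<phi> = \<psi>"
proof -
  note v = validD[OF assms(1)] validD[OF assms(2)]
  have "wval \<psi> \<cdot> wval \<phi> = id2 C (wdom \<phi>)" "wval \<phi> \<cdot> wval \<psi> = id2 C (wcod \<phi>)"
    using arg_cong[OF assms(5), of wval] arg_cong[OF assms(6), of wval] assms(1-4) v by simp_all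
  then have "inverse2 C (wval \<phi>) (wval \<psi>)"
    using v assms by (auto simp: inverse2_def hom2_def)
  then show "wiso \<phi>" "winv \<phi> = \<psi>"
    using assms v inv2_eq[of "wval \<phi>" "wval \<psi>"]
    by (auto simp: wiso_def iso2_def wval_winv intro!: wcell_eqI valid_wnormal)
qed

lemma wiso_vc [simp]:
  assumes "wiso \<psi>" "wiso \<phi>" "wdom \<psi> = wcod \<phi>"
  shows "wiso (\<psi> \<bullet> \<phi>)" "winv (\<psi> \<bullet> \<phi>) = winv \<phi> \<bullet> winv \<psi>"
  using assms wiso_valid wiso_winvI[of "\<psi> \<bullet> \<phi>" "winv \<phi> \<bullet> winv \<psi>"] by auto

text \<open>Oriented so that \<open>winv\<close> moves outwards past whiskering. Where a definition
  has the inverse inside the whiskering, the rule is switched off with \<open>del\<close>.\<close>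

lemma wiso_lw [simp]:
  assumes "wiso \<phi>" "a \<in> Arr C" "src C a = trg C (wdom \<phi>)"
  shows "wiso (a \<triangleleft> \<phi>)" "a \<triangleleft> winv \<phi> = winv (a \<triangleleft> \<phi>)"
  using assms wiso_valid[of \<phi>] validD[of \<phi>] wiso_winvI[of "a \<triangleleft> \<phi>" "a \<triangleleft> winv \<phi>"]
  by (auto simp flip: lw_vc)

lemma wiso_rw [simp]:
  assumes "wiso \<phi>" "h \<in> Arr C" "src C (wdom \<phi>) = trg C h"
  shows "wiso (\<phi> \<triangleright> h)" "winv \<phi> \<triangleright> h = winv (\<phi> \<triangleright> h)"
  using assms wiso_valid[of \<phi>] validD[of \<phi>] wiso_winvI[of "\<phi> \<triangleright> h" "winv \<phi> \<triangleright> h"]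
  by (auto simp flip: rw_vc)

lemma wiso_winv [simp]: "wiso \<phi> \<Longrightarrow> wiso (winv \<phi>)"
  and winv_winv [simp]: "wiso \<phi> \<Longrightarrow> winv (winv \<phi>) = \<phi>"
  using wiso_winvI[of "winv \<phi>" \<phi>] wiso_valid[of \<phi>] by auto

lemma wiso_wid [simp]: "f \<in> Arr C \<Longrightarrow> wiso (wid f)"
  using wiso_winvI[of "wid f" "wid f"] by auto

lemma vc_left_cancel:
  assumes "\<phi> \<bullet> x = \<phi> \<bullet> y" "wiso \<phi>" "wcod x = wdom \<phi>" "wcod y = wdom \<phi>" "wnormal x" "wnormal y"
  shows "x = y"
  using arg_cong[OF assms(1), of "\<lambda>z. winv \<phi> \<bullet> z"] assms(2-) by simp

lemma vc_right_cancel: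
  assumes "x \<bullet> \<phi> = y \<bullet> \<phi>" "wiso \<phi>" "wdom x = wcod \<phi>" "wdom y = wcod \<phi>" "wnormal x" "wnormal y"
  shows "x = y"
  using arg_cong[OF assms(1), of "\<lambda>z. z \<bullet> winv \<phi>"] assms(2-) by simp

section \<open>Coherence and evaluation at a 1-cell\<close>

text \<open>Since \<open>vc_assoc\<close> nests composites to the right, an equation for
  \<open>\<psi> \<bullet> \<phi>\<close> matches only at the right end of a composite; this form
  also matches in the middle.\<close>

lemma vc_tail: "\<psi> \<bullet> \<phi> = \<chi> \<Longrightarrow> \<psi> \<bullet> \<phi> \<bullet> x = \<chi> \<bullet> x"
  by (metis vc_assoc)

lemma invalid_eqI:
  "\<lbrakk>\<not> valid x; \<not> valid y; wnormal x; wnormal y; wdom x = wdom y; wcod x = wcod y\<rbrakk> \<Longrightarrow> x = y"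
  by (rule wcell_eqI) auto

lemma winv_as_natural:
  assumes "wdom \<chi> = h" "wcod \<chi> = h'"
  shows "winv (as a b h') \<bullet> (a \<triangleleft> b \<triangleleft> \<chi>) = ((a \<odot> b) \<triangleleft> \<chi>) \<bullet> winv (as a b h)"
proof (cases "valid \<chi> \<and> comp3 a b h")
  case True
  then have c: "comp3 a b h'"
    using assms validD[of \<chi>] by (simp add: comp3_def)
  show ?thesis
  proof (rule vc_left_cancel[of "as a b h'"], rule vc_right_cancel[of _ "as a b h"])
    show "(as a b h' \<bullet> winv (as a b h') \<bullet> (a \<triangleleft> b \<triangleleft> \<chi>)) \<bullet> as a b h
      = (as a b h' \<bullet> ((a \<odot> b) \<triangleleft> \<chi>) \<bullet> winv (as a b h)) \<bullet> as a b h"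
      using True c assms as_natural[OF assms] by simp
  qed (use True c assms in auto)
next
  \<comment> \<open>One ill-typed ingredient makes both sides invalid, and invalid normal cells with
    the same labels coincide.\<close>
  case False
  show ?thesis
    using False assms validD[of \<chi>] by (intro invalid_eqI) (auto simp: comp3_def)
qed

section \<open>Coherence of the unit isomorphisms\<close>

text \<open>Naturality of \<open>lu\<close> makes whiskering by an identity 1-cell isomorphic to
  doing nothing, hence faithful.\<close>

lemma id1_lw_cancel:
  assumes "id1 C Y \<triangleleft> x = id1 C Y \<triangleleft> y" "valid x" "valid y" "wdom x = wdom y" "wcod x = wcod y"
    "trg C (wdom x) = Y"
  shows "x = y"
proof -
  have "x \<bullet> lu (wdom x) = y \<bullet> lu (wdom x)"
    using assms lu_natural[of x] lu_natural[of y] by metis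
  then show ?thesis
    using assms validD by (intro vc_right_cancel[of x "lu (wdom x)" y]) auto
qed

lemma id1_rw_cancel:
  assumes "x \<triangleright> id1 C X = y \<triangleright> id1 C X" "valid x" "valid y" "wdom x = wdom y" "wcod x = wcod y"
    "src C (wdom x) = X"
  shows "x = y"
proof -
  have "x \<bullet> ru (wdom x) = y \<bullet> ru (wdom x)"
    using assms ru_natural[of x] ru_natural[of y] by metis
  then show ?thesis
    using assms validD by (intro vc_right_cancel[of x "ru (wdom x)" y]) auto
qed

text \<open>Whiskered by the identity 1-cell, the two sides become boundaries of a pentagon filled
  by the triangle identities for \<open>lu f\<close> and \<open>lu (f \<odot> k)\<close> and by
  naturality of the associator; the whiskering is then cancelled.\<close>

lemma lu_comp:
  assumes [simp]: "f \<in> Arr C" "k \<in> Arr C" "src C f = trg C k" and Y: "trg C f = Y"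
  shows "lu (f \<odot> k) \<bullet> as (id1 C Y) f k = lu f \<triangleright> k"
proof -
  let ?I = "id1 C Y"
  have [simp]: "Y \<in> Obj C" using Y by auto
  have c [simp]: "comp3 ?I ?I f" "comp3 ?I f k" "comp3 ?I (?I \<odot> f) k" "comp3 ?I ?I (f \<odot> k)"
    "comp3 (?I \<odot> ?I) f k"
    using Y by (auto simp: comp3_def)
  have "(?I \<triangleleft> (lu (f \<odot> k) \<bullet> as ?I f k)) \<bullet> as ?I (?I \<odot> f) k \<bullet> (as ?I ?I f \<triangleright> k)
    = (?I \<triangleleft> lu (f \<odot> k)) \<bullet> as ?I ?I (f \<odot> k) \<bullet> as (?I \<odot> ?I) f k"
    using Y pentagon_as[of ?I ?I f k] by simp
  also have "\<dots> = (ru ?I \<triangleright> (f \<odot> k)) \<bullet> as (?I \<odot> ?I) f k"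
    using Y triangle_as[of ?I "f \<odot> k" Y] by (simp flip: vc_assoc)
  also have "\<dots> = as ?I f k \<bullet> ((ru ?I \<triangleright> f) \<triangleright> k)"
    using Y by (simp add: as_natural_left)
  also have "\<dots> = as ?I f k \<bullet> ((?I \<triangleleft> lu f) \<triangleright> k) \<bullet> (as ?I ?I f \<triangleright> k)"
    using Y triangle_as[of ?I f Y] by (simp flip: rw_vc)
  also have "\<dots> = (?I \<triangleleft> (lu f \<triangleright> k)) \<bullet> as ?I (?I \<odot> f) k \<bullet> (as ?I ?I f \<triangleright> k)"
    using Y as_natural_mid[of "lu f", THEN vc_tail] by simp
  finally have "?I \<triangleleft> (lu (f \<odot> k) \<bullet> as ?I f k) = ?I \<triangleleft> (lu f \<triangleright> k)"
    by (rule vc_right_cancel) (use Y in auto)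
  then show ?thesis
    by (rule id1_lw_cancel) (use Y in auto)
qed

text \<open>The mirror image of \<open>lu_comp\<close>: the identity 1-cell fills the last two
  places of the pentagon, and the cancelled whiskering is on the right.\<close>

lemma ru_comp:
  assumes [simp]: "g \<in> Arr C" "f \<in> Arr C" "src C g = trg C f" and X: "src C f = X"
  shows "ru (g \<odot> f) = (g \<triangleleft> ru f) \<bullet> as g f (id1 C X)"
proof -
  let ?I = "id1 C X"
  have [simp]: "X \<in> Obj C" using X by auto
  have c [simp]: "comp3 g f ?I" "comp3 f ?I ?I" "comp3 g (f \<odot> ?I) ?I" "comp3 g f (?I \<odot> ?I)"
    "comp3 (g \<odot> f) ?I ?I"
    using X by (auto simp: comp3_def)
  have "as g f ?I \<bullet> (ru (g \<odot> f) \<triangleright> ?I) = as g f ?I \<bullet> ((g \<odot> f) \<triangleleft> lu ?I) \<bullet> as (g \<odot> f) ?I ?I"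
    using X triangle_as[of "g \<odot> f" ?I X] by simp
  also have "\<dots> = (g \<triangleleft> f \<triangleleft> lu ?I) \<bullet> as g f (?I \<odot> ?I) \<bullet> as (g \<odot> f) ?I ?I"
    using as_natural[of "lu ?I", THEN vc_tail] by simp
  also have "\<dots> = (g \<triangleleft> ((f \<triangleleft> lu ?I) \<bullet> as f ?I ?I)) \<bullet> as g (f \<odot> ?I) ?I \<bullet> (as g f ?I \<triangleright> ?I)"
    using pentagon_as[of g f ?I ?I] by simp
  also have "\<dots> = (g \<triangleleft> (ru f \<triangleright> ?I)) \<bullet> as g (f \<odot> ?I) ?I \<bullet> (as g f ?I \<triangleright> ?I)"
    using X triangle_as[of f ?I X] by simp
  also have "\<dots> = as g f ?I \<bullet> (((g \<triangleleft> ru f) \<bullet> as g f ?I) \<triangleright> ?I)"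
    using X as_natural_mid[of "ru f", THEN vc_tail, symmetric] by simp
  finally have "ru (g \<odot> f) \<triangleright> ?I = ((g \<triangleleft> ru f) \<bullet> as g f ?I) \<triangleright> ?I"
    by (rule vc_left_cancel) (use X in auto)
  then show ?thesis
    by (rule id1_rw_cancel) (use X in auto)
qed

lemma lu_id1:
  assumes [simp]: "X \<in> Obj C"
  shows "lu (id1 C X) = ru (id1 C X)"
proof -
  let ?I = "id1 C X"
  have [simp]: "comp3 ?I ?I ?I" by (simp add: comp3_def)
  \<comment> \<open>Naturality of \<open>ru\<close> at its own component \<open>ru ?I\<close>, which
    is then cancelled.\<close>
  have "ru ?I \<bullet> (ru ?I \<triangleright> ?I) = ru ?I \<bullet> ru (?I \<odot> ?I)"
    using ru_natural[of "ru ?I", OF _ refl refl] by simp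
  then have "ru ?I \<triangleright> ?I = ru (?I \<odot> ?I)"
    by (rule vc_left_cancel) auto
  then have "(?I \<triangleleft> lu ?I) \<bullet> as ?I ?I ?I = (?I \<triangleleft> ru ?I) \<bullet> as ?I ?I ?I"
    using ru_comp[of ?I ?I X] triangle_as[of ?I ?I X] by simp
  then have "?I \<triangleleft> lu ?I = ?I \<triangleleft> ru ?I"
    by (rule vc_right_cancel) auto
  then show ?thesis
    by (rule id1_lw_cancel) auto
qed

text \<open>For \<open>\<phi> : a \<odot> b \<rightarrow> c \<odot> d\<close>, \<open>\<phi> : 1 \<rightarrow> c \<odot> d\<close> and \<open>\<phi> : a \<odot> b \<rightarrow> 1\<close>,
  the component at \<open>h\<close> between right-nested composites.\<close>

definition nt where
  "nt a b c d \<phi> h = as c d h \<bullet> (\<phi> \<triangleright> h) \<bullet> winv (as a b h)"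

definition nt02 where
  "nt02 c d \<phi> h = as c d h \<bullet> (\<phi> \<triangleright> h) \<bullet> winv (lu h)"

definition nt20 where
  "nt20 a b \<phi> h = lu h \<bullet> (\<phi> \<triangleright> h) \<bullet> winv (as a b h)"

text \<open>Compares whiskering a right-nested triple by \<open>k\<close> with the right-nested
  quadruple. Every passage from a component at \<open>h\<close> to one at \<open>h \<odot> k\<close>
  goes through it.\<close>

definition as2 where
  "as2 a b h k = (a \<triangleleft> as b h k) \<bullet> as a (b \<odot> h) k"

lemma nt_simps [simp]:
  "wdom (nt a b c d \<phi> h) = a \<odot> b \<odot> h" "wcod (nt a b c d \<phi> h) = c \<odot> d \<odot> h" "wnormal (nt a b c d \<phi> h)"
  "wdom (nt02 c d \<phi> h) = h" "wcod (nt02 c d \<phi> h) = c \<odot> d \<odot> h" "wnormal (nt02 c d \<phi> h)"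
  "wdom (nt20 a b \<phi> h) = a \<odot> b \<odot> h" "wcod (nt20 a b \<phi> h) = h" "wnormal (nt20 a b \<phi> h)"
  "wdom (as2 a b h k) = (a \<odot> b \<odot> h) \<odot> k" "wcod (as2 a b h k) = a \<odot> b \<odot> h \<odot> k" "wnormal (as2 a b h k)"
  by (simp_all add: nt_def nt02_def nt20_def as2_def)

lemma wiso_as2 [simp]:
  "\<lbrakk>comp3 a b h; k \<in> Arr C; src C h = trg C k\<rbrakk> \<Longrightarrow> wiso (as2 a b h k)"
  by (auto simp: as2_def comp3_def)

lemma wiso_nt:
  assumes "wiso \<phi>" "wdom \<phi> = a \<odot> b" "wcod \<phi> = c \<odot> d" "comp3 a b h" "comp3 c d h"
  shows "wiso (nt a b c d \<phi> h)" "winv (nt a b c d \<phi> h) = nt c d a b (winv \<phi>) h"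
  using assms by (auto simp: nt_def comp3_def)

lemma valid_nt02:
  assumes "valid \<phi>" "wdom \<phi> = id1 C X" "wcod \<phi> = c \<odot> d" "h \<in> Arr C" "trg C h = X" "comp3 c d h"
  shows "valid (nt02 c d \<phi> h)"
  using assms trg_obj[of h] by (auto simp: nt02_def comp3_def)

lemma wiso_nt02:
  assumes "wiso \<phi>" "wdom \<phi> = id1 C X" "wcod \<phi> = c \<odot> d" "h \<in> Arr C" "trg C h = X" "comp3 c d h"
  shows "wiso (nt02 c d \<phi> h)" "winv (nt02 c d \<phi> h) = nt20 c d (winv \<phi>) h"
  using assms trg_obj[of h] by (auto simp: nt02_def nt20_def comp3_def)

lemma valid_nt20:
  assumes "valid \<phi>" "wcod \<phi> = id1 C X" "wdom \<phi> = a \<odot> b" "h \<in> Arr C" "trg C h = X" "comp3 a b h"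
  shows "valid (nt20 a b \<phi> h)"
  using assms trg_obj[of h] by (auto simp: nt20_def comp3_def)

lemma wiso_nt20:
  assumes "wiso \<phi>" "wcod \<phi> = id1 C X" "wdom \<phi> = a \<odot> b" "h \<in> Arr C" "trg C h = X" "comp3 a b h"
  shows "wiso (nt20 a b \<phi> h)"
  using assms trg_obj[of h] by (auto simp: nt20_def comp3_def)

section \<open>Naturality of components\<close>

lemma nt_natural:
  assumes "wdom \<phi> = a \<odot> b" "wcod \<phi> = c \<odot> d" "wdom \<chi> = h" "wcod \<chi> = h'"
  shows "nt a b c d \<phi> h' \<bullet> (a \<triangleleft> b \<triangleleft> \<chi>) = (c \<triangleleft> d \<triangleleft> \<chi>) \<bullet> nt a b c d \<phi> h"
proof -
  have "nt a b c d \<phi> h' \<bullet> (a \<triangleleft> b \<triangleleft> \<chi>)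
    = as c d h' \<bullet> (\<phi> \<triangleright> h') \<bullet> ((a \<odot> b) \<triangleleft> \<chi>) \<bullet> winv (as a b h)"
    using assms by (simp add: nt_def winv_as_natural)
  also have "\<dots> = as c d h' \<bullet> ((c \<odot> d) \<triangleleft> \<chi>) \<bullet> (\<phi> \<triangleright> h) \<bullet> winv (as a b h)"
    using assms by (simp add: whisker_interchange[of \<phi>, THEN vc_tail])
  also have "\<dots> = (c \<triangleleft> d \<triangleleft> \<chi>) \<bullet> nt a b c d \<phi> h"
    using assms by (simp add: nt_def as_natural[THEN vc_tail])
  finally show ?thesis .
qed

lemma winv_lu_natural:
  assumes "valid \<chi>" "wdom \<chi> = h" "wcod \<chi> = h'"
  shows "winv (lu h') \<bullet> \<chi> = (id1 C (trg C h) \<triangleleft> \<chi>) \<bullet> winv (lu h)"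
proof (rule vc_left_cancel[of "lu h'"])
  show "lu h' \<bullet> winv (lu h') \<bullet> \<chi> = lu h' \<bullet> (id1 C (trg C h) \<triangleleft> \<chi>) \<bullet> winv (lu h)"
    using assms validD[of \<chi>] lu_natural[of \<chi> h h', THEN vc_tail] by auto
qed (use assms validD[of \<chi>] in auto)

lemma nt02_natural:
  assumes "wdom \<phi> = id1 C X" "wcod \<phi> = c \<odot> d" "valid \<chi>" "wdom \<chi> = h" "wcod \<chi> = h'" "trg C h = X"
  shows "nt02 c d \<phi> h' \<bullet> \<chi> = (c \<triangleleft> d \<triangleleft> \<chi>) \<bullet> nt02 c d \<phi> h"
proof -
  have "nt02 c d \<phi> h' \<bullet> \<chi>
    = as c d h' \<bullet> (\<phi> \<triangleright> h') \<bullet> (id1 C X \<triangleleft> \<chi>) \<bullet> winv (lu h)"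
    using assms by (simp add: nt02_def winv_lu_natural)
  also have "\<dots> = as c d h' \<bullet> ((c \<odot> d) \<triangleleft> \<chi>) \<bullet> (\<phi> \<triangleright> h) \<bullet> winv (lu h)"
    using assms by (simp add: whisker_interchange[of \<phi>, THEN vc_tail])
  also have "\<dots> = (c \<triangleleft> d \<triangleleft> \<chi>) \<bullet> nt02 c d \<phi> h"
    using assms by (simp add: nt02_def as_natural[THEN vc_tail])
  finally show ?thesis .
qed

lemma nt20_natural:
  assumes "wcod \<phi> = id1 C X" "wdom \<phi> = a \<odot> b" "valid \<chi>" "wdom \<chi> = h" "wcod \<chi> = h'" "trg C h = X"
  shows "nt20 a b \<phi> h' \<bullet> (a \<triangleleft> b \<triangleleft> \<chi>) = \<chi> \<bullet> nt20 a b \<phi> h"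
proof -
  have "nt20 a b \<phi> h' \<bullet> (a \<triangleleft> b \<triangleleft> \<chi>)
    = lu h' \<bullet> (\<phi> \<triangleright> h') \<bullet> ((a \<odot> b) \<triangleleft> \<chi>) \<bullet> winv (as a b h)"
    using assms by (simp add: nt20_def winv_as_natural)
  also have "\<dots> = lu h' \<bullet> (id1 C X \<triangleleft> \<chi>) \<bullet> (\<phi> \<triangleright> h) \<bullet> winv (as a b h)"
    using assms by (simp add: whisker_interchange[of \<phi>, THEN vc_tail])
  also have "\<dots> = \<chi> \<bullet> nt20 a b \<phi> h"
    using assms lu_natural[of \<chi> h h', THEN vc_tail] by (simp add: nt20_def)
  finally show ?thesis .
qed

section \<open>Components at composites and under whiskering\<close>

lemma as2_as:
  assumes "comp3 a b h" "k \<in> Arr C" "src C h = trg C k"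
  shows "as2 a b h k \<bullet> (as a b h \<triangleright> k) = as a b (h \<odot> k) \<bullet> as (a \<odot> b) h k"
  using assms pentagon_as[of a b h k] by (simp add: as2_def comp3_def)

lemma as_winv_as:
  assumes "comp3 a b h" "k \<in> Arr C" "src C h = trg C k"
  shows "as (a \<odot> b) h k \<bullet> winv (as a b h \<triangleright> k) = winv (as a b (h \<odot> k)) \<bullet> as2 a b h k"
proof -
  have c [simp]: "comp3 a b (h \<odot> k)" "comp3 (a \<odot> b) h k" "wiso (as a b h \<triangleright> k)"
    using assms by (auto simp: comp3_def)
  have "as (a \<odot> b) h k \<bullet> winv (as a b h \<triangleright> k) = winv (as a b (h \<odot> k)) \<bullet> as2 a b h k"
  proof (rule vc_right_cancel[of _ "as a b h \<triangleright> k"])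
    show "(as (a \<odot> b) h k \<bullet> winv (as a b h \<triangleright> k)) \<bullet> (as a b h \<triangleright> k)
      = (winv (as a b (h \<odot> k)) \<bullet> as2 a b h k) \<bullet> (as a b h \<triangleright> k)"
      unfolding vc_assoc as2_as[OF assms] winv_left[OF c(3)] by simp
  qed auto
  then show ?thesis
    using assms by (simp add: comp3_def)
qed

text \<open>Because the associator is natural in its first argument, families of components respect
  whiskering on the right. This carries an axiom stated at particular 1-cells to an arbitrary
  \<open>k\<close>.\<close>

lemma nt_rw:
  assumes "wdom \<phi> = a \<odot> b" "wcod \<phi> = c \<odot> d" "comp3 a b h" "comp3 c d h" "k \<in> Arr C" "src C h = trg C k"
  shows "as2 c d h k \<bullet> (nt a b c d \<phi> h \<triangleright> k) = nt a b c d \<phi> (h \<odot> k) \<bullet> as2 a b h k"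
proof -
  have "as2 c d h k \<bullet> (nt a b c d \<phi> h \<triangleright> k)
    = as c d (h \<odot> k) \<bullet> as (c \<odot> d) h k \<bullet> ((\<phi> \<triangleright> h) \<triangleright> k) \<bullet> winv (as a b h \<triangleright> k)"
    using assms by (simp add: nt_def as2_as[THEN vc_tail])
  also have "\<dots> = as c d (h \<odot> k) \<bullet> (\<phi> \<triangleright> (h \<odot> k)) \<bullet> as (a \<odot> b) h k \<bullet> winv (as a b h \<triangleright> k)"
    using assms by (simp add: as_natural_left[of \<phi>, THEN vc_tail])
  also have "\<dots> = nt a b c d \<phi> (h \<odot> k) \<bullet> as2 a b h k"
    using assms by (simp add: nt_def as_winv_as)
  finally show ?thesis .
qed

lemma as_winv_lu:
  assumes "h \<in> Arr C" "k \<in> Arr C" "src C h = trg C k" "trg C h = X"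
  shows "as (id1 C X) h k \<bullet> winv (lu h \<triangleright> k) = winv (lu (h \<odot> k))"
proof -
  have c [simp]: "X \<in> Obj C" "comp3 (id1 C X) h k" "wiso (lu h \<triangleright> k)"
    using assms by (auto simp: comp3_def)
  have "lu (h \<odot> k) \<bullet> as (id1 C X) h k \<bullet> winv (lu h \<triangleright> k) = wid (h \<odot> k)"
    using assms lu_comp[of h k X, THEN vc_tail, of "winv (lu h \<triangleright> k)"] winv_right[OF c(3)] by simp
  then have "winv (lu (h \<odot> k)) \<bullet> lu (h \<odot> k) \<bullet> as (id1 C X) h k \<bullet> winv (lu h \<triangleright> k) = winv (lu (h \<odot> k))"
    using assms by simp
  then show ?thesis
    using assms by simp
qed

lemma nt02_rw:
  assumes "wdom \<phi> = id1 C X" "wcod \<phi> = c \<odot> d" "trg C h = X" "comp3 c d h" "k \<in> Arr C" "src C h = trg C k"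
  shows "as2 c d h k \<bullet> (nt02 c d \<phi> h \<triangleright> k) = nt02 c d \<phi> (h \<odot> k)"
proof -
  have h: "h \<in> Arr C" "X \<in> Obj C" using assms by (auto simp: comp3_def)
  have "as2 c d h k \<bullet> (nt02 c d \<phi> h \<triangleright> k)
    = as c d (h \<odot> k) \<bullet> as (c \<odot> d) h k \<bullet> ((\<phi> \<triangleright> h) \<triangleright> k) \<bullet> winv (lu h \<triangleright> k)"
    using assms h by (simp add: nt02_def as2_as[THEN vc_tail])
  also have "\<dots> = as c d (h \<odot> k) \<bullet> (\<phi> \<triangleright> (h \<odot> k)) \<bullet> as (id1 C X) h k \<bullet> winv (lu h \<triangleright> k)"
    using assms by (simp add: as_natural_left[of \<phi>, THEN vc_tail])
  also have "\<dots> = nt02 c d \<phi> (h \<odot> k)"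
    using assms h by (simp add: nt02_def as_winv_lu)
  finally show ?thesis .
qed

lemma nt20_rw:
  assumes "wcod \<phi> = id1 C X" "wdom \<phi> = a \<odot> b" "trg C h = X" "comp3 a b h" "k \<in> Arr C" "src C h = trg C k"
  shows "nt20 a b \<phi> h \<triangleright> k = nt20 a b \<phi> (h \<odot> k) \<bullet> as2 a b h k"
proof -
  have h: "h \<in> Arr C" "X \<in> Obj C" using assms by (auto simp: comp3_def)
  have "nt20 a b \<phi> h \<triangleright> k = (lu h \<triangleright> k) \<bullet> ((\<phi> \<triangleright> h) \<triangleright> k) \<bullet> winv (as a b h \<triangleright> k)"
    using assms by (simp add: nt20_def)
  also have "\<dots> = lu (h \<odot> k) \<bullet> as (id1 C X) h k \<bullet> ((\<phi> \<triangleright> h) \<triangleright> k) \<bullet> winv (as a b h \<triangleright> k)"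
    using assms h by (simp flip: lu_comp)
  also have "\<dots> = lu (h \<odot> k) \<bullet> (\<phi> \<triangleright> (h \<odot> k)) \<bullet> as (a \<odot> b) h k \<bullet> winv (as a b h \<triangleright> k)"
    using assms by (simp add: as_natural_left[of \<phi>, THEN vc_tail])
  also have "\<dots> = nt20 a b \<phi> (h \<odot> k) \<bullet> as2 a b h k"
    using assms by (simp add: nt20_def as_winv_as)
  finally show ?thesis .
qed

text \<open>Evaluates at \<open>k\<close> a factor of an axiom in which the cell already stands to
  the right of a 1-cell \<open>x\<close>.\<close>

lemma nt_lw_rw:
  assumes "wdom \<phi> = a \<odot> b" "wcod \<phi> = c \<odot> d" "comp3 a b k" "x \<in> Arr C" "src C x = trg C a"
  shows "as2 x c d k \<bullet> ((x \<triangleleft> \<phi>) \<triangleright> k) = (x \<triangleleft> nt a b c d \<phi> k) \<bullet> as2 x a b k"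
  using assms by (simp add: as2_def nt_def as_natural_mid)

text \<open>The triangle identity exchanges the right unitor of \<open>x\<close> found in the raw
  axioms for the left unitor of \<open>k\<close> contained in \<open>nt20\<close>.\<close>

lemma nt20_lw_rw:
  assumes "wdom \<phi> = a \<odot> b" "wcod \<phi> = id1 C X" "comp3 a b k" "x \<in> Arr C" "src C x = X" "trg C k = X" "trg C a = X"
  shows "(ru x \<bullet> (x \<triangleleft> \<phi>)) \<triangleright> k = (x \<triangleleft> nt20 a b \<phi> k) \<bullet> as2 x a b k"
proof -
  have k: "k \<in> Arr C" "X \<in> Obj C" using assms by (auto simp: comp3_def)
  have "(ru x \<bullet> (x \<triangleleft> \<phi>)) \<triangleright> k = (x \<triangleleft> lu k) \<bullet> as x (id1 C X) k \<bullet> ((x \<triangleleft> \<phi>) \<triangleright> k)"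
    using assms k triangle_as[of x k X, THEN vc_tail] by simp
  also have "\<dots> = (x \<triangleleft> (lu k \<bullet> (\<phi> \<triangleright> k))) \<bullet> as x (a \<odot> b) k"
    using assms k by (simp add: as_natural_mid)
  also have "\<dots> = (x \<triangleleft> (nt20 a b \<phi> k \<bullet> as a b k)) \<bullet> as x (a \<odot> b) k"
    using assms k by (simp add: nt20_def)
  finally show ?thesis
    using assms by (simp add: as2_def)
qed

lemma nt02_lw_rw:
  assumes "wdom \<phi> = id1 C X" "wcod \<phi> = c \<odot> d" "comp3 c d k" "x \<in> Arr C" "src C x = X" "trg C k = X" "trg C c = X"
  shows "as2 x c d k \<bullet> (((x \<triangleleft> \<phi>) \<bullet> winv (ru x)) \<triangleright> k) = x \<triangleleft> nt02 c d \<phi> k"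
proof -
  have k: "k \<in> Arr C" "X \<in> Obj C" "comp3 x (id1 C X) k" using assms by (auto simp: comp3_def)
  \<comment> \<open>The triangle identity for inverse unitors, which plays the same role as in
    \<open>nt20_lw_rw\<close>.\<close>
  have "as x (id1 C X) k \<bullet> winv (ru x \<triangleright> k) = x \<triangleleft> winv (lu k)"
    using assms k by (simp flip: triangle_as)
  then have "(x \<triangleleft> as c d k) \<bullet> (x \<triangleleft> (\<phi> \<triangleright> k)) \<bullet> as x (id1 C X) k \<bullet> winv (ru x \<triangleright> k)
    = x \<triangleleft> nt02 c d \<phi> k"
    using assms k by (simp add: nt02_def)
  then show ?thesis
    using assms k by (simp add: as2_def as_natural_mid[THEN vc_tail])
qed

end

section \<open>Pseudofunctors on components\<close>

context pseudofunctor
begin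

lemma farr_simps [simp]:
  assumes "f \<in> Arr C"
  shows "farr F f \<in> Arr C" "src C (farr F f) = fobj F (src C f)" "trg C (farr F f) = fobj F (trg C f)"
  using farr_hom[of f "src C f" "trg C f"] assms by (auto simp: hom1_iff)

lemma fobj_obj' [simp]: "X \<in> Obj C \<Longrightarrow> fobj F X \<in> Obj C"
  by (rule fobj_obj)

section \<open>Images of labelled cells and the comparison cells\<close>

definition wF where
  "wF \<phi> = W (farr F (wdom \<phi>)) (farr F (wcod \<phi>)) (if valid \<phi> then Some (fcell F (wval \<phi>)) else None)"

definition wm where
  "wm g f = W (farr F g \<odot> farr F f) (farr F (g \<odot> f))
     (if g \<in> Arr C \<and> f \<in> Arr C \<and> src C g = trg C f then Some (fmult F g f) else None)"

definition wu where "wu X = wr (id1 C (fobj F X)) (farr F (id1 C X)) (funit F X)"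

lemma wF_simps [simp]:
  "wdom (wF \<phi>) = farr F (wdom \<phi>)" "wcod (wF \<phi>) = farr F (wcod \<phi>)"
  "wdom (wm g f) = farr F g \<odot> farr F f" "wcod (wm g f) = farr F (g \<odot> f)"
  "wdom (wu X) = id1 C (fobj F X)" "wcod (wu X) = farr F (id1 C X)" "wnormal (wu X)"
  by (simp_all add: wF_def wm_def wu_def)

lemma valid_wF [simp]: "valid (wF \<phi>) \<longleftrightarrow> valid \<phi>"
  using validD(1)[of \<phi>] fcell_hom by (auto simp: wF_def)

lemma wval_wF [simp]: "valid \<phi> \<Longrightarrow> wval (wF \<phi>) = fcell F (wval \<phi>)"
  by (simp add: wF_def wval_def)

lemma fmult_iso2:
  "\<lbrakk>g \<in> Arr C; f \<in> Arr C; src C g = trg C f\<rbrakk>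
    \<Longrightarrow> fmult F g f \<in> iso2 C (farr F g \<odot> farr F f) (farr F (g \<odot> f))"
  using fmult_iso[of f "src C f" "trg C f" g "trg C g"] by (simp add: hom1_iff)

lemma valid_wm [simp]: "valid (wm g f) \<longleftrightarrow> g \<in> Arr C \<and> f \<in> Arr C \<and> src C g = trg C f"
  using fmult_iso2[of g f] by (auto simp: wm_def iso2_def)

lemma wval_wm [simp]:
  "\<lbrakk>g \<in> Arr C; f \<in> Arr C; src C g = trg C f\<rbrakk> \<Longrightarrow> wval (wm g f) = fmult F g f"
  by (simp add: wm_def wval_def)

lemma wiso_wm [simp]: "wiso (wm g f) \<longleftrightarrow> g \<in> Arr C \<and> f \<in> Arr C \<and> src C g = trg C f"
  using fmult_iso2[of g f] by (auto simp: wiso_def)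

lemma wiso_wu [simp]: "X \<in> Obj C \<Longrightarrow> wiso (wu X)"
  and valid_wu [simp]: "X \<in> Obj C \<Longrightarrow> valid (wu X)"
  and wval_wu [simp]: "X \<in> Obj C \<Longrightarrow> wval (wu X) = funit F X"
  using funit_iso[of X] by (auto simp: wiso_def wu_def iso2_def)

lemma wnormal_wF [simp]: "wnormal (wF \<phi>)" "wnormal (wm g f)"
  unfolding wnormal_def valid_wF valid_wm by (auto simp: wF_def wm_def)

lemma wF_vc [simp]: "wdom \<psi> = wcod \<phi> \<Longrightarrow> wF (\<psi> \<bullet> \<phi>) = wF \<psi> \<bullet> wF \<phi>"
  by (rule wcell_eqI) (auto intro!: fcell_vcomp dest: validD(1))

lemma wF_wid [simp]: "f \<in> Arr C \<Longrightarrow> wF (wid f) = wid (farr F f)"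
  by (rule wcell_eqI) (auto simp: fcell_id)

lemma wiso_wF [simp]:
  assumes "wiso \<phi>"
  shows "wiso (wF \<phi>)" "wF (winv \<phi>) = winv (wF \<phi>)"
  using assms validD[of \<phi>] wiso_winvI[of "wF \<phi>" "wF (winv \<phi>)"] by (auto simp flip: wF_vc)

lemma wm_natural_right:
  assumes "wdom \<chi> = f" "wcod \<chi> = f'"
  shows "wm g f' \<bullet> (farr F g \<triangleleft> wF \<chi>) = wF (g \<triangleleft> \<chi>) \<bullet> wm g f"
proof (rule wcell_eqI)
  show "valid (wm g f' \<bullet> (farr F g \<triangleleft> wF \<chi>)) \<longleftrightarrow> valid (wF (g \<triangleleft> \<chi>) \<bullet> wm g f)"
    using assms validD[of \<chi>] by auto
  assume "valid (wm g f' \<bullet> (farr F g \<triangleleft> wF \<chi>))"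
  then show "wval (wm g f' \<bullet> (farr F g \<triangleleft> wF \<chi>)) = wval (wF (g \<triangleleft> \<chi>) \<bullet> wm g f)"
    using assms validD[of \<chi>] fmult_natural[of "wval \<chi>" f f' "id2 C g" g g] id2_hom[of g]
    by (auto simp: fcell_id)
qed (use assms in auto)

lemma wm_natural_left:
  assumes "wdom \<chi> = g" "wcod \<chi> = g'"
  shows "wm g' f \<bullet> (wF \<chi> \<triangleright> farr F f) = wF (\<chi> \<triangleright> f) \<bullet> wm g f"
proof (rule wcell_eqI)
  show "valid (wm g' f \<bullet> (wF \<chi> \<triangleright> farr F f)) \<longleftrightarrow> valid (wF (\<chi> \<triangleright> f) \<bullet> wm g f)"
    using assms validD(3-6)[of \<chi>] by (cases "valid \<chi>"; cases "f \<in> Arr C") auto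
  assume "valid (wm g' f \<bullet> (wF \<chi> \<triangleright> farr F f))"
  then have "valid (wm g' f)" "valid (wF \<chi>)"
    by (blast dest: valid_vc[THEN iffD1] valid_rw[THEN iffD1])+
  then show "wval (wm g' f \<bullet> (wF \<chi> \<triangleright> farr F f)) = wval (wF (\<chi> \<triangleright> f) \<bullet> wm g f)"
    using assms validD[of \<chi>] fmult_natural[of "id2 C f" f f "wval \<chi>" g g'] id2_hom[of f]
    by (auto simp: fcell_id)
qed (use assms in auto)

lemma wm_as:
  assumes "comp3 h g f"
  shows "wF (as h g f) \<bullet> wm (h \<odot> g) f \<bullet> (wm h g \<triangleright> farr F f)
    = wm h (g \<odot> f) \<bullet> (farr F h \<triangleleft> wm g f) \<bullet> as (farr F h) (farr F g) (farr F f)"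
  using assms fmult_assoc[of f "src C f" "src C g" g "src C h" h "trg C h"]
  by (intro wcell_eqI) (auto simp: comp3_def hom1_iff)

lemma wm_lu:
  assumes "f \<in> Arr C" "trg C f = Y"
  shows "wF (lu f) \<bullet> wm (id1 C Y) f \<bullet> (wu Y \<triangleright> farr F f) = lu (farr F f)"
  using assms trg_obj[of f] fmult_lunit[of f "src C f" "trg C f"]
  by (intro wcell_eqI) (auto simp: comp3_def hom1_iff)

definition wmm where "wmm a b h = wm a (b \<odot> h) \<bullet> (farr F a \<triangleleft> wm b h)"

lemma wmm_simps [simp]:
  "wdom (wmm a b h) = farr F a \<odot> farr F b \<odot> farr F h" "wcod (wmm a b h) = farr F (a \<odot> b \<odot> h)"
  "wnormal (wmm a b h)" "comp3 a b h \<Longrightarrow> wiso (wmm a b h)"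
  by (auto simp: wmm_def comp3_def)

text \<open>Unlike \<open>wmm\<close>, it leaves the last 1-cell untouched, so \<open>h\<close> need
  not lie in the image of \<open>F\<close>; a typical instance is a component of the unit of a
  pseudomonad.\<close>

definition wM where "wM g f h = (wm g f \<triangleright> h) \<bullet> winv (as (farr F g) (farr F f) h)"

lemma wM_simps [simp]:
  "wdom (wM g f h) = farr F g \<odot> farr F f \<odot> h" "wcod (wM g f h) = farr F (g \<odot> f) \<odot> h"
  "wnormal (wM g f h)"
  "\<lbrakk>g \<in> Arr C; f \<in> Arr C; h \<in> Arr C; src C g = trg C f; fobj F (src C f) = trg C h\<rbrakk> \<Longrightarrow> wiso (wM g f h)"
  by (auto simp: wM_def comp3_def)

lemma wM_natural:
  assumes "wdom \<chi> = h" "wcod \<chi> = h'"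
  shows "wM g f h' \<bullet> (farr F g \<triangleleft> farr F f \<triangleleft> \<chi>) = (farr F (g \<odot> f) \<triangleleft> \<chi>) \<bullet> wM g f h"
  using assms by (simp add: wM_def winv_as_natural whisker_interchange[of "wm g f", THEN vc_tail])

lemma wM_rw:
  assumes "g \<in> Arr C" "f \<in> Arr C" "x \<in> Arr C" "h \<in> Arr C" "src C g = trg C f"
    "trg C x = fobj F (src C f)" "src C x = trg C h"
  shows "as (farr F (g \<odot> f)) x h \<bullet> (wM g f x \<triangleright> h) = wM g f (x \<odot> h) \<bullet> as2 (farr F g) (farr F f) x h"
proof -
  have c: "comp3 (farr F g) (farr F f) x" using assms by (simp add: comp3_def)
  show ?thesis
    using assms c as_winv_as[OF c, of h] as_natural_left[of "wm g f", THEN vc_tail] by (simp add: wM_def)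
qed

lemma comp3_farr [simp]: "comp3 a b h \<Longrightarrow> comp3 (farr F a) (farr F b) (farr F h)"
  by (auto simp: comp3_def)

lemma wF_as_wm:
  assumes "comp3 a b h"
  shows "wF (as a b h) \<bullet> wm (a \<odot> b) h
    = wmm a b h \<bullet> as (farr F a) (farr F b) (farr F h) \<bullet> winv (wm a b \<triangleright> farr F h)"
proof (rule vc_right_cancel[of _ "wm a b \<triangleright> farr F h"])
  have "a \<in> Arr C" "b \<in> Arr C" "h \<in> Arr C" "src C a = trg C b" "src C b = trg C h"
    using assms by (auto simp: comp3_def)
  then show "(wF (as a b h) \<bullet> wm (a \<odot> b) h) \<bullet> (wm a b \<triangleright> farr F h)
    = (wmm a b h \<bullet> as (farr F a) (farr F b) (farr F h) \<bullet> winv (wm a b \<triangleright> farr F h)) \<bullet> (wm a b \<triangleright> farr F h)"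
    using assms by (simp add: wm_as wmm_def)
qed (use assms in \<open>auto simp: comp3_def\<close>)

lemma wF_winv_as_wm:
  assumes "comp3 a b h"
  shows "winv (wF (as a b h)) \<bullet> wmm a b h
    = wm (a \<odot> b) h \<bullet> (wm a b \<triangleright> farr F h) \<bullet> winv (as (farr F a) (farr F b) (farr F h))"
proof (rule vc_left_cancel[of "wF (as a b h)"], rule vc_right_cancel[of _ "as (farr F a) (farr F b) (farr F h)"])
  show "(wF (as a b h) \<bullet> winv (wF (as a b h)) \<bullet> wmm a b h) \<bullet> as (farr F a) (farr F b) (farr F h)
    = (wF (as a b h) \<bullet> wm (a \<odot> b) h \<bullet> (wm a b \<triangleright> farr F h)
        \<bullet> winv (as (farr F a) (farr F b) (farr F h))) \<bullet> as (farr F a) (farr F b) (farr F h)"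
    using assms by (simp add: wm_as wmm_def)
qed (use assms in \<open>auto simp: wmm_def comp3_def\<close>)

text \<open>Components go to components: \<open>wF_as_wm\<close> and \<open>wF_winv_as_wm\<close>
  absorb the two associators of \<open>nt\<close> into \<open>wmm\<close>, and the cell between them
  becomes the conjugate of \<open>wF \<phi>\<close> by comparison cells.\<close>

lemma wF_nt:
  assumes "wdom \<phi> = a \<odot> b" "wcod \<phi> = c \<odot> d" "comp3 a b h" "comp3 c d h"
  shows "wF (nt a b c d \<phi> h) \<bullet> wmm a b h
    = wmm c d h \<bullet> nt (farr F a) (farr F b) (farr F c) (farr F d) (winv (wm c d) \<bullet> wF \<phi> \<bullet> wm a b) (farr F h)"
proof -
  have "wF (nt a b c d \<phi> h) \<bullet> wmm a b h = wF (as c d h) \<bullet> wF (\<phi> \<triangleright> h) \<bullet> wm (a \<odot> b) h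
      \<bullet> (wm a b \<triangleright> farr F h) \<bullet> winv (as (farr F a) (farr F b) (farr F h))"
    using assms by (simp add: nt_def wF_winv_as_wm)
  also have "\<dots> = wF (as c d h) \<bullet> wm (c \<odot> d) h \<bullet> (wF \<phi> \<triangleright> farr F h)
      \<bullet> (wm a b \<triangleright> farr F h) \<bullet> winv (as (farr F a) (farr F b) (farr F h))"
    using assms wm_natural_left[of \<phi>, THEN vc_tail] by simp
  also have "\<dots> = wmm c d h \<bullet> as (farr F c) (farr F d) (farr F h) \<bullet> winv (wm c d \<triangleright> farr F h)
      \<bullet> (wF \<phi> \<triangleright> farr F h) \<bullet> (wm a b \<triangleright> farr F h) \<bullet> winv (as (farr F a) (farr F b) (farr F h))"
    using assms wF_as_wm[of c d h, THEN vc_tail] by simp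
  finally show ?thesis
    using assms by (simp add: nt_def) (simp add: comp3_def)
qed

lemma wF_winv_lu:
  assumes "f \<in> Arr C" "trg C f = Y"
  shows "winv (wF (lu f)) = wm (id1 C Y) f \<bullet> (wu Y \<triangleright> farr F f) \<bullet> winv (lu (farr F f))"
proof (rule vc_left_cancel[of "wF (lu f)"])
  show "wF (lu f) \<bullet> winv (wF (lu f)) = wF (lu f) \<bullet> wm (id1 C Y) f \<bullet> (wu Y \<triangleright> farr F f) \<bullet> winv (lu (farr F f))"
    using assms arg_cong[OF wm_lu[OF assms], of "\<lambda>x. x \<bullet> winv (lu (farr F f))"] by simp
qed (use assms in auto)

lemma wF_nt02:
  assumes "wdom \<phi> = id1 C X" "wcod \<phi> = c \<odot> d" "trg C h = X" "comp3 c d h"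
  shows "wF (nt02 c d \<phi> h)
    = wmm c d h \<bullet> nt02 (farr F c) (farr F d) (winv (wm c d) \<bullet> wF \<phi> \<bullet> wu X) (farr F h)"
proof -
  have h: "h \<in> Arr C" using assms by (simp add: comp3_def)
  have "wF (nt02 c d \<phi> h) = wF (as c d h) \<bullet> wF (\<phi> \<triangleright> h) \<bullet> wm (id1 C X) h
      \<bullet> (wu X \<triangleright> farr F h) \<bullet> winv (lu (farr F h))"
    using assms h by (simp add: nt02_def wF_winv_lu)
  also have "\<dots> = wF (as c d h) \<bullet> wm (c \<odot> d) h \<bullet> (wF \<phi> \<triangleright> farr F h)
      \<bullet> (wu X \<triangleright> farr F h) \<bullet> winv (lu (farr F h))"
    using assms wm_natural_left[of \<phi>, THEN vc_tail] by simp
  also have "\<dots> = wmm c d h \<bullet> as (farr F c) (farr F d) (farr F h) \<bullet> winv (wm c d \<triangleright> farr F h)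
      \<bullet> (wF \<phi> \<triangleright> farr F h) \<bullet> (wu X \<triangleright> farr F h) \<bullet> winv (lu (farr F h))"
    using assms wF_as_wm[of c d h, THEN vc_tail] by simp
  finally show ?thesis
    using assms by (simp add: nt02_def) (simp add: comp3_def)
qed

end

section \<open>Pseudomonads on components\<close>

context pseudomonad
begin

sublocale T: pseudofunctor C T
  by (rule pseudofunctor_T)

abbreviation "TO \<equiv> fobj T"
abbreviation "TA \<equiv> farr T"
abbreviation "N \<equiv> tarr n"
abbreviation "I \<equiv> tarr i"

lemma N_simps [simp]:
  assumes "X \<in> Obj C"
  shows "N X \<in> Arr C" "src C (N X) = TO (TO X)" "trg C (N X) = TO X"
  using pseudonatural.tarr_hom[OF pseudonatural_n assms] by (auto simp: hom1_iff psfun_comp_def)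

lemma I_simps [simp]:
  assumes "X \<in> Obj C"
  shows "I X \<in> Arr C" "src C (I X) = X" "trg C (I X) = TO X"
  using pseudonatural.tarr_hom[OF pseudonatural_i assms] by (auto simp: hom1_iff psfun_id_def)

section \<open>The data of a pseudomonad as labelled cells and components\<close>

definition wassoc where "wassoc X = wr (N X \<odot> TA (N X)) (N X \<odot> N (TO X)) (\<alpha> X)"
definition wlam where "wlam X = wr (id1 C (TO X)) (N X \<odot> I (TO X)) (\<l> X)"
definition wrho where "wrho X = wr (N X \<odot> TA (I X)) (id1 C (TO X)) (\<rho> X)"
definition wn where "wn f = wr (N (trg C f) \<odot> TA (TA f)) (TA f \<odot> N (src C f)) (tcell n f)"
definition wi where "wi f = wr (I (trg C f) \<odot> f) (TA f \<odot> I (src C f)) (tcell i f)"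

lemma wlabels_mon [simp]:
  "wdom (wassoc X) = N X \<odot> TA (N X)" "wcod (wassoc X) = N X \<odot> N (TO X)"
  "wdom (wlam X) = id1 C (TO X)" "wcod (wlam X) = N X \<odot> I (TO X)"
  "wdom (wrho X) = N X \<odot> TA (I X)" "wcod (wrho X) = id1 C (TO X)"
  "wdom (wn f) = N (trg C f) \<odot> TA (TA f)" "wcod (wn f) = TA f \<odot> N (src C f)"
  "wdom (wi f) = I (trg C f) \<odot> f" "wcod (wi f) = TA f \<odot> I (src C f)"
  "wnormal (wassoc X)" "wnormal (wlam X)" "wnormal (wrho X)" "wnormal (wn f)" "wnormal (wi f)"
  by (simp_all add: wassoc_def wlam_def wrho_def wn_def wi_def)

lemma wiso_wr: "\<phi> \<in> iso2 C f g \<Longrightarrow> wiso (wr f g \<phi>) \<and> wval (wr f g \<phi>) = \<phi>"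
  by (auto simp: wiso_def iso2_def)

lemma wiso_wassoc [simp]: "X \<in> Obj C \<Longrightarrow> wiso (wassoc X)"
  and wval_wassoc [simp]: "X \<in> Obj C \<Longrightarrow> wval (wassoc X) = \<alpha> X"
  using modification_\<alpha> wiso_wr[of "\<alpha> X" "N X \<odot> TA (N X)" "N X \<odot> N (TO X)"]
  by (auto simp: invertible_modification_def Let_def pstrans_comp_def psfun_pstrans_def
      pstrans_psfun_def wassoc_def)

lemma wiso_wlam [simp]: "X \<in> Obj C \<Longrightarrow> wiso (wlam X)"
  and wval_wlam [simp]: "X \<in> Obj C \<Longrightarrow> wval (wlam X) = \<l> X"
  using modification_\<l> wiso_wr[of "\<l> X" "id1 C (TO X)" "N X \<odot> I (TO X)"]
  by (auto simp: invertible_modification_def Let_def pstrans_comp_def pstrans_id_def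
      pstrans_psfun_def wlam_def)

lemma wiso_wrho [simp]: "X \<in> Obj C \<Longrightarrow> wiso (wrho X)"
  and wval_wrho [simp]: "X \<in> Obj C \<Longrightarrow> wval (wrho X) = \<rho> X"
  using modification_\<rho> wiso_wr[of "\<rho> X" "N X \<odot> TA (I X)" "id1 C (TO X)"]
  by (auto simp: invertible_modification_def Let_def pstrans_comp_def pstrans_id_def
      psfun_pstrans_def wrho_def)

lemma wiso_wn [simp]: "f \<in> Arr C \<Longrightarrow> wiso (wn f)"
  and wval_wn [simp]: "f \<in> Arr C \<Longrightarrow> wval (wn f) = tcell n f"
  using pseudonatural.tcell_iso[OF pseudonatural_n, of f "src C f" "trg C f"] wiso_wr[of "tcell n f"]
  by (auto simp: psfun_comp_def wn_def hom1_iff)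

lemma wiso_wi [simp]: "f \<in> Arr C \<Longrightarrow> wiso (wi f)"
  and wval_wi [simp]: "f \<in> Arr C \<Longrightarrow> wval (wi f) = tcell i f"
  using pseudonatural.tcell_iso[OF pseudonatural_i, of f "src C f" "trg C f"] wiso_wr[of "tcell i f"]
  by (auto simp: psfun_id_def wi_def hom1_iff)

text \<open>In the notation of the overview, \<open>assoc_at\<close>, \<open>lam_at\<close>,
  \<open>rho_at\<close>, \<open>n_at f\<close> and \<open>i_at f\<close> are A, L, R, N_f and
  I_f.\<close>

definition assoc_at where "assoc_at X h = nt (N X) (TA (N X)) (N X) (N (TO X)) (wassoc X) h"
definition lam_at where "lam_at X h = nt02 (N X) (I (TO X)) (wlam X) h"
definition rho_at where "rho_at X h = nt20 (N X) (TA (I X)) (wrho X) h"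
definition n_at where "n_at f h = nt (N (trg C f)) (TA (TA f)) (TA f) (N (src C f)) (wn f) h"
definition i_at where "i_at f h = nt (I (trg C f)) f (TA f) (I (src C f)) (wi f) h"

text \<open>Conjugation by the comparison cells of \<open>T\<close> is the form in which
  \<open>T\<close> of \<alpha> and of \<lambda> enters the coherence axioms; likewise
  \<open>Ti f\<close> is the naturality 2-cell at \<open>f\<close> of the transformation
  \<open>T i\<close>.\<close>

definition Tassoc where
  "Tassoc X = winv (T.wm (N X) (N (TO X))) \<bullet> T.wF (wassoc X) \<bullet> T.wm (N X) (TA (N X))"
definition Tlam where
  "Tlam X = winv (T.wm (N X) (I (TO X))) \<bullet> T.wF (wlam X) \<bullet> T.wu (TO X)"
definition Ti where
  "Ti f = winv (T.wm (TA f) (I (src C f))) \<bullet> T.wF (wi f) \<bullet> T.wm (I (trg C f)) f"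

definition Tassoc_at where
  "Tassoc_at X h = nt (TA (N X)) (TA (TA (N X))) (TA (N X)) (TA (N (TO X))) (Tassoc X) h"
definition Tlam_at where "Tlam_at X h = nt02 (TA (N X)) (TA (I (TO X))) (Tlam X) h"
definition Ti_at where
  "Ti_at f h = nt (TA (I (trg C f))) (TA f) (TA (TA f)) (TA (I (src C f))) (Ti f) h"

lemma at_simps [simp]:
  "wdom (assoc_at X h) = N X \<odot> TA (N X) \<odot> h" "wcod (assoc_at X h) = N X \<odot> N (TO X) \<odot> h"
  "wdom (lam_at X h) = h" "wcod (lam_at X h) = N X \<odot> I (TO X) \<odot> h"
  "wdom (rho_at X h) = N X \<odot> TA (I X) \<odot> h" "wcod (rho_at X h) = h"
  "wdom (n_at f h) = N (trg C f) \<odot> TA (TA f) \<odot> h" "wcod (n_at f h) = TA f \<odot> N (src C f) \<odot> h"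
  "wdom (i_at f h) = I (trg C f) \<odot> f \<odot> h" "wcod (i_at f h) = TA f \<odot> I (src C f) \<odot> h"
  "wnormal (assoc_at X h)" "wnormal (lam_at X h)" "wnormal (rho_at X h)" "wnormal (n_at f h)" "wnormal (i_at f h)"
  by (simp_all add: assoc_at_def lam_at_def rho_at_def n_at_def i_at_def)

lemma Tat_simps [simp]:
  "wdom (Tassoc X) = TA (N X) \<odot> TA (TA (N X))" "wcod (Tassoc X) = TA (N X) \<odot> TA (N (TO X))"
  "wdom (Tlam X) = id1 C (TO (TO X))" "wcod (Tlam X) = TA (N X) \<odot> TA (I (TO X))"
  "wdom (Ti f) = TA (I (trg C f)) \<odot> TA f" "wcod (Ti f) = TA (TA f) \<odot> TA (I (src C f))"
  "wnormal (Tassoc X)" "wnormal (Tlam X)" "wnormal (Ti f)"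
  "wdom (Tassoc_at X h) = TA (N X) \<odot> TA (TA (N X)) \<odot> h"
  "wcod (Tassoc_at X h) = TA (N X) \<odot> TA (N (TO X)) \<odot> h"
  "wdom (Tlam_at X h) = h" "wcod (Tlam_at X h) = TA (N X) \<odot> TA (I (TO X)) \<odot> h"
  "wdom (Ti_at f h) = TA (I (trg C f)) \<odot> TA f \<odot> h" "wcod (Ti_at f h) = TA (TA f) \<odot> TA (I (src C f)) \<odot> h"
  "wnormal (Tassoc_at X h)" "wnormal (Tlam_at X h)" "wnormal (Ti_at f h)"
  by (simp_all add: Tassoc_def Tlam_def Ti_def Tassoc_at_def Tlam_at_def Ti_at_def)

lemma wiso_Tassoc [simp]: "X \<in> Obj C \<Longrightarrow> wiso (Tassoc X)"
  and wiso_Tlam [simp]: "X \<in> Obj C \<Longrightarrow> wiso (Tlam X)"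
  and wiso_Ti [simp]: "f \<in> Arr C \<Longrightarrow> wiso (Ti f)"
  by (simp_all add: Tassoc_def Tlam_def Ti_def)

lemma wiso_assoc_at [simp]:
  "\<lbrakk>X \<in> Obj C; h \<in> Arr C; trg C h = TO (TO (TO X))\<rbrakk> \<Longrightarrow> wiso (assoc_at X h)"
  by (simp add: assoc_at_def wiso_nt comp3_def)

lemma wiso_lam_at [simp]: "\<lbrakk>X \<in> Obj C; h \<in> Arr C; trg C h = TO X\<rbrakk> \<Longrightarrow> wiso (lam_at X h)"
  by (simp add: lam_at_def wiso_nt02 comp3_def)

lemma wiso_rho_at [simp]: "\<lbrakk>X \<in> Obj C; h \<in> Arr C; trg C h = TO X\<rbrakk> \<Longrightarrow> wiso (rho_at X h)"
  by (simp add: rho_at_def wiso_nt20 comp3_def)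

lemma wiso_n_at [simp]:
  "\<lbrakk>f \<in> Arr C; h \<in> Arr C; trg C h = TO (TO (src C f))\<rbrakk> \<Longrightarrow> wiso (n_at f h)"
  by (simp add: n_at_def wiso_nt comp3_def)

lemma wiso_i_at [simp]: "\<lbrakk>f \<in> Arr C; h \<in> Arr C; trg C h = src C f\<rbrakk> \<Longrightarrow> wiso (i_at f h)"
  by (simp add: i_at_def wiso_nt comp3_def)

lemma at_natural:
  assumes "wdom \<chi> = h" "wcod \<chi> = h'"
  shows assoc_at_natural:
    "assoc_at X h' \<bullet> (N X \<triangleleft> TA (N X) \<triangleleft> \<chi>) = (N X \<triangleleft> N (TO X) \<triangleleft> \<chi>) \<bullet> assoc_at X h"
  and n_at_natural:
    "n_at f h' \<bullet> (N (trg C f) \<triangleleft> TA (TA f) \<triangleleft> \<chi>) = (TA f \<triangleleft> N (src C f) \<triangleleft> \<chi>) \<bullet> n_at f h"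
  and i_at_natural:
    "i_at f h' \<bullet> (I (trg C f) \<triangleleft> f \<triangleleft> \<chi>) = (TA f \<triangleleft> I (src C f) \<triangleleft> \<chi>) \<bullet> i_at f h"
  using assms by (simp_all add: assoc_at_def n_at_def i_at_def nt_natural)

lemma unit_at_natural:
  assumes "valid \<chi>" "wdom \<chi> = h" "wcod \<chi> = h'" "trg C h = TO X"
  shows lam_at_natural: "lam_at X h' \<bullet> \<chi> = (N X \<triangleleft> I (TO X) \<triangleleft> \<chi>) \<bullet> lam_at X h"
  and rho_at_natural: "rho_at X h' \<bullet> (N X \<triangleleft> TA (I X) \<triangleleft> \<chi>) = \<chi> \<bullet> rho_at X h"
  using assms by (simp_all add: lam_at_def rho_at_def nt02_natural[where X = "TO X"] nt20_natural[where X = "TO X"])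

section \<open>The coherence axioms at a generic 1-cell\<close>

text \<open>In the axiom each whiskering of \<open>\<alpha> X\<close> already stands between the two
  associators that \<open>assoc_at\<close> contains, so only regrouping is required.\<close>

lemma coherence_assoc_raw:
  assumes [simp]: "X \<in> Obj C"
  shows "(N X \<triangleleft> wassoc (TO X)) \<bullet> assoc_at X (TA (N (TO X))) \<bullet> (N X \<triangleleft> Tassoc X)
    = assoc_at X (N (TO (TO X))) \<bullet> (N X \<triangleleft> wn (N X)) \<bullet> assoc_at X (TA (TA (N X)))"
  unfolding assoc_at_def nt_def vc_assoc
  by (rule wcell_eqI, simp_all add: comp3_def)
    (use coherence_assoc[OF assms] in \<open>simp add: Let_def Tassoc_def comp3_def wval_winv\<close>)

text \<open>\<open>as2\<close> slides through the whiskered raw axiom factor by factor, so the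
  associators created by whiskering with \<open>h\<close> collect at the right end and cancel. The
  other passages from raw to \<open>_at\<close> forms follow the same scheme.\<close>

lemma coherence_assoc_at:
  assumes [simp]: "X \<in> Obj C" "h \<in> Arr C" and h: "trg C h = TO (TO (TO (TO X)))"
  shows "(N X \<triangleleft> assoc_at (TO X) h) \<bullet> assoc_at X (TA (N (TO X)) \<odot> h) \<bullet> (N X \<triangleleft> Tassoc_at X h)
    = assoc_at X (N (TO (TO X)) \<odot> h) \<bullet> (N X \<triangleleft> n_at (N X) h) \<bullet> assoc_at X (TA (TA (N X)) \<odot> h)"
proof (rule vc_right_cancel[of _ "as2 (N X) (TA (N X)) (TA (TA (N X))) h"])
  let ?as = "as2 (N X) (N (TO X)) (N (TO (TO X))) h"
  note [simp] = comp3_def h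
  have 1: "as2 (N X) (N (TO X)) (N (TO (TO X))) h \<bullet> ((N X \<triangleleft> wassoc (TO X)) \<triangleright> h)
    = (N X \<triangleleft> assoc_at (TO X) h) \<bullet> as2 (N X) (N (TO X)) (TA (N (TO X))) h"
    unfolding assoc_at_def by (rule nt_lw_rw) auto
  have 2: "as2 (N X) (TA (N X)) (TA (N (TO X))) h \<bullet> ((N X \<triangleleft> Tassoc X) \<triangleright> h)
    = (N X \<triangleleft> Tassoc_at X h) \<bullet> as2 (N X) (TA (N X)) (TA (TA (N X))) h"
    unfolding Tassoc_at_def by (rule nt_lw_rw) auto
  have 4: "as2 (N X) (TA (N X)) (N (TO (TO X))) h \<bullet> ((N X \<triangleleft> wn (N X)) \<triangleright> h)
    = (N X \<triangleleft> n_at (N X) h) \<bullet> as2 (N X) (N (TO X)) (TA (TA (N X))) h"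
    using nt_lw_rw[of "wn (N X)" "N (TO X)" "TA (TA (N X))" "TA (N X)" "N (TO (TO X))" h "N X"]
    by (simp add: n_at_def)
  have 5: "as2 (N X) (N (TO X)) k h \<bullet> (assoc_at X k \<triangleright> h)
    = assoc_at X (k \<odot> h) \<bullet> as2 (N X) (TA (N X)) k h"
    if "k \<in> Arr C" "src C k = TO (TO (TO (TO X)))" "trg C k = TO (TO (TO X))" for k
    unfolding assoc_at_def by (rule nt_rw) (use that in auto)
  have "?as \<bullet> (((N X \<triangleleft> wassoc (TO X)) \<bullet> assoc_at X (TA (N (TO X))) \<bullet> (N X \<triangleleft> Tassoc X)) \<triangleright> h)
    = ?as \<bullet> ((assoc_at X (N (TO (TO X))) \<bullet> (N X \<triangleleft> wn (N X)) \<bullet> assoc_at X (TA (TA (N X)))) \<triangleright> h)"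
    by (simp only: coherence_assoc_raw[OF assms(1)])
  then show "((N X \<triangleleft> assoc_at (TO X) h) \<bullet> assoc_at X (TA (N (TO X)) \<odot> h) \<bullet> (N X \<triangleleft> Tassoc_at X h))
      \<bullet> as2 (N X) (TA (N X)) (TA (TA (N X))) h
    = (assoc_at X (N (TO (TO X)) \<odot> h) \<bullet> (N X \<triangleleft> n_at (N X) h) \<bullet> assoc_at X (TA (TA (N X)) \<odot> h))
      \<bullet> as2 (N X) (TA (N X)) (TA (TA (N X))) h"
    by (simp del: comp3_def add: 1[THEN vc_tail] 2 4[THEN vc_tail] 5 5[THEN vc_tail])
qed (use h in \<open>auto simp: comp3_def\<close>)

lemma coherence_unit_raw:
  assumes [simp]: "X \<in> Obj C"
  shows "(ru (N X) \<bullet> (N X \<triangleleft> wrho (TO X))) \<bullet> assoc_at X (TA (I (TO X)))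
    \<bullet> (N X \<triangleleft> Tlam X) \<bullet> winv (ru (N X)) = wid (N X)"
  unfolding assoc_at_def nt_def vc_assoc
  by (rule wcell_eqI, simp_all add: comp3_def)
    (use coherence_unit[OF assms] in \<open>simp add: Let_def Tlam_def comp3_def wval_winv\<close>)

lemma coherence_unit_at:
  assumes [simp]: "X \<in> Obj C" "h \<in> Arr C" and h: "trg C h = TO (TO X)"
  shows "(N X \<triangleleft> rho_at (TO X) h) \<bullet> assoc_at X (TA (I (TO X)) \<odot> h) \<bullet> (N X \<triangleleft> Tlam_at X h)
    = wid (N X \<odot> h)"
proof -
  note [simp] = h
  have 1: "(ru (N X) \<bullet> (N X \<triangleleft> wrho (TO X))) \<triangleright> h
    = (N X \<triangleleft> rho_at (TO X) h) \<bullet> as2 (N X) (N (TO X)) (TA (I (TO X))) h"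
    unfolding rho_at_def by (rule nt20_lw_rw) (auto simp: comp3_def)
  have 2: "as2 (N X) (TA (N X)) (TA (I (TO X))) h \<bullet> (((N X \<triangleleft> Tlam X) \<bullet> winv (ru (N X))) \<triangleright> h)
    = N X \<triangleleft> Tlam_at X h"
    unfolding Tlam_at_def by (rule nt02_lw_rw[where X = "TO (TO X)"]) (auto simp: comp3_def)
  have 3: "as2 (N X) (N (TO X)) (TA (I (TO X))) h \<bullet> (assoc_at X (TA (I (TO X))) \<triangleright> h)
    = assoc_at X (TA (I (TO X)) \<odot> h) \<bullet> as2 (N X) (TA (N X)) (TA (I (TO X))) h"
    unfolding assoc_at_def by (rule nt_rw) (auto simp: comp3_def)
  have "wid (N X) \<triangleright> h = (((ru (N X) \<bullet> (N X \<triangleleft> wrho (TO X))) \<bullet> assoc_at X (TA (I (TO X)))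
    \<bullet> ((N X \<triangleleft> Tlam X) \<bullet> winv (ru (N X)))) \<triangleright> h)"
    by (simp only: coherence_unit_raw[OF assms(1)])
  also have "\<dots> = ((ru (N X) \<bullet> (N X \<triangleleft> wrho (TO X))) \<triangleright> h) \<bullet> (assoc_at X (TA (I (TO X))) \<triangleright> h)
    \<bullet> (((N X \<triangleleft> Tlam X) \<bullet> winv (ru (N X))) \<triangleright> h)"
    by simp
  also have "\<dots> = (N X \<triangleleft> rho_at (TO X) h) \<bullet> assoc_at X (TA (I (TO X)) \<odot> h) \<bullet> (N X \<triangleleft> Tlam_at X h)"
    unfolding 1 vc_assoc 3[THEN vc_tail] 2 ..
  finally show ?thesis by simp
qed

section \<open>The modification axioms at a generic 1-cell\<close>

text \<open>The naturality cell of \<open>pstrans_id\<close> is a left unitor followed by an inverse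
  right unitor: the latter stays in the statement, the former is cancelled in the proof.\<close>

lemma lam_modification_raw:
  assumes [simp]: "f \<in> Arr C"
  shows "n_at f (I (TO (src C f))) \<bullet> (N (trg C f) \<triangleleft> wi (TA f)) \<bullet> lam_at (trg C f) (TA f)
    = (TA f \<triangleleft> wlam (src C f)) \<bullet> winv (ru (TA f))"
proof (rule vc_right_cancel[of _ "lu (TA f)"])
  have m: "tcell (pstrans_comp C T (psfun_comp C T T) T n (pstrans_psfun i T)) f \<cdot> (\<l> (trg C f) \<rhd> TA f)
    = (TA f \<lhd> \<l> (src C f)) \<cdot> tcell (pstrans_id C T) f"
    using modification_\<l> by (simp add: invertible_modification_def Let_def hom1_iff)
  have "(as (TA f) (N (src C f)) (I (TO (src C f))) \<bullet> (wn f \<triangleright> I (TO (src C f)))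
      \<bullet> winv (as (N (trg C f)) (TA (TA f)) (I (TO (src C f)))) \<bullet> (N (trg C f) \<triangleleft> wi (TA f))
      \<bullet> as (N (trg C f)) (I (TO (trg C f))) (TA f)) \<bullet> (wlam (trg C f) \<triangleright> TA f)
    = (TA f \<triangleleft> wlam (src C f)) \<bullet> winv (ru (TA f)) \<bullet> lu (TA f)"
    by (rule wcell_eqI, simp_all del: vc_assoc add: comp3_def)
      (use m in \<open>simp add: Let_def comp3_def wval_winv pstrans_comp_def pstrans_psfun_def pstrans_id_def psfun_comp_def\<close>)
  then show "(n_at f (I (TO (src C f))) \<bullet> (N (trg C f) \<triangleleft> wi (TA f)) \<bullet> lam_at (trg C f) (TA f)) \<bullet> lu (TA f)
    = ((TA f \<triangleleft> wlam (src C f)) \<bullet> winv (ru (TA f))) \<bullet> lu (TA f)"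
    by (simp add: lam_at_def nt02_def n_at_def nt_def)
qed auto

lemma lam_modification_at:
  assumes [simp]: "f \<in> Arr C" "h \<in> Arr C" and h: "trg C h = TO (src C f)"
  shows "n_at f (I (TO (src C f)) \<odot> h) \<bullet> (N (trg C f) \<triangleleft> i_at (TA f) h) \<bullet> lam_at (trg C f) (TA f \<odot> h)
    = TA f \<triangleleft> lam_at (src C f) h"
proof -
  note [simp] = h
  let ?X = "src C f" and ?Y = "trg C f"
  have 1: "as2 (TA f) (N ?X) (I (TO ?X)) h \<bullet> (n_at f (I (TO ?X)) \<triangleright> h)
    = n_at f (I (TO ?X) \<odot> h) \<bullet> as2 (N ?Y) (TA (TA f)) (I (TO ?X)) h"
    unfolding n_at_def by (rule nt_rw) (auto simp: comp3_def)
  have 2: "as2 (N ?Y) (TA (TA f)) (I (TO ?X)) h \<bullet> ((N ?Y \<triangleleft> wi (TA f)) \<triangleright> h)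
    = (N ?Y \<triangleleft> i_at (TA f) h) \<bullet> as2 (N ?Y) (I (TO ?Y)) (TA f) h"
    using nt_lw_rw[of "wi (TA f)" "I (TO ?Y)" "TA f" "TA (TA f)" "I (TO ?X)" h "N ?Y"]
    by (simp add: i_at_def comp3_def)
  have 3: "as2 (N ?Y) (I (TO ?Y)) (TA f) h \<bullet> (lam_at ?Y (TA f) \<triangleright> h) = lam_at ?Y (TA f \<odot> h)"
    unfolding lam_at_def by (rule nt02_rw[where X = "TO ?Y"]) (auto simp: comp3_def)
  have 4: "as2 (TA f) (N ?X) (I (TO ?X)) h \<bullet> (((TA f \<triangleleft> wlam ?X) \<bullet> winv (ru (TA f))) \<triangleright> h)
    = TA f \<triangleleft> lam_at ?X h"
    unfolding lam_at_def by (rule nt02_lw_rw[where X = "TO ?X"]) (auto simp: comp3_def)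
  have "as2 (TA f) (N ?X) (I (TO ?X)) h
      \<bullet> ((n_at f (I (TO ?X)) \<bullet> (N ?Y \<triangleleft> wi (TA f)) \<bullet> lam_at ?Y (TA f)) \<triangleright> h) = TA f \<triangleleft> lam_at ?X h"
    by (simp only: lam_modification_raw[OF assms(1)] 4)
  then show ?thesis
    by (simp add: 1[THEN vc_tail] 2[THEN vc_tail] 3)
qed

lemma rho_modification_raw:
  assumes [simp]: "f \<in> Arr C"
  shows "(ru (TA f) \<bullet> (TA f \<triangleleft> wrho (src C f))) \<bullet> n_at f (TA (I (src C f))) \<bullet> (N (trg C f) \<triangleleft> Ti f)
    = rho_at (trg C f) (TA f)"
proof (rule vc_right_cancel[of _ "as (N (trg C f)) (TA (I (trg C f))) (TA f)"])
  have m: "tcell (pstrans_id C T) f \<cdot> (\<rho> (trg C f) \<rhd> TA f)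
    = (TA f \<lhd> \<rho> (src C f)) \<cdot> tcell (pstrans_comp C T (psfun_comp C T T) T n (psfun_pstrans C (psfun_id C) T T i)) f"
    using modification_\<rho> by (simp add: invertible_modification_def Let_def hom1_iff)
  have "(winv (ru (TA f)) \<bullet> lu (TA f)) \<bullet> (wrho (trg C f) \<triangleright> TA f)
    = (TA f \<triangleleft> wrho (src C f)) \<bullet> as (TA f) (N (src C f)) (TA (I (src C f))) \<bullet> (wn f \<triangleright> TA (I (src C f)))
      \<bullet> winv (as (N (trg C f)) (TA (TA f)) (TA (I (src C f)))) \<bullet> (N (trg C f) \<triangleleft> Ti f)
      \<bullet> as (N (trg C f)) (TA (I (trg C f))) (TA f)"
    by (rule wcell_eqI, simp_all del: vc_assoc add: comp3_def)
      (use m in \<open>simp add: Let_def comp3_def wval_winv pstrans_comp_def psfun_pstrans_def pstrans_id_def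
        psfun_comp_def psfun_id_def Ti_def T.fcell_id\<close>)
  from arg_cong[OF this, of "\<lambda>x. ru (TA f) \<bullet> x"]
  show "((ru (TA f) \<bullet> (TA f \<triangleleft> wrho (src C f))) \<bullet> n_at f (TA (I (src C f))) \<bullet> (N (trg C f) \<triangleleft> Ti f))
      \<bullet> as (N (trg C f)) (TA (I (trg C f))) (TA f)
    = rho_at (trg C f) (TA f) \<bullet> as (N (trg C f)) (TA (I (trg C f))) (TA f)"
    by (simp add: rho_at_def nt20_def n_at_def nt_def comp3_def)
qed (auto simp: comp3_def)

lemma rho_modification_at:
  assumes [simp]: "f \<in> Arr C" "h \<in> Arr C" and h: "trg C h = TO (src C f)"
  shows "(TA f \<triangleleft> rho_at (src C f) h) \<bullet> n_at f (TA (I (src C f)) \<odot> h) \<bullet> (N (trg C f) \<triangleleft> Ti_at f h)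
    = rho_at (trg C f) (TA f \<odot> h)"
proof (rule vc_right_cancel[of _ "as2 (N (trg C f)) (TA (I (trg C f))) (TA f) h"])
  note [simp] = h
  let ?X = "src C f" and ?Y = "trg C f"
  have 1: "as2 (TA f) (N ?X) (TA (I ?X)) h \<bullet> (n_at f (TA (I ?X)) \<triangleright> h)
    = n_at f (TA (I ?X) \<odot> h) \<bullet> as2 (N ?Y) (TA (TA f)) (TA (I ?X)) h"
    unfolding n_at_def by (rule nt_rw) (auto simp: comp3_def)
  have 2: "as2 (N ?Y) (TA (TA f)) (TA (I ?X)) h \<bullet> ((N ?Y \<triangleleft> Ti f) \<triangleright> h)
    = (N ?Y \<triangleleft> Ti_at f h) \<bullet> as2 (N ?Y) (TA (I ?Y)) (TA f) h"
    unfolding Ti_at_def by (rule nt_lw_rw) (auto simp: comp3_def)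
  have 3: "rho_at ?Y (TA f) \<triangleright> h = rho_at ?Y (TA f \<odot> h) \<bullet> as2 (N ?Y) (TA (I ?Y)) (TA f) h"
    unfolding rho_at_def by (rule nt20_rw[where X = "TO ?Y"]) (auto simp: comp3_def)
  have 4: "(ru (TA f) \<bullet> (TA f \<triangleleft> wrho ?X)) \<triangleright> h
    = (TA f \<triangleleft> rho_at ?X h) \<bullet> as2 (TA f) (N ?X) (TA (I ?X)) h"
    unfolding rho_at_def by (rule nt20_lw_rw) (auto simp: comp3_def)
  have "rho_at ?Y (TA f) \<triangleright> h = ((ru (TA f) \<bullet> (TA f \<triangleleft> wrho ?X)) \<triangleright> h) \<bullet> (n_at f (TA (I ?X)) \<triangleright> h)
      \<bullet> ((N ?Y \<triangleleft> Ti f) \<triangleright> h)"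
    unfolding rho_modification_raw[OF assms(1), symmetric] by simp
  then show "((TA f \<triangleleft> rho_at ?X h) \<bullet> n_at f (TA (I ?X) \<odot> h) \<bullet> (N ?Y \<triangleleft> Ti_at f h)) \<bullet> as2 (N ?Y) (TA (I ?Y)) (TA f) h
    = rho_at ?Y (TA f \<odot> h) \<bullet> as2 (N ?Y) (TA (I ?Y)) (TA f) h"
    unfolding 3 4 vc_assoc 1[THEN vc_tail] 2 ..
qed (use h in \<open>auto simp: comp3_def\<close>)

section \<open>Pseudonaturality of the unit\<close>

lemma wi_natural:
  assumes "valid \<chi>" "wdom \<chi> = f" "wcod \<chi> = g"
  shows "wi g \<bullet> (I (trg C f) \<triangleleft> \<chi>) = (T.wF \<chi> \<triangleright> I (src C f)) \<bullet> wi f"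
  using assms validD[of \<chi>] pseudonatural.tcell_natural[OF pseudonatural_i, of f "src C f" "trg C f" "wval \<chi>" g]
  by (intro wcell_eqI) (auto simp: psfun_id_def hom1_iff)

lemma wi_comp:
  assumes [simp]: "g \<in> Arr C" "f \<in> Arr C" and gf: "src C g = trg C f"
  shows "wi (g \<odot> f) = T.wM g f (I (src C f)) \<bullet> (TA g \<triangleleft> wi f) \<bullet> i_at g f"
proof -
  note [simp] = gf
  \<comment> \<open>The source of \<open>i\<close> is the identity pseudofunctor, whose comparison
    cells are identities; these facts remove the corresponding factor from
    \<open>tcell_comp\<close>.\<close>
  have "tcell i (g \<odot> f) \<cdot> id2 C (I (trg C g) \<odot> g \<odot> f) = tcell i (g \<odot> f)"
    using vcomp_id validD(1)[of "wi (g \<odot> f)"] by simp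
  moreover have "id2 C (I (trg C g)) \<star> id2 C (g \<odot> f) = id2 C (I (trg C g) \<odot> g \<odot> f)"
    using hcomp_id[of "g \<odot> f" "src C f" "trg C g" "I (trg C g)"] by (simp add: hom1_iff)
  ultimately show ?thesis
    unfolding T.wM_def i_at_def nt_def vc_assoc
    by (intro wcell_eqI, simp_all add: comp3_def)
      (use pseudonatural.tcell_comp[OF pseudonatural_i, of f "src C f" "trg C f" g "trg C g"] in
        \<open>simp add: psfun_id_def hom1_iff comp3_def wval_winv\<close>)
qed

lemma wi_id1:
  assumes [simp]: "X \<in> Obj C"
  shows "wi (id1 C X) = (T.wu X \<triangleright> I X) \<bullet> winv (lu (I X)) \<bullet> ru (I X)"
proof -
  have "tcell i (id1 C X) \<cdot> id2 C (I X \<odot> id1 C X) = tcell i (id1 C X)"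
    using vcomp_id validD(1)[of "wi (id1 C X)"] by simp
  moreover have "id2 C (I X) \<star> id2 C (id1 C X) = id2 C (I X \<odot> id1 C X)"
    using hcomp_id[of "id1 C X" X X "I X"] by (simp add: hom1_iff)
  ultimately show ?thesis
    by (intro wcell_eqI, simp_all)
      (use pseudonatural.tcell_unit[OF pseudonatural_i, of X] in \<open>simp add: psfun_id_def wval_winv\<close>)
qed

text \<open>Serves to split the unit cell of a 1-cell \<open>N Z \<odot> TA g\<close> into those of
  its two factors, in \<open>mu_eta\<close> and in \<open>lax_alg_comp\<close>.\<close>

lemma i_at_comp:
  assumes [simp]: "g \<in> Arr C" "f \<in> Arr C" "h \<in> Arr C" and gf: "src C g = trg C f" "trg C h = src C f"
  shows "i_at (g \<odot> f) h = T.wM g f (I (src C f) \<odot> h) \<bullet> (TA g \<triangleleft> i_at f h) \<bullet> i_at g (f \<odot> h)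
    \<bullet> (I (trg C g) \<triangleleft> as g f h)"
proof -
  note [simp] = gf
  let ?X = "src C f" and ?Y = "trg C f" and ?Z = "trg C g"
  have 1: "as (TA (g \<odot> f)) (I ?X) h \<bullet> (T.wM g f (I ?X) \<triangleright> h)
    = T.wM g f (I ?X \<odot> h) \<bullet> as2 (TA g) (TA f) (I ?X) h"
    by (rule T.wM_rw) auto
  have 2: "as2 (TA g) (TA f) (I ?X) h \<bullet> ((TA g \<triangleleft> wi f) \<triangleright> h)
    = (TA g \<triangleleft> i_at f h) \<bullet> as2 (TA g) (I ?Y) f h"
    using nt_lw_rw[of "wi f" "I ?Y" f "TA f" "I ?X" h "TA g"] by (simp add: i_at_def comp3_def)
  have 3: "as2 (TA g) (I ?Y) f h \<bullet> (i_at g f \<triangleright> h) = i_at g (f \<odot> h) \<bullet> as2 (I ?Z) g f h"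
    using nt_rw[of "wi g" "I ?Z" g "TA g" "I ?Y" f h] by (simp add: i_at_def comp3_def)
  have "i_at (g \<odot> f) h = as (TA (g \<odot> f)) (I ?X) h \<bullet> (wi (g \<odot> f) \<triangleright> h) \<bullet> winv (as (I ?Z) (g \<odot> f) h)"
    by (simp add: i_at_def nt_def)
  also have "\<dots> = T.wM g f (I ?X \<odot> h) \<bullet> (TA g \<triangleleft> i_at f h) \<bullet> i_at g (f \<odot> h)
      \<bullet> as2 (I ?Z) g f h \<bullet> winv (as (I ?Z) (g \<odot> f) h)"
    by (simp add: wi_comp 1[THEN vc_tail] 2[THEN vc_tail] 3[THEN vc_tail])
  finally show ?thesis
    by (simp add: as2_def comp3_def)
qed

text \<open>Naturality of \<open>i\<close> at \<open>\<phi>\<close>, with \<open>wi_comp\<close>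
  resolving both composites; the comparison cells released in this way conjugate
  \<open>T.wF \<phi>\<close>.\<close>

lemma wi_natural_comp:
  assumes "valid \<phi>" "wdom \<phi> = a \<odot> b" "wcod \<phi> = c \<odot> d" "comp3 I' a b" "I' = I (trg C a)"
    "src C d = src C b" "c \<in> Arr C" "d \<in> Arr C" "src C c = trg C d" "trg C c = trg C a"
  shows "(TA c \<triangleleft> wi d) \<bullet> i_at c d \<bullet> (I' \<triangleleft> \<phi>)
    = nt (TA a) (TA b) (TA c) (TA d) (winv (T.wm c d) \<bullet> T.wF \<phi> \<bullet> T.wm a b) (I (src C b))
      \<bullet> (TA a \<triangleleft> wi b) \<bullet> i_at a b"
proof (rule vc_left_cancel[of "T.wM c d (I (src C b))"])
  have t [simp]: "a \<in> Arr C" "b \<in> Arr C" "src C a = trg C b" using assms by (auto simp: comp3_def)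
  note [simp] = assms(1-3,5-)
  have "T.wM c d (I (src C b)) \<bullet> (TA c \<triangleleft> wi d) \<bullet> i_at c d \<bullet> (I' \<triangleleft> \<phi>) = wi (c \<odot> d) \<bullet> (I' \<triangleleft> \<phi>)"
    by (simp add: wi_comp)
  also have "\<dots> = (T.wF \<phi> \<triangleright> I (src C b)) \<bullet> wi (a \<odot> b)"
    using wi_natural[of \<phi> "a \<odot> b" "c \<odot> d"] by simp
  also have "\<dots> = T.wM c d (I (src C b)) \<bullet>
    nt (TA a) (TA b) (TA c) (TA d) (winv (T.wm c d) \<bullet> T.wF \<phi> \<bullet> T.wm a b) (I (src C b))
      \<bullet> (TA a \<triangleleft> wi b) \<bullet> i_at a b"
    by (simp add: wi_comp T.wM_def nt_def comp3_def)
  finally show "T.wM c d (I (src C b)) \<bullet> (TA c \<triangleleft> wi d) \<bullet> i_at c d \<bullet> (I' \<triangleleft> \<phi>) = \<dots>" .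
qed (use assms in \<open>auto simp: comp3_def\<close>)

text \<open>The analogue of \<open>wi_natural_comp\<close> for a cell out of an identity:
  \<open>wi_id1\<close> replaces \<open>wi_comp\<close> at the source, and the result is then
  whiskered by \<open>k\<close>.\<close>

lemma wi_natural_unit_at:
  assumes "valid \<phi>" "wdom \<phi> = id1 C B" "wcod \<phi> = c \<odot> d" "c \<in> Arr C" "d \<in> Arr C"
    "src C c = trg C d" "trg C c = B" "src C d = B" "k \<in> Arr C" "trg C k = B"
  shows "(TA c \<triangleleft> i_at d k) \<bullet> i_at c (d \<odot> k) \<bullet> (I B \<triangleleft> nt02 c d \<phi> k)
    = nt02 (TA c) (TA d) (winv (T.wm c d) \<bullet> T.wF \<phi> \<bullet> T.wu B) (I B \<odot> k)"
proof -
  note [simp] = assms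
  have B [simp]: "B \<in> Obj C" using trg_obj[of k] by simp
  let ?\<psi> = "winv (T.wm c d) \<bullet> T.wF \<phi> \<bullet> T.wu B"
  have 0: "(TA c \<triangleleft> wi d) \<bullet> i_at c d \<bullet> (I B \<triangleleft> \<phi>) \<bullet> winv (ru (I B)) = nt02 (TA c) (TA d) ?\<psi> (I B)"
  proof (rule vc_left_cancel[of "T.wM c d (I B)"])
    have "T.wM c d (I B) \<bullet> (TA c \<triangleleft> wi d) \<bullet> i_at c d \<bullet> (I B \<triangleleft> \<phi>) \<bullet> winv (ru (I B))
      = wi (c \<odot> d) \<bullet> (I B \<triangleleft> \<phi>) \<bullet> winv (ru (I B))"
      by (simp add: wi_comp)
    also have "\<dots> = (T.wF \<phi> \<triangleright> I B) \<bullet> wi (id1 C B) \<bullet> winv (ru (I B))"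
      using wi_natural[of \<phi> "id1 C B" "c \<odot> d", THEN vc_tail] by simp
    also have "\<dots> = T.wM c d (I B) \<bullet> nt02 (TA c) (TA d) ?\<psi> (I B)"
      by (simp add: wi_id1 T.wM_def nt02_def comp3_def)
    finally show "T.wM c d (I B) \<bullet> (TA c \<triangleleft> wi d) \<bullet> i_at c d \<bullet> (I B \<triangleleft> \<phi>) \<bullet> winv (ru (I B)) = \<dots>" .
  qed auto
  have 1: "as2 (TA c) (TA d) (I B) k \<bullet> ((TA c \<triangleleft> wi d) \<triangleright> k)
    = (TA c \<triangleleft> i_at d k) \<bullet> as2 (TA c) (I (trg C d)) d k"
    using nt_lw_rw[of "wi d" "I (trg C d)" d "TA d" "I B" k "TA c"] by (simp add: i_at_def comp3_def)
  have 2: "as2 (TA c) (I (trg C d)) d k \<bullet> (i_at c d \<triangleright> k) = i_at c (d \<odot> k) \<bullet> as2 (I B) c d k"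
    using nt_rw[of "wi c" "I B" c "TA c" "I (trg C d)" d k] by (simp add: i_at_def comp3_def)
  have 3: "as2 (I B) c d k \<bullet> (((I B \<triangleleft> \<phi>) \<bullet> winv (ru (I B))) \<triangleright> k) = I B \<triangleleft> nt02 c d \<phi> k"
    by (rule nt02_lw_rw[where X = B]) (auto simp: comp3_def)
  have "nt02 (TA c) (TA d) ?\<psi> (I B \<odot> k) = as2 (TA c) (TA d) (I B) k \<bullet> (nt02 (TA c) (TA d) ?\<psi> (I B) \<triangleright> k)"
    by (rule nt02_rw[where X = "TO B", symmetric]) (auto simp: comp3_def)
  also have "\<dots> = as2 (TA c) (TA d) (I B) k \<bullet> ((TA c \<triangleleft> wi d) \<triangleright> k) \<bullet> (i_at c d \<triangleright> k)
      \<bullet> (((I B \<triangleleft> \<phi>) \<bullet> winv (ru (I B))) \<triangleright> k)"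
    unfolding 0[symmetric] by simp
  also have "\<dots> = (TA c \<triangleleft> i_at d k) \<bullet> i_at c (d \<odot> k) \<bullet> (I B \<triangleleft> nt02 c d \<phi> k)"
    unfolding 1[THEN vc_tail] 2[THEN vc_tail] 3 vc_assoc ..
  finally show ?thesis ..
qed

text \<open>Naturality of \<open>i\<close> at the 2-cell \<open>\<l> X\<close>: along
  \<open>I (TO X)\<close>, the cell \<lambda> under \<open>T\<close> is expressed by \<lambda>
  outside \<open>T\<close>.\<close>

lemma Tlam_at_I:
  assumes "X \<in> Obj C" "k \<in> Arr C" "trg C k = TO X"
  shows "Tlam_at X (I (TO X) \<odot> k)
    = (TA (N X) \<triangleleft> i_at (I (TO X)) k) \<bullet> i_at (N X) (I (TO X) \<odot> k) \<bullet> (I (TO X) \<triangleleft> lam_at X k)"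
  using assms by (simp add: Tlam_at_def lam_at_def Tlam_def wi_natural_unit_at)

text \<open>Naturality of \<open>i\<close> at its own naturality 2-cell \<open>wi f\<close>.\<close>

lemma Ti_at_I:
  assumes "f \<in> Arr C" "src C f = X" "trg C f = Y"
  shows "(TA (TA f) \<triangleleft> wi (I X)) \<bullet> i_at (TA f) (I X) \<bullet> (I (TO Y) \<triangleleft> wi f)
    = Ti_at f (I X) \<bullet> (TA (I Y) \<triangleleft> wi f) \<bullet> i_at (I Y) f"
proof -
  have "(TA (TA f) \<triangleleft> wi (I (src C f))) \<bullet> i_at (TA f) (I (src C f)) \<bullet> (I (TO (trg C f)) \<triangleleft> wi f)
    = nt (TA (I (trg C f))) (TA f) (TA (TA f)) (TA (I (src C f))) (Ti f) (I (src C f))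
      \<bullet> (TA (I (trg C f)) \<triangleleft> wi f) \<bullet> i_at (I (trg C f)) f"
    unfolding Ti_def by (rule wi_natural_comp) (use assms(1) in \<open>simp_all add: comp3_def\<close>)
  then show ?thesis
    unfolding Ti_at_def assms(2,3) .
qed

section \<open>Derived coherence conditions\<close>

text \<open>The unit cell \<open>f \<rightarrow> n \<odot> T f \<odot> i\<close> is invertible, so \<open>n \<odot> T(-)\<close> is faithful.\<close>

lemma N_T_faithful:
  assumes "N X \<triangleleft> T.wF \<phi> = N X \<triangleleft> T.wF \<psi>" "valid \<phi>" "valid \<psi>" "wdom \<psi> = wdom \<phi>" "wcod \<psi> = wcod \<phi>"
    "trg C (wdom \<phi>) = TO X" and [simp]: "X \<in> Obj C"
  shows "\<phi> = \<psi>"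
proof -
  define f g where "f = wdom \<phi>" and "g = wcod \<phi>"
  have [simp]: "f \<in> Arr C" "g \<in> Arr C" "src C g = src C f" "trg C f = TO X" "trg C g = TO X"
    using assms validD[of \<phi>] by (auto simp: f_def g_def)
  \<comment> \<open>Naturality of the invertible unit cell: \<open>\<chi>\<close> followed by the
    unit at \<open>g\<close> depends on \<open>\<chi>\<close> only through
    \<open>N X \<triangleleft> T.wF \<chi>\<close>.\<close>
  have *: "(N X \<triangleleft> wi g) \<bullet> lam_at X g \<bullet> \<chi> = as (N X) (TA g) (I (src C f)) \<bullet> ((N X \<triangleleft> T.wF \<chi>) \<triangleright> I (src C f))
      \<bullet> winv (as (N X) (TA f) (I (src C f))) \<bullet> (N X \<triangleleft> wi f) \<bullet> lam_at X f"
    if "valid \<chi>" "wdom \<chi> = f" "wcod \<chi> = g" for \<chi>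
  proof -
    have "(N X \<triangleleft> wi g) \<bullet> lam_at X g \<bullet> \<chi> = (N X \<triangleleft> (wi g \<bullet> (I (TO X) \<triangleleft> \<chi>))) \<bullet> lam_at X f"
      using that lam_at_natural[of \<chi> f g X] by simp
    also have "\<dots> = (N X \<triangleleft> (T.wF \<chi> \<triangleright> I (src C f))) \<bullet> (N X \<triangleleft> wi f) \<bullet> lam_at X f"
      using that wi_natural[of \<chi> f g] by simp
    also have "\<dots> = (N X \<triangleleft> (T.wF \<chi> \<triangleright> I (src C f))) \<bullet> as (N X) (TA f) (I (src C f))
        \<bullet> winv (as (N X) (TA f) (I (src C f))) \<bullet> (N X \<triangleleft> wi f) \<bullet> lam_at X f"
      by (simp add: comp3_def)
    finally show ?thesis
      using as_natural_mid[of "T.wF \<chi>" "TA f" "TA g" "N X" "I (src C f)", THEN vc_tail] that by simp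
  qed
  have "((N X \<triangleleft> wi g) \<bullet> lam_at X g) \<bullet> \<phi> = ((N X \<triangleleft> wi g) \<bullet> lam_at X g) \<bullet> \<psi>"
    using *[of \<phi>] *[of \<psi>] assms by (simp add: f_def g_def)
  then show ?thesis
    by (rule vc_left_cancel) (use assms in \<open>auto simp: f_def[symmetric] g_def[symmetric]\<close>)
qed

text \<open>Kelly's argument: after the isomorphism \<open>Q\<close> both sides become \<open>assoc_at X h\<close>.\<close>

lemma N_Tlam_Tassoc:
  assumes [simp]: "X \<in> Obj C" "h \<in> Arr C" and h: "trg C h = TO (TO (TO X))"
  shows "N X \<triangleleft> (Tassoc_at X (TA (I (TO (TO X))) \<odot> h) \<bullet> (TA (N X) \<triangleleft> Ti_at (N X) h) \<bullet> Tlam_at X (TA (N X) \<odot> h))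
    = N X \<triangleleft> TA (N X) \<triangleleft> Tlam_at (TO X) h" (is "N X \<triangleleft> ?l = N X \<triangleleft> ?r")
proof -
  note [simp] = h
  let ?TX = "TO X" let ?TTX = "TO (TO X)"
  let ?h = "TA (I ?TTX) \<odot> h"
  \<comment> \<open>These are the factors that follow \<open>Tlam_at\<close> in the unit axiom at
    \<open>TO X\<close>, whiskered by \<open>N X\<close> and preceded by
    \<open>assoc_at\<close>.\<close>
  define Q where "Q = (N X \<triangleleft> N ?TX \<triangleleft> rho_at ?TTX h) \<bullet> (N X \<triangleleft> assoc_at ?TX ?h) \<bullet> assoc_at X (TA (N ?TX) \<odot> ?h)"
  have [simp]: "wnormal Q" "wdom Q = N X \<odot> TA (N X) \<odot> TA (N ?TX) \<odot> ?h" "wiso Q"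
    by (simp_all add: Q_def)
  have r: "Q \<bullet> (N X \<triangleleft> ?r) = assoc_at X h"
  proof -
    have "Q \<bullet> (N X \<triangleleft> ?r) = (N X \<triangleleft> ((N ?TX \<triangleleft> rho_at ?TTX h) \<bullet> assoc_at ?TX ?h \<bullet> (N ?TX \<triangleleft> Tlam_at ?TX h)))
        \<bullet> assoc_at X h"
      using assoc_at_natural[of "Tlam_at ?TX h" h _ X] by (simp add: Q_def)
    also have "\<dots> = assoc_at X h"
      by (subst coherence_unit_at) simp_all
    finally show ?thesis .
  qed
  have l: "Q \<bullet> (N X \<triangleleft> ?l) = assoc_at X h"
  proof -
    \<comment> \<open>The associativity axiom at \<open>?h\<close> applies here; afterwards
      \<open>rho_modification_at\<close> absorbs \<open>n_at\<close> and \<open>Ti_at\<close>, which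
      leaves the unit axiom at \<open>X\<close>.\<close>
    have "Q \<bullet> (N X \<triangleleft> ?l) = (N X \<triangleleft> N ?TX \<triangleleft> rho_at ?TTX h) \<bullet> assoc_at X (N ?TTX \<odot> ?h)
        \<bullet> (N X \<triangleleft> n_at (N X) ?h) \<bullet> assoc_at X (TA (TA (N X)) \<odot> ?h)
        \<bullet> (N X \<triangleleft> TA (N X) \<triangleleft> Ti_at (N X) h) \<bullet> (N X \<triangleleft> Tlam_at X (TA (N X) \<odot> h))"
      using coherence_assoc_at[of X ?h, THEN vc_tail] by (simp add: Q_def)
    also have "\<dots> = assoc_at X h \<bullet> (N X \<triangleleft> TA (N X) \<triangleleft> rho_at ?TTX h)
        \<bullet> (N X \<triangleleft> n_at (N X) ?h) \<bullet> (N X \<triangleleft> N ?TX \<triangleleft> Ti_at (N X) h) \<bullet> assoc_at X (TA (I ?TX) \<odot> TA (N X) \<odot> h)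
        \<bullet> (N X \<triangleleft> Tlam_at X (TA (N X) \<odot> h))"
      using assoc_at_natural[of "rho_at ?TTX h" _ h X, THEN vc_tail]
        assoc_at_natural[of "Ti_at (N X) h" _ _ X, THEN vc_tail] by simp
    also have "\<dots> = assoc_at X h \<bullet> (N X \<triangleleft> ((TA (N X) \<triangleleft> rho_at ?TTX h) \<bullet> n_at (N X) ?h \<bullet> (N ?TX \<triangleleft> Ti_at (N X) h)))
        \<bullet> assoc_at X (TA (I ?TX) \<odot> TA (N X) \<odot> h) \<bullet> (N X \<triangleleft> Tlam_at X (TA (N X) \<odot> h))"
      by simp
    also have "\<dots> = assoc_at X h \<bullet> (N X \<triangleleft> rho_at ?TX (TA (N X) \<odot> h))
        \<bullet> assoc_at X (TA (I ?TX) \<odot> TA (N X) \<odot> h) \<bullet> (N X \<triangleleft> Tlam_at X (TA (N X) \<odot> h))"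
      using rho_modification_at[of "N X" h] by simp
    also have "\<dots> = assoc_at X h"
      by (subst coherence_unit_at) simp_all
    finally show ?thesis .
  qed
  show ?thesis
    by (rule vc_left_cancel[of Q]) (use l r in simp_all)
qed

text \<open>Under \<open>T\<close> and after the comparison \<open>T.wm (N X) h\<close>, the two
  sides become \<open>m\<close> composed with the two cells compared in \<open>N_Tlam_Tassoc\<close>
  at \<open>TA h\<close>; \<open>N_T_faithful\<close> then removes \<open>T\<close>.\<close>

lemma lam_assoc_at:
  assumes [simp]: "X \<in> Obj C" "h \<in> Arr C" and h: "trg C h = TO (TO X)"
  shows "assoc_at X (I (TO (TO X)) \<odot> h) \<bullet> (N X \<triangleleft> i_at (N X) h) \<bullet> lam_at X (N X \<odot> h)
    = N X \<triangleleft> lam_at (TO X) h" (is "?l = ?r")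
proof (rule N_T_faithful[of X])
  note [simp] = h
  let ?TX = "TO X" let ?TTX = "TO (TO X)"
  \<comment> \<open>The comparison from the composite of the four images under \<open>T\<close> to
    the image of the composite, shared by both sides.\<close>
  define m where "m = T.wmm (N X) (N ?TX) (I ?TTX \<odot> h) \<bullet> (TA (N X) \<triangleleft> TA (N ?TX) \<triangleleft> T.wm (I ?TTX) h)"
  have l: "T.wF ?l \<bullet> T.wm (N X) h = m \<bullet> Tassoc_at X (TA (I ?TTX) \<odot> TA h) \<bullet> (TA (N X) \<triangleleft> Ti_at (N X) (TA h))
      \<bullet> Tlam_at X (TA (N X) \<odot> TA h)"
  proof -
    have 1: "T.wF (lam_at X (N X \<odot> h)) = T.wmm (N X) (I ?TX) (N X \<odot> h) \<bullet> Tlam_at X (TA (N X \<odot> h))"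
      unfolding lam_at_def Tlam_at_def Tlam_def by (rule T.wF_nt02) (auto simp: comp3_def)
    have 2: "Tlam_at X (TA (N X \<odot> h)) \<bullet> T.wm (N X) h
      = (TA (N X) \<triangleleft> TA (I ?TX) \<triangleleft> T.wm (N X) h) \<bullet> Tlam_at X (TA (N X) \<odot> TA h)"
      unfolding Tlam_at_def by (rule nt02_natural[where X = "TO (TO X)"]) auto
    have 3: "T.wF (i_at (N X) h) \<bullet> T.wmm (I ?TX) (N X) h = T.wmm (TA (N X)) (I ?TTX) h \<bullet> Ti_at (N X) (TA h)"
      using T.wF_nt[of "wi (N X)" "I ?TX" "N X" "TA (N X)" "I ?TTX" h] by (simp add: i_at_def Ti_at_def Ti_def comp3_def)
    have 4: "T.wF (assoc_at X (I ?TTX \<odot> h)) \<bullet> T.wmm (N X) (TA (N X)) (I ?TTX \<odot> h)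
      = T.wmm (N X) (N ?TX) (I ?TTX \<odot> h) \<bullet> Tassoc_at X (TA (I ?TTX \<odot> h))"
      unfolding assoc_at_def Tassoc_at_def Tassoc_def by (rule T.wF_nt) (auto simp: comp3_def)
    have 5: "Tassoc_at X (TA (I ?TTX \<odot> h)) \<bullet> (TA (N X) \<triangleleft> TA (TA (N X)) \<triangleleft> T.wm (I ?TTX) h)
      = (TA (N X) \<triangleleft> TA (N ?TX) \<triangleleft> T.wm (I ?TTX) h) \<bullet> Tassoc_at X (TA (I ?TTX) \<odot> TA h)"
      unfolding Tassoc_at_def by (rule nt_natural) auto
    have "T.wF ?l \<bullet> T.wm (N X) h = T.wF (assoc_at X (I ?TTX \<odot> h)) \<bullet> T.wF (N X \<triangleleft> i_at (N X) h)
        \<bullet> T.wmm (N X) (I ?TX) (N X \<odot> h) \<bullet> (TA (N X) \<triangleleft> TA (I ?TX) \<triangleleft> T.wm (N X) h) \<bullet> Tlam_at X (TA (N X) \<odot> TA h)"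
      by (simp add: 1 2)
    also have "\<dots> = T.wF (assoc_at X (I ?TTX \<odot> h)) \<bullet> T.wm (N X) (TA (N X) \<odot> I ?TTX \<odot> h)
        \<bullet> (TA (N X) \<triangleleft> (T.wF (i_at (N X) h) \<bullet> T.wmm (I ?TX) (N X) h)) \<bullet> Tlam_at X (TA (N X) \<odot> TA h)"
      using T.wm_natural_right[of "i_at (N X) h" _ _ "N X", THEN vc_tail] by (simp add: T.wmm_def)
    also have "\<dots> = T.wF (assoc_at X (I ?TTX \<odot> h)) \<bullet> T.wmm (N X) (TA (N X)) (I ?TTX \<odot> h)
        \<bullet> (TA (N X) \<triangleleft> TA (TA (N X)) \<triangleleft> T.wm (I ?TTX) h) \<bullet> (TA (N X) \<triangleleft> Ti_at (N X) (TA h))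
        \<bullet> Tlam_at X (TA (N X) \<odot> TA h)"
      unfolding 3 by (simp add: T.wmm_def)
    finally show ?thesis
      by (simp add: 4[THEN vc_tail] 5[THEN vc_tail] m_def)
  qed
  have r: "T.wF ?r \<bullet> T.wm (N X) h = m \<bullet> (TA (N X) \<triangleleft> Tlam_at ?TX (TA h))"
  proof -
    have 1: "T.wF (lam_at ?TX h) = T.wmm (N ?TX) (I ?TTX) h \<bullet> Tlam_at ?TX (TA h)"
      unfolding lam_at_def Tlam_at_def Tlam_def by (rule T.wF_nt02) (auto simp: comp3_def)
    have "T.wF ?r \<bullet> T.wm (N X) h = T.wm (N X) (N ?TX \<odot> I ?TTX \<odot> h) \<bullet> (TA (N X) \<triangleleft> T.wF (lam_at ?TX h))"
      using T.wm_natural_right[of "lam_at ?TX h" h _ "N X"] by simp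
    also have "\<dots> = m \<bullet> (TA (N X) \<triangleleft> Tlam_at ?TX (TA h))"
      by (simp add: 1 m_def T.wmm_def)
    finally show ?thesis .
  qed
  have [simp]: "wnormal m" "wdom m = TA (N X) \<odot> TA (N ?TX) \<odot> TA (I ?TTX) \<odot> TA h"
    by (simp_all add: m_def)
  have "(N X \<triangleleft> T.wF ?l) \<bullet> (N X \<triangleleft> T.wm (N X) h) = (N X \<triangleleft> T.wF ?r) \<bullet> (N X \<triangleleft> T.wm (N X) h)"
  proof -
    have "N X \<triangleleft> (T.wF ?l \<bullet> T.wm (N X) h) = (N X \<triangleleft> m) \<bullet> (N X \<triangleleft>
      (Tassoc_at X (TA (I ?TTX) \<odot> TA h) \<bullet> (TA (N X) \<triangleleft> Ti_at (N X) (TA h)) \<bullet> Tlam_at X (TA (N X) \<odot> TA h)))"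
      unfolding l by simp
    also have "\<dots> = N X \<triangleleft> (T.wF ?r \<bullet> T.wm (N X) h)"
      by (subst N_Tlam_Tassoc) (simp_all add: r del: T.wF_vc)
    finally show ?thesis by simp
  qed
  then show "N X \<triangleleft> T.wF ?l = N X \<triangleleft> T.wF ?r"
    by (rule vc_right_cancel) auto
qed (use h in auto)

text \<open>The instance \<open>I (TO X) \<odot> I X\<close> is the one that
  \<open>lam_rho_modification\<close> produces for the 1-cell \<open>I X\<close>. It follows from
  the unit axiom because \<open>Tlam_at_I\<close> takes \<lambda> out of \<open>T\<close> there, and
  \<open>lam_assoc_at\<close> then removes \<alpha>.\<close>

lemma lam_rho_at_id:
  assumes [simp]: "X \<in> Obj C"
  shows "N X \<triangleleft> (rho_at (TO X) (I (TO X) \<odot> I X) \<bullet> (N (TO X) \<triangleleft> i_at (I (TO X)) (I X)) \<bullet> lam_at (TO X) (I (TO X) \<odot> I X))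
    = wid (N X \<odot> I (TO X) \<odot> I X)"
proof -
  let ?TX = "TO X" let ?TTX = "TO (TO X)" let ?h = "I (TO X) \<odot> I X"
  \<comment> \<open>Naturality of \<open>lam_at\<close> at its own component, which is invertible
    and so cancels.\<close>
  have 1: "N X \<triangleleft> I ?TX \<triangleleft> lam_at X (I X) = lam_at X (N X \<odot> ?h)"
    by (rule vc_right_cancel[of _ "lam_at X (I X)"])
      (use lam_at_natural[of "lam_at X (I X)" "I X" _ X] in auto)
  have "wid (N X \<odot> ?h) = (N X \<triangleleft> rho_at ?TX ?h) \<bullet> assoc_at X (TA (I ?TX) \<odot> ?h) \<bullet> (N X \<triangleleft> Tlam_at X ?h)"
    by (rule coherence_unit_at[symmetric]) auto
  also have "\<dots> = (N X \<triangleleft> rho_at ?TX ?h) \<bullet> assoc_at X (TA (I ?TX) \<odot> ?h)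
      \<bullet> (N X \<triangleleft> TA (N X) \<triangleleft> i_at (I ?TX) (I X)) \<bullet> (N X \<triangleleft> i_at (N X) ?h) \<bullet> lam_at X (N X \<odot> ?h)"
    by (simp add: Tlam_at_I 1)
  also have "\<dots> = (N X \<triangleleft> rho_at ?TX ?h) \<bullet> (N X \<triangleleft> N ?TX \<triangleleft> i_at (I ?TX) (I X))
      \<bullet> assoc_at X (I ?TTX \<odot> ?h) \<bullet> (N X \<triangleleft> i_at (N X) ?h) \<bullet> lam_at X (N X \<odot> ?h)"
    using assoc_at_natural[of "i_at (I ?TX) (I X)" _ _ X, THEN vc_tail] by simp
  also have "\<dots> = (N X \<triangleleft> rho_at ?TX ?h) \<bullet> (N X \<triangleleft> N ?TX \<triangleleft> i_at (I ?TX) (I X)) \<bullet> (N X \<triangleleft> lam_at ?TX ?h)"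
    by (subst lam_assoc_at) simp_all
  finally show ?thesis by simp
qed

text \<open>Pasted from \<lambda>, the naturality of \<open>i\<close> and \<rho>, the endomorphisms
  of the 1-cells \<open>I X\<close> form a modification from \<open>i\<close> to itself; the right
  side contains the one of \<open>I Y\<close> evaluated at \<open>f\<close>.\<close>

lemma lam_rho_modification:
  assumes [simp]: "f \<in> Arr C" and f: "src C f = X" "trg C f = Y"
  shows "(TA f \<triangleleft> (rho_at X (I X) \<bullet> (N X \<triangleleft> wi (I X)) \<bullet> lam_at X (I X))) \<bullet> wi f
    = wi f \<bullet> rho_at Y (I Y \<odot> f) \<bullet> (N Y \<triangleleft> i_at (I Y) f) \<bullet> lam_at Y (I Y \<odot> f)"
proof -
  note [simp] = f
  have [simp]: "X \<in> Obj C" "Y \<in> Obj C" using src_obj[of f] trg_obj[of f] by simp_all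
  have "(TA f \<triangleleft> (rho_at X (I X) \<bullet> (N X \<triangleleft> wi (I X)) \<bullet> lam_at X (I X))) \<bullet> wi f
    = (TA f \<triangleleft> rho_at X (I X)) \<bullet> (TA f \<triangleleft> N X \<triangleleft> wi (I X)) \<bullet> n_at f (I (TO X) \<odot> I X)
      \<bullet> (N Y \<triangleleft> i_at (TA f) (I X)) \<bullet> lam_at Y (TA f \<odot> I X) \<bullet> wi f"
    using lam_modification_at[of f "I X"] by (simp flip: vc_assoc)
  also have "\<dots> = (TA f \<triangleleft> rho_at X (I X)) \<bullet> n_at f (TA (I X) \<odot> I X)
      \<bullet> (N Y \<triangleleft> ((TA (TA f) \<triangleleft> wi (I X)) \<bullet> i_at (TA f) (I X) \<bullet> (I (TO Y) \<triangleleft> wi f))) \<bullet> lam_at Y (I Y \<odot> f)"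
    using n_at_natural[of "wi (I X)" "I (TO X) \<odot> I X" "TA (I X) \<odot> I X" f, THEN vc_tail]
      lam_at_natural[of "wi f" "I Y \<odot> f" "TA f \<odot> I X" Y] by simp
  also have "\<dots> = ((TA f \<triangleleft> rho_at X (I X)) \<bullet> n_at f (TA (I X) \<odot> I X) \<bullet> (N Y \<triangleleft> Ti_at f (I X)))
      \<bullet> (N Y \<triangleleft> TA (I Y) \<triangleleft> wi f) \<bullet> (N Y \<triangleleft> i_at (I Y) f) \<bullet> lam_at Y (I Y \<odot> f)"
    by (subst Ti_at_I) simp_all
  also have "\<dots> = rho_at Y (TA f \<odot> I X) \<bullet> (N Y \<triangleleft> TA (I Y) \<triangleleft> wi f) \<bullet> (N Y \<triangleleft> i_at (I Y) f) \<bullet> lam_at Y (I Y \<odot> f)"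
    using rho_modification_at[of f "I X"] by simp
  also have "\<dots> = wi f \<bullet> rho_at Y (I Y \<odot> f) \<bullet> (N Y \<triangleleft> i_at (I Y) f) \<bullet> lam_at Y (I Y \<odot> f)"
    using rho_at_natural[of "wi f" "I Y \<odot> f" "TA f \<odot> I X" Y, THEN vc_tail] by simp
  finally show ?thesis .
qed

text \<open>The analogue of Kelly's equality of the two unit isomorphisms at the unit object. The
  modification property at \<open>I X\<close> makes
  \<open>N X \<triangleleft> TA (I X) \<triangleleft> ?w\<close> an identity, and naturality of
  \<rho> undoes this double whiskering.\<close>

lemma lam_rho_id:
  assumes [simp]: "X \<in> Obj C"
  shows "rho_at X (I X) \<bullet> (N X \<triangleleft> wi (I X)) \<bullet> lam_at X (I X) = wid (I X)" (is "?w = _")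
proof -
  have "(N X \<triangleleft> TA (I X) \<triangleleft> ?w) \<bullet> (N X \<triangleleft> wi (I X)) = N X \<triangleleft> ((TA (I X) \<triangleleft> ?w) \<bullet> wi (I X))"
    by simp
  also have "\<dots> = (N X \<triangleleft> wi (I X)) \<bullet> (N X \<triangleleft> (rho_at (TO X) (I (TO X) \<odot> I X)
      \<bullet> (N (TO X) \<triangleleft> i_at (I (TO X)) (I X)) \<bullet> lam_at (TO X) (I (TO X) \<odot> I X)))"
    using lam_rho_modification[of "I X" X "TO X"] by simp
  also have "\<dots> = wid (N X \<odot> TA (I X) \<odot> I X) \<bullet> (N X \<triangleleft> wi (I X))"
    unfolding lam_rho_at_id[OF assms] by simp
  finally have w: "N X \<triangleleft> TA (I X) \<triangleleft> ?w = wid (N X \<odot> TA (I X) \<odot> I X)"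
    by (rule vc_right_cancel) auto
  have "?w \<bullet> rho_at X (I X) = rho_at X (I X) \<bullet> (N X \<triangleleft> TA (I X) \<triangleleft> ?w)"
    by (rule rho_at_natural[symmetric]) auto
  also have "\<dots> = wid (I X) \<bullet> rho_at X (I X)"
    unfolding w by simp
  finally show ?thesis
    by (rule vc_right_cancel) auto
qed

text \<open>The pasting that arises from the unit cell of \<open>N Y \<odot> TA f\<close>.
  \<open>lam_assoc_at\<close> removes \<alpha> and \<open>lam_modification_at\<close> removes
  \<open>n_at\<close>; both \<open>mu_eta\<close> and \<open>lax_alg_comp\<close> rest on the
  result.\<close>

lemma lam_assoc_n_at:
  assumes [simp]: "f \<in> Arr C" "h \<in> Arr C" "Y \<in> Obj C" and f: "src C f = X" "trg C f = TO Y" "trg C h = TO X"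
  shows "(N Y \<triangleleft> n_at f (I (TO X) \<odot> h)) \<bullet> assoc_at Y (TA (TA f) \<odot> I (TO X) \<odot> h)
      \<bullet> (N Y \<triangleleft> TA (N Y) \<triangleleft> i_at (TA f) h) \<bullet> (N Y \<triangleleft> i_at (N Y) (TA f \<odot> h)) \<bullet> lam_at Y (N Y \<odot> TA f \<odot> h)
    = N Y \<triangleleft> TA f \<triangleleft> lam_at X h"
proof -
  note [simp] = f
  have [simp]: "X \<in> Obj C" using src_obj[of f] by simp
  have "(N Y \<triangleleft> n_at f (I (TO X) \<odot> h)) \<bullet> assoc_at Y (TA (TA f) \<odot> I (TO X) \<odot> h)
      \<bullet> (N Y \<triangleleft> TA (N Y) \<triangleleft> i_at (TA f) h) \<bullet> (N Y \<triangleleft> i_at (N Y) (TA f \<odot> h)) \<bullet> lam_at Y (N Y \<odot> TA f \<odot> h)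
    = (N Y \<triangleleft> n_at f (I (TO X) \<odot> h)) \<bullet> (N Y \<triangleleft> N (TO Y) \<triangleleft> i_at (TA f) h)
      \<bullet> assoc_at Y (I (TO (TO Y)) \<odot> TA f \<odot> h) \<bullet> (N Y \<triangleleft> i_at (N Y) (TA f \<odot> h)) \<bullet> lam_at Y (N Y \<odot> TA f \<odot> h)"
    using assoc_at_natural[of "i_at (TA f) h" _ _ Y, THEN vc_tail] by simp
  also have "\<dots> = N Y \<triangleleft> (n_at f (I (TO X) \<odot> h) \<bullet> (N (TO Y) \<triangleleft> i_at (TA f) h) \<bullet> lam_at (TO Y) (TA f \<odot> h))"
    by (subst lam_assoc_at) simp_all
  also have "\<dots> = N Y \<triangleleft> TA f \<triangleleft> lam_at X h"
    using lam_modification_at[of f h] by simp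
  finally show ?thesis .
qed

section \<open>The cells \<mu>, \<eta> and \<theta> of the associated relative pseudomonad\<close>

definition wmu where
  "wmu Y Z g f = winv (as (N Z) (TA g) (N Y \<odot> TA f)) \<bullet> (N Z \<triangleleft> n_at g (TA f))
    \<bullet> assoc_at Z (TA (TA g) \<odot> TA f) \<bullet> (N Z \<triangleleft> winv (T.wM (N Z) (TA g) (TA f)))
    \<bullet> (N Z \<triangleleft> winv (T.wm (N Z \<odot> TA g) f))"

definition weta where
  "weta Y f = winv (as (N Y) (TA f) (I (src C f))) \<bullet> (N Y \<triangleleft> wi f) \<bullet> lam_at Y f"

lemma weta_simps [simp]:
  "wdom (weta Y f) = f" "wcod (weta Y f) = (N Y \<odot> TA f) \<odot> I (src C f)" "wnormal (weta Y f)"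
  by (simp_all add: weta_def)

lemma wiso_weta [simp]:
  "\<lbrakk>Y \<in> Obj C; f \<in> Arr C; trg C f = TO Y\<rbrakk> \<Longrightarrow> wiso (weta Y f)"
  by (simp add: weta_def comp3_def)

lemma wval_weta:
  "\<lbrakk>Y \<in> Obj C; f \<in> Arr C; src C f = X; trg C f = TO Y\<rbrakk> \<Longrightarrow> wval (weta Y f) = associated_\<eta> C T n i \<l> X Y f"
  using src_obj[of f] by (simp add: weta_def associated_\<eta>_def lam_at_def nt02_def comp3_def wval_winv)

lemma winv_wM:
  assumes "g \<in> Arr C" "f \<in> Arr C" "h \<in> Arr C" "src C g = trg C f" "TO (src C f) = trg C h"
  shows "winv (T.wM g f h) = as (TA g) (TA f) h \<bullet> (winv (T.wm g f) \<triangleright> h)"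
  using assms by (simp add: T.wM_def comp3_def)

lemma wmu_simps [simp]:
  assumes "f \<in> Arr C" "g \<in> Arr C" "Y \<in> Obj C" "Z \<in> Obj C" "src C g = Y" "trg C f = TO Y" "trg C g = TO Z"
  shows "valid (wmu Y Z g f)"
    "wdom (wmu Y Z g f) = N Z \<odot> TA ((N Z \<odot> TA g) \<odot> f)"
    "wcod (wmu Y Z g f) = (N Z \<odot> TA g) \<odot> N Y \<odot> TA f"
  using assms by (simp_all add: wmu_def comp3_def)

text \<open>Pure regrouping: \<open>n_at\<close>, \<open>assoc_at\<close> and \<open>winv_wM\<close>
  unfold to the ten factors of \<open>associated_\<mu>\<close>.\<close>

lemma wval_wmu:
  assumes "f \<in> Arr C" "g \<in> Arr C" "Y \<in> Obj C" "Z \<in> Obj C" "src C f = X" "src C g = Y" "trg C f = TO Y" "trg C g = TO Z"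
  shows "wval (wmu Y Z g f) = associated_\<mu> C T n \<alpha> X Y Z g f"
proof -
  have e: "wmu Y Z g f = winv (as (N Z) (TA g) (N Y \<odot> TA f)) \<bullet> (N Z \<triangleleft> as (TA g) (N Y) (TA f))
      \<bullet> (N Z \<triangleleft> (wn g \<triangleright> TA f)) \<bullet> (N Z \<triangleleft> winv (as (N (TO Z)) (TA (TA g)) (TA f)))
      \<bullet> as (N Z) (N (TO Z)) (TA (TA g) \<odot> TA f) \<bullet> (wassoc Z \<triangleright> (TA (TA g) \<odot> TA f))
      \<bullet> winv (as (N Z) (TA (N Z)) (TA (TA g) \<odot> TA f)) \<bullet> (N Z \<triangleleft> as (TA (N Z)) (TA (TA g)) (TA f))
      \<bullet> (N Z \<triangleleft> (winv (T.wm (N Z) (TA g)) \<triangleright> TA f)) \<bullet> (N Z \<triangleleft> winv (T.wm (N Z \<odot> TA g) f))"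
    using assms by (simp add: wmu_def winv_wM n_at_def assoc_at_def nt_def del: wiso_lw(2) wiso_rw(2))
  show ?thesis
    unfolding e using assms by (simp add: associated_\<mu>_def Let_def comp3_def wval_winv del: wiso_lw(2) wiso_rw(2))
qed

lemma as2_winv_wM:
  assumes [simp]: "g \<in> Arr C" "f \<in> Arr C" "x \<in> Arr C" "h \<in> Arr C" "src C g = trg C f"
    "trg C x = TO (src C f)" "src C x = trg C h"
  shows "as2 (TA g) (TA f) x h \<bullet> winv (T.wM g f x \<triangleright> h) = winv (T.wM g f (x \<odot> h)) \<bullet> as (TA (g \<odot> f)) x h"
proof (rule vc_left_cancel[of "T.wM g f (x \<odot> h)"], rule vc_right_cancel[of _ "T.wM g f x \<triangleright> h"])
  have "T.wM g f (x \<odot> h) \<bullet> as2 (TA g) (TA f) x h = as (TA (g \<odot> f)) x h \<bullet> (T.wM g f x \<triangleright> h)"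
    using T.wM_rw[of g f x h] by simp
  then show "(T.wM g f (x \<odot> h) \<bullet> as2 (TA g) (TA f) x h \<bullet> winv (T.wM g f x \<triangleright> h)) \<bullet> (T.wM g f x \<triangleright> h)
    = (T.wM g f (x \<odot> h) \<bullet> winv (T.wM g f (x \<odot> h)) \<bullet> as (TA (g \<odot> f)) x h) \<bullet> (T.wM g f x \<triangleright> h)"
    by (simp add: comp3_def)
qed (auto simp: comp3_def)

lemma wM_natural_winv:
  assumes "valid \<chi>" "wdom \<chi> = h" "wcod \<chi> = h'" "g \<in> Arr C" "f \<in> Arr C" "src C g = trg C f" "trg C h = TO (src C f)"
  shows "winv (T.wM g f h') \<bullet> (TA (g \<odot> f) \<triangleleft> \<chi>) = (TA g \<triangleleft> TA f \<triangleleft> \<chi>) \<bullet> winv (T.wM g f h)"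
proof (rule vc_left_cancel[of "T.wM g f h'"])
  show "T.wM g f h' \<bullet> winv (T.wM g f h') \<bullet> (TA (g \<odot> f) \<triangleleft> \<chi>)
    = T.wM g f h' \<bullet> (TA g \<triangleleft> TA f \<triangleleft> \<chi>) \<bullet> winv (T.wM g f h)"
    using assms validD(3-6)[of \<chi>] T.wM_natural[of \<chi> h h' g f, THEN vc_tail] by simp
qed (use assms validD(3-6)[of \<chi>] in simp_all)

text \<open>Moves the trailing \<open>I X\<close> inwards, so that each cell of \<open>wmu\<close>
  is replaced by its component at a 1-cell ending in \<open>I X\<close>, the form to which the
  component equations apply.\<close>

lemma mu_eta_nested:
  assumes [simp]: "f \<in> Arr C" "g \<in> Arr C" "Y \<in> Obj C" "Z \<in> Obj C"
    and t: "src C f = X" "src C g = Y" "trg C f = TO Y" "trg C g = TO Z"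
  shows "(N Z \<triangleleft> TA g \<triangleleft> as (N Y) (TA f) (I X)) \<bullet> as (N Z) (TA g) ((N Y \<odot> TA f) \<odot> I X)
      \<bullet> as (N Z \<odot> TA g) (N Y \<odot> TA f) (I X) \<bullet> (wmu Y Z g f \<triangleright> I X) \<bullet> weta Z ((N Z \<odot> TA g) \<odot> f)
    = (N Z \<triangleleft> n_at g (TA f \<odot> I X)) \<bullet> assoc_at Z (TA (TA g) \<odot> TA f \<odot> I X)
      \<bullet> (N Z \<triangleleft> winv (T.wM (N Z) (TA g) (TA f \<odot> I X))) \<bullet> (N Z \<triangleleft> TA (N Z \<odot> TA g) \<triangleleft> wi f)
      \<bullet> (N Z \<triangleleft> i_at (N Z \<odot> TA g) f) \<bullet> lam_at Z ((N Z \<odot> TA g) \<odot> f)" (is "?lhs = ?rhs")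
proof -
  note [simp] = t
  have [simp]: "X \<in> Obj C" using src_obj[of f] by simp
  let ?s = "N Y \<odot> TA f" let ?t = "N Z \<odot> TA g" let ?tgf = "TA (TA g) \<odot> TA f"
  \<comment> \<open>The pentagon splits off \<open>as (N Z) (TA g) ?s \<triangleright> I X\<close>,
    which cancels the leftmost factor of \<open>wmu\<close>.\<close>
  have p: "as (N Z) (TA g) (?s \<odot> I X) \<bullet> as ?t ?s (I X)
    = (N Z \<triangleleft> as (TA g) ?s (I X)) \<bullet> as (N Z) (TA g \<odot> ?s) (I X) \<bullet> (as (N Z) (TA g) ?s \<triangleright> I X)"
    by (rule pentagon_as) (simp_all add: comp3_def)
  have 1: "as2 (TA g) (N Y) (TA f) (I X) \<bullet> (n_at g (TA f) \<triangleright> I X)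
    = n_at g (TA f \<odot> I X) \<bullet> as2 (N (TO Z)) (TA (TA g)) (TA f) (I X)"
    using nt_rw[of "wn g" "N (TO Z)" "TA (TA g)" "TA g" "N Y" "TA f" "I X"] by (simp add: n_at_def comp3_def)
  have 2: "as2 (N Z) (N (TO Z)) ?tgf (I X) \<bullet> (assoc_at Z ?tgf \<triangleright> I X)
    = assoc_at Z (?tgf \<odot> I X) \<bullet> as2 (N Z) (TA (N Z)) ?tgf (I X)"
    unfolding assoc_at_def by (rule nt_rw) (simp_all add: comp3_def)
  have 3: "as2 (TA (N Z)) (TA (TA g)) (TA f) (I X) \<bullet> winv (T.wM (N Z) (TA g) (TA f) \<triangleright> I X)
    = winv (T.wM (N Z) (TA g) (TA f \<odot> I X)) \<bullet> as (TA ?t) (TA f) (I X)"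
    by (rule as2_winv_wM) simp_all
  have 4: "(N Z \<triangleleft> N (TO Z) \<triangleleft> as (TA (TA g)) (TA f) (I X)) \<bullet> as2 (N Z) (N (TO Z)) ?tgf (I X)
    = (N Z \<triangleleft> as2 (N (TO Z)) (TA (TA g)) (TA f) (I X)) \<bullet> as (N Z) (N (TO Z) \<odot> ?tgf) (I X)"
    by (simp add: as2_def)
  have 5: "(N Z \<triangleleft> TA (N Z) \<triangleleft> as (TA (TA g)) (TA f) (I X)) \<bullet> as2 (N Z) (TA (N Z)) ?tgf (I X)
    = (N Z \<triangleleft> as2 (TA (N Z)) (TA (TA g)) (TA f) (I X)) \<bullet> as (N Z) (TA (N Z) \<odot> ?tgf) (I X)"
    by (simp add: as2_def)
  have 6: "assoc_at Z (TA (TA g) \<odot> TA f \<odot> I X) \<bullet> (N Z \<triangleleft> TA (N Z) \<triangleleft> as (TA (TA g)) (TA f) (I X))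
    = (N Z \<triangleleft> N (TO Z) \<triangleleft> as (TA (TA g)) (TA f) (I X)) \<bullet> assoc_at Z (?tgf \<odot> I X)"
    by (rule assoc_at_natural) simp_all
  have mid: "as (N Z) b' (I X) \<bullet> ((N Z \<triangleleft> \<chi>) \<triangleright> I X) = (N Z \<triangleleft> (\<chi> \<triangleright> I X)) \<bullet> as (N Z) b (I X)"
    if "wdom \<chi> = b" "wcod \<chi> = b'" for \<chi> b b'
    using that by (rule as_natural_mid)
  have "?lhs = (N Z \<triangleleft> as2 (TA g) (N Y) (TA f) (I X)) \<bullet> as (N Z) (TA g \<odot> ?s) (I X)
      \<bullet> ((N Z \<triangleleft> n_at g (TA f)) \<triangleright> I X) \<bullet> (assoc_at Z ?tgf \<triangleright> I X)
      \<bullet> ((N Z \<triangleleft> winv (T.wM (N Z) (TA g) (TA f))) \<triangleright> I X)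
      \<bullet> ((N Z \<triangleleft> winv (T.wm ?t f)) \<triangleright> I X) \<bullet> weta Z (?t \<odot> f)"
    by (simp add: p[THEN vc_tail] as2_def wmu_def comp3_def)
  also have "\<dots> = (N Z \<triangleleft> n_at g (TA f \<odot> I X)) \<bullet> (N Z \<triangleleft> as2 (N (TO Z)) (TA (TA g)) (TA f) (I X))
      \<bullet> as (N Z) (N (TO Z) \<odot> ?tgf) (I X) \<bullet> (assoc_at Z ?tgf \<triangleright> I X)
      \<bullet> ((N Z \<triangleleft> winv (T.wM (N Z) (TA g) (TA f))) \<triangleright> I X)
      \<bullet> ((N Z \<triangleleft> winv (T.wm ?t f)) \<triangleright> I X) \<bullet> weta Z (?t \<odot> f)"
    using mid[of "n_at g (TA f)", THEN vc_tail] arg_cong[OF 1, of "\<lambda>x. N Z \<triangleleft> x", simplified, THEN vc_tail]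
    by simp
  also have "\<dots> = (N Z \<triangleleft> n_at g (TA f \<odot> I X)) \<bullet> (N Z \<triangleleft> N (TO Z) \<triangleleft> as (TA (TA g)) (TA f) (I X))
      \<bullet> assoc_at Z (?tgf \<odot> I X) \<bullet> as2 (N Z) (TA (N Z)) ?tgf (I X)
      \<bullet> ((N Z \<triangleleft> winv (T.wM (N Z) (TA g) (TA f))) \<triangleright> I X)
      \<bullet> ((N Z \<triangleleft> winv (T.wm ?t f)) \<triangleright> I X) \<bullet> weta Z (?t \<odot> f)"
    unfolding 4[symmetric, THEN vc_tail] vc_assoc 2[THEN vc_tail] ..
  also have "\<dots> = (N Z \<triangleleft> n_at g (TA f \<odot> I X)) \<bullet> assoc_at Z (TA (TA g) \<odot> TA f \<odot> I X)
      \<bullet> (N Z \<triangleleft> as2 (TA (N Z)) (TA (TA g)) (TA f) (I X)) \<bullet> as (N Z) (TA (N Z) \<odot> ?tgf) (I X)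
      \<bullet> ((N Z \<triangleleft> winv (T.wM (N Z) (TA g) (TA f))) \<triangleright> I X)
      \<bullet> ((N Z \<triangleleft> winv (T.wm ?t f)) \<triangleright> I X) \<bullet> weta Z (?t \<odot> f)"
    unfolding 5[THEN vc_tail, unfolded vc_assoc, symmetric] 6[symmetric, THEN vc_tail] vc_assoc ..
  also have "\<dots> = (N Z \<triangleleft> n_at g (TA f \<odot> I X)) \<bullet> assoc_at Z (TA (TA g) \<odot> TA f \<odot> I X)
      \<bullet> (N Z \<triangleleft> (as2 (TA (N Z)) (TA (TA g)) (TA f) (I X) \<bullet> winv (T.wM (N Z) (TA g) (TA f) \<triangleright> I X)))
      \<bullet> (N Z \<triangleleft> winv (T.wm ?t f \<triangleright> I X)) \<bullet> (N Z \<triangleleft> wi (?t \<odot> f)) \<bullet> lam_at Z (?t \<odot> f)"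
    using mid[of "winv (T.wM (N Z) (TA g) (TA f))", OF refl refl, THEN vc_tail]
      mid[of "winv (T.wm ?t f)", OF refl refl, THEN vc_tail]
    by (simp add: weta_def comp3_def)
  also have "\<dots> = (N Z \<triangleleft> n_at g (TA f \<odot> I X)) \<bullet> assoc_at Z (TA (TA g) \<odot> TA f \<odot> I X)
      \<bullet> (N Z \<triangleleft> (winv (T.wM (N Z) (TA g) (TA f \<odot> I X)) \<bullet> as (TA ?t) (TA f) (I X)
        \<bullet> winv (T.wm ?t f \<triangleright> I X) \<bullet> wi (?t \<odot> f))) \<bullet> lam_at Z (?t \<odot> f)"
    unfolding 3 by (simp add: comp3_def)
  also have "winv (T.wM (N Z) (TA g) (TA f \<odot> I X)) \<bullet> as (TA ?t) (TA f) (I X)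
        \<bullet> winv (T.wm ?t f \<triangleright> I X) \<bullet> wi (?t \<odot> f)
      = winv (T.wM (N Z) (TA g) (TA f \<odot> I X)) \<bullet> (TA ?t \<triangleleft> wi f) \<bullet> i_at ?t f"
    by (simp add: wi_comp T.wM_def comp3_def)
  finally show ?thesis by simp
qed

text \<open>Naturality carries \<open>wi f\<close> to the left end. What remains is the left side of
  \<open>lam_assoc_n_at\<close> for \<open>g\<close> at \<open>f\<close>, so only \<lambda> and
  \<open>wi f\<close> survive, and these make up \<open>weta Y f\<close>.\<close>

lemma mu_eta:
  assumes [simp]: "f \<in> Arr C" "g \<in> Arr C" "Y \<in> Obj C" "Z \<in> Obj C"
    and t: "src C f = X" "src C g = Y" "trg C f = TO Y" "trg C g = TO Z"
  shows "as (N Z \<odot> TA g) (N Y \<odot> TA f) (I X) \<bullet> (wmu Y Z g f \<triangleright> I X) \<bullet> weta Z ((N Z \<odot> TA g) \<odot> f)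
    = (N Z \<odot> TA g) \<triangleleft> weta Y f" (is "?lhs = ?rhs")
proof -
  note [simp] = t
  have [simp]: "X \<in> Obj C" using src_obj[of f] by simp
  let ?s = "N Y \<odot> TA f" let ?t = "N Z \<odot> TA g"
  let ?P = "(N Z \<triangleleft> TA g \<triangleleft> as (N Y) (TA f) (I X)) \<bullet> as (N Z) (TA g) (?s \<odot> I X)"
  have "?P \<bullet> ?lhs = (N Z \<triangleleft> n_at g (TA f \<odot> I X)) \<bullet> assoc_at Z (TA (TA g) \<odot> TA f \<odot> I X)
      \<bullet> (N Z \<triangleleft> winv (T.wM (N Z) (TA g) (TA f \<odot> I X))) \<bullet> (N Z \<triangleleft> TA (N Z \<odot> TA g) \<triangleleft> wi f)
      \<bullet> (N Z \<triangleleft> i_at (N Z \<odot> TA g) f) \<bullet> lam_at Z ((N Z \<odot> TA g) \<odot> f)"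
    unfolding vc_assoc by (rule mu_eta_nested) simp_all
  also have "\<dots> = (N Z \<triangleleft> n_at g (TA f \<odot> I X)) \<bullet> assoc_at Z (TA (TA g) \<odot> TA f \<odot> I X)
      \<bullet> (N Z \<triangleleft> (winv (T.wM (N Z) (TA g) (TA f \<odot> I X)) \<bullet> (TA ?t \<triangleleft> wi f)))
      \<bullet> (N Z \<triangleleft> i_at ?t f) \<bullet> lam_at Z (?t \<odot> f)"
    by simp
  also have "winv (T.wM (N Z) (TA g) (TA f \<odot> I X)) \<bullet> (TA ?t \<triangleleft> wi f)
      = (TA (N Z) \<triangleleft> TA (TA g) \<triangleleft> wi f) \<bullet> winv (T.wM (N Z) (TA g) (I (TO Y) \<odot> f))"
    by (rule wM_natural_winv) simp_all
  also have "(N Z \<triangleleft> n_at g (TA f \<odot> I X)) \<bullet> assoc_at Z (TA (TA g) \<odot> TA f \<odot> I X)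
      \<bullet> (N Z \<triangleleft> ((TA (N Z) \<triangleleft> TA (TA g) \<triangleleft> wi f) \<bullet> winv (T.wM (N Z) (TA g) (I (TO Y) \<odot> f))))
      \<bullet> (N Z \<triangleleft> i_at ?t f) \<bullet> lam_at Z (?t \<odot> f)
    = (N Z \<triangleleft> TA g \<triangleleft> N Y \<triangleleft> wi f) \<bullet> (N Z \<triangleleft> n_at g (I (TO Y) \<odot> f)) \<bullet> assoc_at Z (TA (TA g) \<odot> I (TO Y) \<odot> f)
      \<bullet> (N Z \<triangleleft> (winv (T.wM (N Z) (TA g) (I (TO Y) \<odot> f)) \<bullet> i_at ?t f)) \<bullet> lam_at Z (?t \<odot> f)"
  proof -
    have "(N Z \<triangleleft> n_at g (TA f \<odot> I X)) \<bullet> (N Z \<triangleleft> N (TO Z) \<triangleleft> TA (TA g) \<triangleleft> wi f)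
      = N Z \<triangleleft> (n_at g (TA f \<odot> I X) \<bullet> (N (TO Z) \<triangleleft> TA (TA g) \<triangleleft> wi f))"
      by simp
    also have "\<dots> = (N Z \<triangleleft> TA g \<triangleleft> N Y \<triangleleft> wi f) \<bullet> (N Z \<triangleleft> n_at g (I (TO Y) \<odot> f))"
      using n_at_natural[of "wi f" "I (TO Y) \<odot> f" "TA f \<odot> I X" g] by simp
    finally show ?thesis
      using assoc_at_natural[of "TA (TA g) \<triangleleft> wi f" _ _ Z, THEN vc_tail] by (simp flip: vc_assoc)
  qed
  \<comment> \<open>The comparison cell in \<open>i_at_comp\<close> cancels the one contributed by
    \<mu>.\<close>
  also have "winv (T.wM (N Z) (TA g) (I (TO Y) \<odot> f)) \<bullet> i_at ?t f
      = (TA (N Z) \<triangleleft> i_at (TA g) f) \<bullet> i_at (N Z) (TA g \<odot> f) \<bullet> (I (TO Z) \<triangleleft> as (N Z) (TA g) f)"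
    by (simp add: i_at_comp)
  also have "(N Z \<triangleleft> TA g \<triangleleft> N Y \<triangleleft> wi f) \<bullet> (N Z \<triangleleft> n_at g (I (TO Y) \<odot> f)) \<bullet> assoc_at Z (TA (TA g) \<odot> I (TO Y) \<odot> f)
      \<bullet> (N Z \<triangleleft> ((TA (N Z) \<triangleleft> i_at (TA g) f) \<bullet> i_at (N Z) (TA g \<odot> f) \<bullet> (I (TO Z) \<triangleleft> as (N Z) (TA g) f)))
      \<bullet> lam_at Z (?t \<odot> f)
    = (N Z \<triangleleft> TA g \<triangleleft> N Y \<triangleleft> wi f) \<bullet> ((N Z \<triangleleft> n_at g (I (TO Y) \<odot> f)) \<bullet> assoc_at Z (TA (TA g) \<odot> I (TO Y) \<odot> f)
      \<bullet> (N Z \<triangleleft> TA (N Z) \<triangleleft> i_at (TA g) f) \<bullet> (N Z \<triangleleft> i_at (N Z) (TA g \<odot> f)) \<bullet> lam_at Z (N Z \<odot> TA g \<odot> f))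
      \<bullet> as (N Z) (TA g) f"
    using lam_at_natural[of "as (N Z) (TA g) f" "?t \<odot> f" "N Z \<odot> TA g \<odot> f" Z] by (simp add: comp3_def)
  also have "\<dots> = (N Z \<triangleleft> TA g \<triangleleft> N Y \<triangleleft> wi f) \<bullet> (N Z \<triangleleft> TA g \<triangleleft> lam_at Y f) \<bullet> as (N Z) (TA g) f"
    by (subst lam_assoc_n_at) simp_all
  also have "\<dots> = ?P \<bullet> ?rhs"
    using as_natural[of "weta Y f" f _ "N Z" "TA g"] by (simp add: weta_def comp3_def)
  finally show ?thesis
    by (rule vc_left_cancel) (simp_all add: comp3_def)
qed

lemma rho_eta:
  assumes [simp]: "X \<in> Obj C"
  shows "lu (I X) \<bullet> (wrho X \<triangleright> I X) \<bullet> weta X (I X) = wid (I X)"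
  using lam_rho_id[OF assms] by (simp add: weta_def rho_at_def nt20_def)

end

section \<open>Adjunctions and left extensions\<close>

context bicategory
begin

text \<open>Passes from a naturality square along isomorphisms to the one along their inverses;
  \<open>lax_alg\<close>, which is built from inverses, obtains its naturality in this way.\<close>

lemma winv_swap:
  assumes "\<phi>' \<bullet> a = b \<bullet> \<phi>" "wiso \<phi>'" "wiso \<phi>" "wcod a = wdom \<phi>'" "wdom b = wcod \<phi>" "wnormal a" "wnormal b"
  shows "winv \<phi>' \<bullet> b = a \<bullet> winv \<phi>"
proof -
  have "winv \<phi>' \<bullet> (\<phi>' \<bullet> a) \<bullet> winv \<phi> = winv \<phi>' \<bullet> (b \<bullet> \<phi>) \<bullet> winv \<phi>"
    by (simp only: assms(1))
  then show ?thesis using assms(2-) by simp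
qed

section \<open>Left extensions in terms of labelled cells\<close>

lemma left_extensionI:
  assumes j: "j \<in> hom1 C X X'" and "f \<in> hom1 C X Y" "f' \<in> hom1 C X' Y"
    and e: "valid e" "wdom e = f" "wcod e = f' \<odot> j"
    and s: "\<And>g \<psi>. \<lbrakk>g \<in> hom1 C X' Y; valid \<psi>; wdom \<psi> = f; wcod \<psi> = g \<odot> j\<rbrakk>
      \<Longrightarrow> \<exists>\<phi>. valid \<phi> \<and> wdom \<phi> = f' \<and> wcod \<phi> = g \<and> (\<phi> \<triangleright> j) \<bullet> e = \<psi>"
    and u: "\<And>g \<phi> \<phi>'. \<lbrakk>g \<in> hom1 C X' Y; valid \<phi>; wdom \<phi> = f'; wcod \<phi> = g; valid \<phi>'; wdom \<phi>' = f'; wcod \<phi>' = g;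
      (\<phi> \<triangleright> j) \<bullet> e = (\<phi>' \<triangleright> j) \<bullet> e\<rbrakk> \<Longrightarrow> \<phi> = \<phi>'"
  shows "left_extension C X X' Y j f f' (wval e)"
  unfolding left_extension_def bij_betw_def
proof (intro conjI ballI)
  show "wval e \<in> hom2 C f (f' \<odot> j)" using e validD(1) by metis
  fix g assume g: "g \<in> hom1 C X' Y"
  let ?F = "\<lambda>\<phi>. (\<phi> \<rhd> j) \<cdot> wval e"
  have w: "valid ((wr f' g \<phi> \<triangleright> j) \<bullet> e)" "wval ((wr f' g \<phi> \<triangleright> j) \<bullet> e) = ?F \<phi>"
    if "\<phi> \<in> hom2 C f' g" for \<phi>
    using that e j assms(3) by (simp_all add: hom1_iff)
  show "inj_on ?F (hom2 C f' g)"
  proof (rule inj_onI)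
    fix \<phi> \<phi>' assume h: "\<phi> \<in> hom2 C f' g" "\<phi>' \<in> hom2 C f' g" "?F \<phi> = ?F \<phi>'"
    have *: "(wr f' g \<phi> \<triangleright> j) \<bullet> e = (wr f' g \<phi>' \<triangleright> j) \<bullet> e"
      by (rule wcell_eqI) (use h w in auto)
    have "wr f' g \<phi> = wr f' g \<phi>'"
      by (rule u[of g]) (use h g * in auto)
    then show "\<phi> = \<phi>'"
      using h wval_wr by metis
  qed
  show "?F ` hom2 C f' g = hom2 C f (g \<odot> j)"
  proof (intro equalityI subsetI)
    fix \<psi> assume "\<psi> \<in> ?F ` hom2 C f' g"
    then obtain \<phi> where p: "\<phi> \<in> hom2 C f' g" "\<psi> = ?F \<phi>" by auto
    then show "\<psi> \<in> hom2 C f (g \<odot> j)"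
      using validD(1)[OF w(1)[OF p(1)]] w(2)[OF p(1)] e by simp
  next
    fix \<psi> assume h: "\<psi> \<in> hom2 C f (g \<odot> j)"
    then obtain \<phi> where p: "valid \<phi>" "wdom \<phi> = f'" "wcod \<phi> = g" "(\<phi> \<triangleright> j) \<bullet> e = wr f (g \<odot> j) \<psi>"
      using s[of g "wr f (g \<odot> j) \<psi>"] g by auto
    have "wval \<phi> \<in> hom2 C f' g" "wr f' g (wval \<phi>) = \<phi>"
      using p validD(1)[of \<phi>] by (auto intro!: wcell_eqI)
    then show "\<psi> \<in> ?F ` hom2 C f' g"
      using w(2)[of "wval \<phi>"] p h by (intro image_eqI[of _ _ "wval \<phi>"]) simp_all
  qed
qed (use assms in auto)

text \<open>The two halves are separated because the converse uses existence for the adjunction unit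
  and uniqueness for the triangle identity on \<open>N X\<close>.\<close>

lemma left_extensionD:
  assumes L: "left_extension C X X' Y j f f' (wval e)"
    and e: "valid e" "wdom e = f" "wcod e = f' \<odot> j" and g: "g \<in> hom1 C X' Y"
  shows left_extension_exists: "\<lbrakk>valid \<psi>; wdom \<psi> = f; wcod \<psi> = g \<odot> j\<rbrakk>
      \<Longrightarrow> \<exists>\<phi>. valid \<phi> \<and> wdom \<phi> = f' \<and> wcod \<phi> = g \<and> (\<phi> \<triangleright> j) \<bullet> e = \<psi>"
    and left_extension_unique: "\<lbrakk>valid \<phi>; wdom \<phi> = f'; wcod \<phi> = g; valid \<phi>'; wdom \<phi>' = f'; wcod \<phi>' = g;
      (\<phi> \<triangleright> j) \<bullet> e = (\<phi>' \<triangleright> j) \<bullet> e\<rbrakk> \<Longrightarrow> \<phi> = \<phi>'"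
proof -
  let ?F = "\<lambda>\<phi>. (\<phi> \<rhd> j) \<cdot> wval e"
  have j: "j \<in> hom1 C X X'" "f' \<in> hom1 C X' Y" and b: "bij_betw ?F (hom2 C f' g) (hom2 C f (g \<odot> j))"
    using L g by (auto simp: left_extension_def)
  show "\<exists>\<phi>. valid \<phi> \<and> wdom \<phi> = f' \<and> wcod \<phi> = g \<and> (\<phi> \<triangleright> j) \<bullet> e = \<psi>"
    if h: "valid \<psi>" "wdom \<psi> = f" "wcod \<psi> = g \<odot> j"
  proof -
    have "wval \<psi> \<in> ?F ` hom2 C f' g"
      using validD(1)[OF h(1)] h b by (simp add: bij_betw_def)
    then obtain \<phi> where p: "\<phi> \<in> hom2 C f' g" "wval \<psi> = ?F \<phi>" by auto
    then show ?thesis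
      using j e h by (intro exI[of _ "wr f' g \<phi>"]) (auto intro!: wcell_eqI simp: hom1_iff)
  qed
  show "\<phi> = \<phi>'" if h: "valid \<phi>" "wdom \<phi> = f'" "wcod \<phi> = g" "valid \<phi>'" "wdom \<phi>' = f'" "wcod \<phi>' = g"
      "(\<phi> \<triangleright> j) \<bullet> e = (\<phi>' \<triangleright> j) \<bullet> e"
  proof -
    have "?F (wval \<phi>) = ?F (wval \<phi>')"
      using arg_cong[OF h(7), of wval] h(1-6) e j by (simp add: hom1_iff)
    then have "wval \<phi> = wval \<phi>'"
      using b validD(1)[OF h(1)] validD(1)[OF h(4)] h by (auto simp: bij_betw_def dest: inj_onD)
    then show ?thesis
      using h by (intro wcell_eqI) auto
  qed
qed

end

context pseudomonad
begin

section \<open>Adjunction units evaluated at 1-cells\<close>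

text \<open>The triangle identities for the counit \<open>inv2 C (\<l> X)\<close> in component form,
  the one on \<open>I (TO X)\<close> being solved for the unit.\<close>

definition adj_unit where
  "adj_unit X w \<longleftrightarrow> valid w \<and> wdom w = id1 C (TO (TO X)) \<and> wcod w = I (TO X) \<odot> N X
    \<and> (\<forall>h. h \<in> Arr C \<longrightarrow> trg C h = TO (TO X) \<longrightarrow>
        winv (lam_at X (N X \<odot> h)) \<bullet> (N X \<triangleleft> nt02 (I (TO X)) (N X) w h) = wid (N X \<odot> h))
    \<and> (\<forall>k. k \<in> Arr C \<longrightarrow> trg C k = TO X \<longrightarrow>
        nt02 (I (TO X)) (N X) w (I (TO X) \<odot> k) = I (TO X) \<triangleleft> lam_at X k)"

lemma nt20_winv_wlam:
  "\<lbrakk>X \<in> Obj C; h \<in> Arr C; trg C h = TO X\<rbrakk> \<Longrightarrow> nt20 (N X) (I (TO X)) (winv (wlam X)) h = winv (lam_at X h)"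
  using wiso_nt02(2)[of "wlam X" "TO X" "N X" "I (TO X)" h] by (simp add: lam_at_def comp3_def)

lemma adj_unit_exists:
  assumes X [simp]: "X \<in> Obj C" and L: "lax_idempotent_pseudomonad C T n i \<l>"
  shows "\<exists>w. adj_unit X w"
proof -
  let ?N = "N X" and ?I = "I (TO X)"
  obtain u where u: "u \<in> hom2 C (id1 C (TO (TO X))) (?I \<odot> ?N)"
    and 1: "lunit C ?N \<cdot> (inv2 C (\<l> X) \<rhd> ?N) \<cdot> assoc_inv C ?N ?I ?N \<cdot> (?N \<lhd> u) \<cdot> inv2 C (runit C ?N) = id2 C ?N"
    and 2: "runit C ?I \<cdot> (?I \<lhd> inv2 C (\<l> X)) \<cdot> assoc C ?I ?N ?I \<cdot> (u \<rhd> ?I) \<cdot> inv2 C (lunit C ?I) = id2 C ?I"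
    using bspec[OF L[unfolded lax_idempotent_pseudomonad_def] X] by (auto simp: left_adjoint_with_counit_def)
  define w where "w = wr (id1 C (TO (TO X))) (?I \<odot> ?N) u"
  have w [simp]: "valid w" "wdom w = id1 C (TO (TO X))" "wcod w = ?I \<odot> ?N" "wval w = u"
    using u by (simp_all add: w_def)
  \<comment> \<open>Grouped as a component of the counit after a whiskered unit, which are the
    shapes that \<open>nt20_rw\<close> and \<open>nt02_lw_rw\<close> can whisker by
    \<open>h\<close>.\<close>
  have t1: "nt20 ?N ?I (winv (wlam X)) ?N \<bullet> ((?N \<triangleleft> w) \<bullet> winv (ru ?N)) = wid ?N"
    unfolding nt20_def vc_assoc
    by (rule wcell_eqI) (simp_all add: comp3_def wval_winv 1 del: wiso_rw(2))
  have t2: "(ru ?I \<bullet> (?I \<triangleleft> winv (wlam X))) \<bullet> nt02 ?I ?N w ?I = wid ?I"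
    unfolding nt02_def vc_assoc
    by (rule wcell_eqI) (simp_all add: comp3_def wval_winv 2 del: wiso_lw(2))
  have "winv (lam_at X (?N \<odot> h)) \<bullet> (?N \<triangleleft> nt02 ?I ?N w h) = wid (?N \<odot> h)"
    if [simp]: "h \<in> Arr C" and h: "trg C h = TO (TO X)" for h
  proof -
    note [simp] = h
    have "wid (?N \<odot> h) = (nt20 ?N ?I (winv (wlam X)) ?N \<bullet> ((?N \<triangleleft> w) \<bullet> winv (ru ?N))) \<triangleright> h"
      unfolding t1 by simp
    also have "\<dots> = (nt20 ?N ?I (winv (wlam X)) ?N \<triangleright> h) \<bullet> (((?N \<triangleleft> w) \<bullet> winv (ru ?N)) \<triangleright> h)"
      by simp
    also have "nt20 ?N ?I (winv (wlam X)) ?N \<triangleright> h = nt20 ?N ?I (winv (wlam X)) (?N \<odot> h) \<bullet> as2 ?N ?I ?N h"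
      by (rule nt20_rw[where X = "TO X"]) (simp_all add: comp3_def)
    also have "\<dots> \<bullet> (((?N \<triangleleft> w) \<bullet> winv (ru ?N)) \<triangleright> h) = winv (lam_at X (?N \<odot> h)) \<bullet> (?N \<triangleleft> nt02 ?I ?N w h)"
      using nt02_lw_rw[of w "TO (TO X)" ?I ?N h ?N] by (simp add: nt20_winv_wlam comp3_def)
    finally show ?thesis ..
  qed
  moreover have "nt02 ?I ?N w (?I \<odot> k) = ?I \<triangleleft> lam_at X k"
    if [simp]: "k \<in> Arr C" and k: "trg C k = TO X" for k
  proof -
    note [simp] = k
    have "wid (?I \<odot> k) = ((ru ?I \<bullet> (?I \<triangleleft> winv (wlam X))) \<triangleright> k) \<bullet> (nt02 ?I ?N w ?I \<triangleright> k)"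
      using arg_cong[OF t2, of "\<lambda>x. x \<triangleright> k"] by simp
    also have "(ru ?I \<bullet> (?I \<triangleleft> winv (wlam X))) \<triangleright> k = (?I \<triangleleft> nt20 ?N ?I (winv (wlam X)) k) \<bullet> as2 ?I ?N ?I k"
      by (rule nt20_lw_rw[where X = "TO X"]) (simp_all add: comp3_def)
    also have "\<dots> \<bullet> (nt02 ?I ?N w ?I \<triangleright> k) = (?I \<triangleleft> winv (lam_at X k)) \<bullet> nt02 ?I ?N w (?I \<odot> k)"
      using nt02_rw[of w "TO (TO X)" ?I ?N ?I k] by (simp add: nt20_winv_wlam comp3_def)
    finally have "(?I \<triangleleft> lam_at X k) \<bullet> wid (?I \<odot> k) = (?I \<triangleleft> lam_at X k) \<bullet> (?I \<triangleleft> winv (lam_at X k)) \<bullet> nt02 ?I ?N w (?I \<odot> k)"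
      by simp
    then show ?thesis by simp
  qed
  ultimately show ?thesis
    using w unfolding adj_unit_def by (intro exI[of _ w]) blast
qed

section \<open>Lax algebra structures on 1-cells between free algebras\<close>

text \<open>The lax algebra structure \<open>n \<odot> T g \<rightarrow> g \<odot> n\<close> on \<open>g\<close>, the mate of \<open>i \<odot> g \<rightarrow> T g \<odot> i\<close>
  under \<open>n \<stileturn> i\<close>.\<close>

definition lax_alg where
  "lax_alg w X Y g h = winv (lam_at Y (g \<odot> N X \<odot> h)) \<bullet> (N Y \<triangleleft> winv (i_at g (N X \<odot> h)))
    \<bullet> (N Y \<triangleleft> TA g \<triangleleft> nt02 (I (TO X)) (N X) w h)"

lemma adj_unitD:
  assumes "adj_unit X w"
  shows "valid w" "wdom w = id1 C (TO (TO X))" "wcod w = I (TO X) \<odot> N X"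
    and "\<lbrakk>h \<in> Arr C; trg C h = TO (TO X)\<rbrakk>
      \<Longrightarrow> winv (lam_at X (N X \<odot> h)) \<bullet> (N X \<triangleleft> nt02 (I (TO X)) (N X) w h) = wid (N X \<odot> h)"
    and "\<lbrakk>k \<in> Arr C; trg C k = TO X\<rbrakk> \<Longrightarrow> nt02 (I (TO X)) (N X) w (I (TO X) \<odot> k) = I (TO X) \<triangleleft> lam_at X k"
  using assms unfolding adj_unit_def by blast+

lemma valid_unit_at:
  assumes "adj_unit X w" "X \<in> Obj C" "h \<in> Arr C" "trg C h = TO (TO X)"
  shows "valid (nt02 (I (TO X)) (N X) w h)"
  using adj_unitD(1-3)[OF assms(1)] assms(2-) by (intro valid_nt02[where X = "TO (TO X)"]) (auto simp: comp3_def)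

lemma lax_alg_simps [simp]:
  "wdom (lax_alg w X Y g h) = N Y \<odot> TA g \<odot> h" "wcod (lax_alg w X Y g h) = g \<odot> N X \<odot> h"
  "wnormal (lax_alg w X Y g h)"
  by (simp_all add: lax_alg_def)

lemma winv_i_at_natural:
  assumes "valid \<chi>" "wdom \<chi> = h" "wcod \<chi> = h'" "g \<in> Arr C" "trg C h = src C g" "src C g = X" "trg C g = Y"
  shows "winv (i_at g h') \<bullet> (TA g \<triangleleft> I X \<triangleleft> \<chi>) = (I Y \<triangleleft> g \<triangleleft> \<chi>) \<bullet> winv (i_at g h)"
  using assms validD(3-6)[of \<chi>] i_at_natural[of \<chi> h h' g] by (intro winv_swap) simp_all

lemma winv_lam_at_natural:
  assumes "valid \<chi>" "wdom \<chi> = h" "wcod \<chi> = h'" "trg C h = TO X" "X \<in> Obj C"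
  shows "winv (lam_at X h') \<bullet> (N X \<triangleleft> I (TO X) \<triangleleft> \<chi>) = \<chi> \<bullet> winv (lam_at X h)"
  using assms validD(3-6)[of \<chi>] lam_at_natural[of \<chi> h h' X] by (intro winv_swap) simp_all

lemma lax_alg_natural:
  assumes w: "adj_unit X w" and [simp]: "X \<in> Obj C" "Y \<in> Obj C" "g \<in> Arr C"
    and t: "src C g = TO X" "trg C g = TO Y" and v: "valid \<chi>" "wdom \<chi> = h" "wcod \<chi> = h'" "trg C h = TO (TO X)"
  shows "lax_alg w X Y g h' \<bullet> (N Y \<triangleleft> TA g \<triangleleft> \<chi>) = (g \<triangleleft> N X \<triangleleft> \<chi>) \<bullet> lax_alg w X Y g h"
proof -
  note [simp] = t v adj_unitD(1-3)[OF w] validD(3-6)[of \<chi>, unfolded v]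
  let ?U = "nt02 (I (TO X)) (N X) w"
  have 1: "?U h' \<bullet> \<chi> = (I (TO X) \<triangleleft> N X \<triangleleft> \<chi>) \<bullet> ?U h"
    by (rule nt02_natural[where X = "TO (TO X)"]) simp_all
  have 2: "winv (i_at g (N X \<odot> h')) \<bullet> (TA g \<triangleleft> I (TO X) \<triangleleft> N X \<triangleleft> \<chi>)
    = (I (TO Y) \<triangleleft> g \<triangleleft> N X \<triangleleft> \<chi>) \<bullet> winv (i_at g (N X \<odot> h))"
    by (rule winv_i_at_natural) simp_all
  have 3: "winv (lam_at Y (g \<odot> N X \<odot> h')) \<bullet> (N Y \<triangleleft> I (TO Y) \<triangleleft> g \<triangleleft> N X \<triangleleft> \<chi>)
    = (g \<triangleleft> N X \<triangleleft> \<chi>) \<bullet> winv (lam_at Y (g \<odot> N X \<odot> h))"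
    by (rule winv_lam_at_natural) simp_all
  have "lax_alg w X Y g h' \<bullet> (N Y \<triangleleft> TA g \<triangleleft> \<chi>) = winv (lam_at Y (g \<odot> N X \<odot> h'))
      \<bullet> (N Y \<triangleleft> (winv (i_at g (N X \<odot> h')) \<bullet> (TA g \<triangleleft> (?U h' \<bullet> \<chi>))))"
    by (simp add: lax_alg_def)
  also have "\<dots> = winv (lam_at Y (g \<odot> N X \<odot> h'))
      \<bullet> (N Y \<triangleleft> ((winv (i_at g (N X \<odot> h')) \<bullet> (TA g \<triangleleft> I (TO X) \<triangleleft> N X \<triangleleft> \<chi>)) \<bullet> (TA g \<triangleleft> ?U h)))"
    unfolding 1 by simp
  also have "\<dots> = (winv (lam_at Y (g \<odot> N X \<odot> h')) \<bullet> (N Y \<triangleleft> I (TO Y) \<triangleleft> g \<triangleleft> N X \<triangleleft> \<chi>))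
      \<bullet> (N Y \<triangleleft> winv (i_at g (N X \<odot> h))) \<bullet> (N Y \<triangleleft> TA g \<triangleleft> ?U h)"
    unfolding 2 by simp
  also have "\<dots> = (g \<triangleleft> N X \<triangleleft> \<chi>) \<bullet> lax_alg w X Y g h"
    unfolding 3 by (simp add: lax_alg_def)
  finally show ?thesis .
qed

text \<open>The unit law of the structure. It rests on the triangle identity on
  \<open>I (TO X)\<close>, which replaces \<open>w\<close> by \<lambda>; naturality then cancels the
  remaining inverses.\<close>

lemma lax_alg_I:
  assumes w: "adj_unit X w" and [simp]: "X \<in> Obj C" "Y \<in> Obj C" "g \<in> Arr C" "k \<in> Arr C"
    and t: "src C g = TO X" "trg C g = TO Y" "trg C k = TO X"
  shows "lax_alg w X Y g (I (TO X) \<odot> k) \<bullet> (N Y \<triangleleft> i_at g k) \<bullet> lam_at Y (g \<odot> k) = g \<triangleleft> lam_at X k"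
proof -
  note [simp] = t
  let ?y = "N X \<odot> I (TO X) \<odot> k"
  have "lax_alg w X Y g (I (TO X) \<odot> k) \<bullet> (N Y \<triangleleft> i_at g k) \<bullet> lam_at Y (g \<odot> k)
    = winv (lam_at Y (g \<odot> ?y)) \<bullet> (N Y \<triangleleft> ((winv (i_at g ?y) \<bullet> (TA g \<triangleleft> I (TO X) \<triangleleft> lam_at X k)) \<bullet> i_at g k))
      \<bullet> lam_at Y (g \<odot> k)"
    by (simp add: lax_alg_def adj_unitD(5)[OF w])
  also have "winv (i_at g ?y) \<bullet> (TA g \<triangleleft> I (TO X) \<triangleleft> lam_at X k)
      = (I (TO Y) \<triangleleft> g \<triangleleft> lam_at X k) \<bullet> winv (i_at g k)"
    by (rule winv_i_at_natural) simp_all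
  also have "winv (lam_at Y (g \<odot> ?y)) \<bullet> (N Y \<triangleleft> (((I (TO Y) \<triangleleft> g \<triangleleft> lam_at X k) \<bullet> winv (i_at g k)) \<bullet> i_at g k))
      \<bullet> lam_at Y (g \<odot> k)
    = winv (lam_at Y (g \<odot> ?y)) \<bullet> ((N Y \<triangleleft> I (TO Y) \<triangleleft> g \<triangleleft> lam_at X k) \<bullet> lam_at Y (g \<odot> k))"
    by simp
  also have "(N Y \<triangleleft> I (TO Y) \<triangleleft> g \<triangleleft> lam_at X k) \<bullet> lam_at Y (g \<odot> k) = lam_at Y (g \<odot> ?y) \<bullet> (g \<triangleleft> lam_at X k)"
    by (rule lam_at_natural[symmetric]) simp_all
  finally show ?thesis by simp
qed

text \<open>Inverting the pasting of \<open>lam_assoc_n_at\<close> writes the mate in terms of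
  \<open>?K\<close>. Naturality of \<open>?K\<close> brings \<open>w\<close> next to
  \<open>lam_at\<close>, where the triangle identity on \<open>N X\<close> removes both. Thus on
  \<open>N Y \<odot> TA f\<close> the structure is invertible even if \<open>w\<close> is
  not.\<close>

lemma lax_alg_comp:
  assumes w: "adj_unit X w" and [simp]: "X \<in> Obj C" "Y \<in> Obj C" "f \<in> Arr C" "h \<in> Arr C"
    and t: "src C f = X" "trg C f = TO Y" "trg C h = TO (TO X)"
  shows "as (N Y) (TA f) (N X \<odot> h) \<bullet> lax_alg w X Y (N Y \<odot> TA f) h \<bullet> (N Y \<triangleleft> T.wM (N Y) (TA f) h)
    = (N Y \<triangleleft> n_at f h) \<bullet> assoc_at Y (TA (TA f) \<odot> h)"
proof -
  note [simp] = t adj_unitD(1-3)[OF w] valid_unit_at[OF w]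
  let ?U = "nt02 (I (TO X)) (N X) w h" and ?x = "N X \<odot> h" and ?t = "N Y \<odot> TA f"
  let ?K = "\<lambda>h. (N Y \<triangleleft> n_at f h) \<bullet> assoc_at Y (TA (TA f) \<odot> h)"
  \<comment> \<open>The unit pasting at \<open>N Y \<odot> TA f\<close>, resolved into its factors;
    by \<open>KZ\<close> its inverse is \<open>?K\<close> up to \<lambda>.\<close>
  define Z where "Z = (N Y \<triangleleft> TA (N Y) \<triangleleft> i_at (TA f) ?x) \<bullet> (N Y \<triangleleft> i_at (N Y) (TA f \<odot> ?x)) \<bullet> lam_at Y (N Y \<odot> TA f \<odot> ?x)"
  have Z [simp]: "wiso Z" "wdom Z = N Y \<odot> TA f \<odot> ?x" "wcod Z = N Y \<odot> TA (N Y) \<odot> TA (TA f) \<odot> I (TO X) \<odot> ?x" "wnormal Z"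
    by (simp_all add: Z_def)
  have K: "?K (I (TO X) \<odot> ?x) \<bullet> (N Y \<triangleleft> TA (N Y) \<triangleleft> TA (TA f) \<triangleleft> ?U) = (N Y \<triangleleft> TA f \<triangleleft> N X \<triangleleft> ?U) \<bullet> ?K h"
  proof -
    have "?K (I (TO X) \<odot> ?x) \<bullet> (N Y \<triangleleft> TA (N Y) \<triangleleft> TA (TA f) \<triangleleft> ?U)
      = (N Y \<triangleleft> (n_at f (I (TO X) \<odot> ?x) \<bullet> (N (TO Y) \<triangleleft> TA (TA f) \<triangleleft> ?U))) \<bullet> assoc_at Y (TA (TA f) \<odot> h)"
      using assoc_at_natural[of "TA (TA f) \<triangleleft> ?U" _ _ Y] by simp
    also have "n_at f (I (TO X) \<odot> ?x) \<bullet> (N (TO Y) \<triangleleft> TA (TA f) \<triangleleft> ?U) = (TA f \<triangleleft> N X \<triangleleft> ?U) \<bullet> n_at f h"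
      using n_at_natural[of ?U h "I (TO X) \<odot> ?x" f] by simp
    finally show ?thesis by simp
  qed
  have KZ: "?K (I (TO X) \<odot> ?x) \<bullet> Z = N Y \<triangleleft> TA f \<triangleleft> lam_at X ?x"
    unfolding Z_def vc_assoc by (rule lam_assoc_n_at) simp_all
  have e: "(N Y \<triangleleft> i_at ?t ?x) \<bullet> lam_at Y (?t \<odot> ?x)
    = (N Y \<triangleleft> T.wM (N Y) (TA f) (I (TO X) \<odot> ?x)) \<bullet> Z \<bullet> as (N Y) (TA f) ?x"
    using lam_at_natural[of "as (N Y) (TA f) ?x" "?t \<odot> ?x" "N Y \<odot> TA f \<odot> ?x" Y] by (simp add: i_at_comp Z_def comp3_def)
  have M: "(TA ?t \<triangleleft> ?U) \<bullet> T.wM (N Y) (TA f) h = T.wM (N Y) (TA f) (I (TO X) \<odot> ?x) \<bullet> (TA (N Y) \<triangleleft> TA (TA f) \<triangleleft> ?U)"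
    by (rule T.wM_natural[symmetric]) simp_all
  have "as (N Y) (TA f) ?x \<bullet> lax_alg w X Y ?t h \<bullet> (N Y \<triangleleft> T.wM (N Y) (TA f) h)
    = as (N Y) (TA f) ?x \<bullet> winv ((N Y \<triangleleft> i_at ?t ?x) \<bullet> lam_at Y (?t \<odot> ?x))
      \<bullet> (N Y \<triangleleft> ((TA ?t \<triangleleft> ?U) \<bullet> T.wM (N Y) (TA f) h))"
    by (simp add: lax_alg_def)
  also have "\<dots> = winv Z \<bullet> (N Y \<triangleleft> TA (N Y) \<triangleleft> TA (TA f) \<triangleleft> ?U)"
    unfolding e M by (simp add: comp3_def)
  also have "winv Z = (N Y \<triangleleft> TA f \<triangleleft> winv (lam_at X ?x)) \<bullet> ?K (I (TO X) \<odot> ?x)"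
    by (rule vc_right_cancel[of _ Z]) (simp_all add: KZ[unfolded vc_assoc])
  also have "((N Y \<triangleleft> TA f \<triangleleft> winv (lam_at X ?x)) \<bullet> ?K (I (TO X) \<odot> ?x)) \<bullet> (N Y \<triangleleft> TA (N Y) \<triangleleft> TA (TA f) \<triangleleft> ?U)
    = (N Y \<triangleleft> TA f \<triangleleft> (winv (lam_at X ?x) \<bullet> (N X \<triangleleft> ?U))) \<bullet> ?K h"
    unfolding vc_assoc K[unfolded vc_assoc] by simp
  also have "\<dots> = ?K h"
    unfolding adj_unitD(4)[OF w assms(5) t(3)] by simp
  finally show ?thesis .
qed

end

context bicategory
begin

lemma as2_natural:
  assumes "wdom \<chi> = h" "wcod \<chi> = h'"
  shows "as2 a b h' k \<bullet> ((a \<triangleleft> b \<triangleleft> \<chi>) \<triangleright> k) = (a \<triangleleft> b \<triangleleft> (\<chi> \<triangleright> k)) \<bullet> as2 a b h k"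
proof -
  have "as2 a b h' k \<bullet> ((a \<triangleleft> b \<triangleleft> \<chi>) \<triangleright> k)
    = (a \<triangleleft> (as b h' k \<bullet> ((b \<triangleleft> \<chi>) \<triangleright> k))) \<bullet> as a (b \<odot> h) k"
    using assms as_natural_mid[of "b \<triangleleft> \<chi>" "b \<odot> h" "b \<odot> h'" a k] by (simp add: as2_def)
  also have "\<dots> = (a \<triangleleft> b \<triangleleft> (\<chi> \<triangleright> k)) \<bullet> as2 a b h k"
    using assms as_natural_mid[of \<chi> h h' b k] by (simp add: as2_def)
  finally show ?thesis .
qed

end

context pseudomonad
begin

text \<open>Not an instance of \<open>nt_rw\<close>, since \<open>lax_alg\<close> is assembled from
  components instead of coming from one raw 2-cell.\<close>

lemma lax_alg_rw:
  assumes w: "adj_unit X w" and [simp]: "X \<in> Obj C" "Y \<in> Obj C" "g \<in> Arr C" "h \<in> Arr C" "k \<in> Arr C"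
    and t: "src C g = TO X" "trg C g = TO Y" "trg C h = TO (TO X)" "src C h = trg C k"
  shows "as2 g (N X) h k \<bullet> (lax_alg w X Y g h \<triangleright> k) = lax_alg w X Y g (h \<odot> k) \<bullet> as2 (N Y) (TA g) h k"
proof -
  note [simp] = t adj_unitD(1-3)[OF w] valid_unit_at[OF w]
  let ?U = "nt02 (I (TO X)) (N X) w" and ?y = "N X \<odot> h"
  \<comment> \<open>The part that \<open>lax_alg\<close> inverts. It does not contain
    \<open>w\<close>, so the rules for \<open>i_at\<close> and \<open>lam_at\<close> settle its
    whiskering, and \<open>winv_swap\<close> passes to the inverse.\<close>
  define B where "B = (\<lambda>h. (N Y \<triangleleft> i_at g (N X \<odot> h)) \<bullet> lam_at Y (g \<odot> N X \<odot> h))"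
  define d where "d = (N Y \<triangleleft> TA g \<triangleleft> as2 (I (TO X)) (N X) h k) \<bullet> as2 (N Y) (TA g) (I (TO X) \<odot> N X \<odot> h) k"
  have B [simp]: "wdom (B h) = g \<odot> N X \<odot> h" "wcod (B h) = N Y \<odot> TA g \<odot> I (TO X) \<odot> N X \<odot> h" "wnormal (B h)"
    "\<lbrakk>h \<in> Arr C; trg C h = TO (TO X)\<rbrakk> \<Longrightarrow> wiso (B h)" for h
    by (simp_all add: B_def)
  have l: "lax_alg w X Y g h = winv (B h) \<bullet> (N Y \<triangleleft> TA g \<triangleleft> ?U h)" if "h \<in> Arr C" "trg C h = TO (TO X)" for h
    using that by (simp add: lax_alg_def B_def)
  have 1: "B (h \<odot> k) \<bullet> as2 g (N X) h k = d \<bullet> (B h \<triangleright> k)"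
  proof -
    have a: "as2 (TA g) (I (TO X)) ?y k \<bullet> (i_at g ?y \<triangleright> k) = i_at g (?y \<odot> k) \<bullet> as2 (I (TO Y)) g ?y k"
      using nt_rw[of "wi g" "I (TO Y)" g "TA g" "I (TO X)" ?y k] by (simp add: i_at_def comp3_def)
    have b: "as2 (N Y) (I (TO Y)) (g \<odot> ?y) k \<bullet> (lam_at Y (g \<odot> ?y) \<triangleright> k) = lam_at Y ((g \<odot> ?y) \<odot> k)"
      unfolding lam_at_def by (rule nt02_rw[where X = "TO Y"]) (simp_all add: comp3_def)
    have c: "i_at g (N X \<odot> h \<odot> k) \<bullet> (I (TO Y) \<triangleleft> g \<triangleleft> as (N X) h k)
      = (TA g \<triangleleft> I (TO X) \<triangleleft> as (N X) h k) \<bullet> i_at g (?y \<odot> k)"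
      using i_at_natural[of "as (N X) h k" "?y \<odot> k" "N X \<odot> h \<odot> k" g] by simp
    have "d \<bullet> (B h \<triangleright> k) = (N Y \<triangleleft> TA g \<triangleleft> I (TO X) \<triangleleft> as (N X) h k)
        \<bullet> (N Y \<triangleleft> as2 (TA g) (I (TO X)) ?y k) \<bullet> as (N Y) (TA g \<odot> I (TO X) \<odot> ?y) k
        \<bullet> ((N Y \<triangleleft> i_at g ?y) \<triangleright> k) \<bullet> (lam_at Y (g \<odot> ?y) \<triangleright> k)"
      by (simp add: d_def B_def as2_def)
    also have "\<dots> = (N Y \<triangleleft> TA g \<triangleleft> I (TO X) \<triangleleft> as (N X) h k)
        \<bullet> (N Y \<triangleleft> (as2 (TA g) (I (TO X)) ?y k \<bullet> (i_at g ?y \<triangleright> k))) \<bullet> as (N Y) (I (TO Y) \<odot> g \<odot> ?y) k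
        \<bullet> (lam_at Y (g \<odot> ?y) \<triangleright> k)"
      using as_natural_mid[of "i_at g ?y" _ _ "N Y" k, OF refl refl, THEN vc_tail] by simp
    also have "\<dots> = (N Y \<triangleleft> ((TA g \<triangleleft> I (TO X) \<triangleleft> as (N X) h k) \<bullet> i_at g (?y \<odot> k)))
        \<bullet> (N Y \<triangleleft> I (TO Y) \<triangleleft> as g ?y k) \<bullet> as2 (N Y) (I (TO Y)) (g \<odot> ?y) k \<bullet> (lam_at Y (g \<odot> ?y) \<triangleright> k)"
      unfolding a by (simp add: as2_def)
    also have "\<dots> = (N Y \<triangleleft> i_at g (N X \<odot> h \<odot> k)) \<bullet> (N Y \<triangleleft> I (TO Y) \<triangleleft> as2 g (N X) h k) \<bullet> lam_at Y ((g \<odot> ?y) \<odot> k)"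
      unfolding b c[symmetric] by (simp add: as2_def)
    also have "\<dots> = B (h \<odot> k) \<bullet> as2 g (N X) h k"
      using lam_at_natural[of "as2 g (N X) h k" "(g \<odot> ?y) \<odot> k" "g \<odot> N X \<odot> h \<odot> k" Y] by (simp add: B_def comp3_def)
    finally show ?thesis ..
  qed
  have 2: "d \<bullet> ((N Y \<triangleleft> TA g \<triangleleft> ?U h) \<triangleright> k) = (N Y \<triangleleft> TA g \<triangleleft> ?U (h \<odot> k)) \<bullet> as2 (N Y) (TA g) h k"
  proof -
    have "as2 (I (TO X)) (N X) h k \<bullet> (?U h \<triangleright> k) = ?U (h \<odot> k)"
      by (rule nt02_rw[where X = "TO (TO X)"]) (simp_all add: comp3_def)
    then have "(N Y \<triangleleft> TA g \<triangleleft> ?U (h \<odot> k)) = (N Y \<triangleleft> TA g \<triangleleft> as2 (I (TO X)) (N X) h k) \<bullet> (N Y \<triangleleft> TA g \<triangleleft> (?U h \<triangleright> k))"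
      by (simp flip: lw_vc)
    then show ?thesis
      using as2_natural[of "?U h" h "I (TO X) \<odot> N X \<odot> h" "N Y" "TA g" k] by (simp add: d_def)
  qed
  have "winv (B (h \<odot> k)) \<bullet> d = as2 g (N X) h k \<bullet> winv (B h \<triangleright> k)"
    by (rule winv_swap[OF 1]) (simp_all add: d_def)
  then have 3: "as2 g (N X) h k \<bullet> (winv (B h) \<triangleright> k) = winv (B (h \<odot> k)) \<bullet> d"
    by simp
  have "as2 g (N X) h k \<bullet> (lax_alg w X Y g h \<triangleright> k) = (as2 g (N X) h k \<bullet> (winv (B h) \<triangleright> k)) \<bullet> ((N Y \<triangleleft> TA g \<triangleleft> ?U h) \<triangleright> k)"
    by (simp add: l del: wiso_rw(2))
  also have "\<dots> = winv (B (h \<odot> k)) \<bullet> (N Y \<triangleleft> TA g \<triangleleft> ?U (h \<odot> k)) \<bullet> as2 (N Y) (TA g) h k"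
    unfolding 3 vc_assoc 2 ..
  finally show ?thesis
    by (simp add: l)
qed

lemma i_at_whisker:
  assumes "valid \<phi>" "wdom \<phi> = f" "wcod \<phi> = g" "h \<in> Arr C" "trg C h = src C f" "src C f = X" "trg C f = Y"
  shows "i_at g h \<bullet> (I Y \<triangleleft> (\<phi> \<triangleright> h)) = (T.wF \<phi> \<triangleright> (I X \<odot> h)) \<bullet> i_at f h"
proof -
  note v = validD(3-6)[OF assms(1), unfolded assms(2,3)]
  have o: "X \<in> Obj C" "Y \<in> Obj C" using src_obj[OF v(1)] trg_obj[OF v(1)] assms by simp_all
  have 1: "winv (as (I Y) g h) \<bullet> (I Y \<triangleleft> (\<phi> \<triangleright> h)) = ((I Y \<triangleleft> \<phi>) \<triangleright> h) \<bullet> winv (as (I Y) f h)"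
    by (rule winv_swap[OF as_natural_mid]) (use v o assms in \<open>simp_all add: comp3_def\<close>)
  have "i_at g h \<bullet> (I Y \<triangleleft> (\<phi> \<triangleright> h)) = as (TA g) (I X) h \<bullet> ((wi g \<bullet> (I Y \<triangleleft> \<phi>)) \<triangleright> h) \<bullet> winv (as (I Y) f h)"
    using v assms by (simp add: i_at_def nt_def 1)
  also have "wi g \<bullet> (I Y \<triangleleft> \<phi>) = (T.wF \<phi> \<triangleright> I X) \<bullet> wi f"
    using wi_natural[of \<phi> f g] assms by simp
  also have "as (TA g) (I X) h \<bullet> (((T.wF \<phi> \<triangleright> I X) \<bullet> wi f) \<triangleright> h) \<bullet> winv (as (I Y) f h)
      = (T.wF \<phi> \<triangleright> (I X \<odot> h)) \<bullet> i_at f h"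
    using v assms as_natural_left[of "T.wF \<phi>" "TA f" "TA g" "I X" h, THEN vc_tail] by (simp add: i_at_def nt_def)
  finally show ?thesis .
qed

text \<open>Mates are natural in \<open>g\<close>, so every 2-cell between 1-cells
  \<open>TO X \<rightarrow> TO Y\<close> respects the lax algebra structures.\<close>

lemma lax_alg_whisker:
  assumes w: "adj_unit X w" and [simp]: "X \<in> Obj C" "Y \<in> Obj C" "h \<in> Arr C" "trg C h = TO (TO X)"
    and v: "valid \<phi>" "wdom \<phi> = f" "wcod \<phi> = g" and t: "src C f = TO X" "trg C f = TO Y"
  shows "lax_alg w X Y g h \<bullet> (N Y \<triangleleft> (T.wF \<phi> \<triangleright> h)) = (\<phi> \<triangleright> (N X \<odot> h)) \<bullet> lax_alg w X Y f h"
proof -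
  note [simp] = t v validD(3-6)[OF v(1), unfolded v(2,3)] adj_unitD(1-3)[OF w] valid_unit_at[OF w]
  let ?U = "nt02 (I (TO X)) (N X) w" and ?y = "N X \<odot> h"
  have 1: "(TA g \<triangleleft> ?U h) \<bullet> (T.wF \<phi> \<triangleright> h) = (T.wF \<phi> \<triangleright> (I (TO X) \<odot> ?y)) \<bullet> (TA f \<triangleleft> ?U h)"
    by (rule whisker_interchange[symmetric]) simp_all
  have 2: "winv (i_at g ?y) \<bullet> (T.wF \<phi> \<triangleright> (I (TO X) \<odot> ?y)) = (I (TO Y) \<triangleleft> (\<phi> \<triangleright> ?y)) \<bullet> winv (i_at f ?y)"
    by (rule winv_swap[OF i_at_whisker]) simp_all
  have 3: "winv (lam_at Y (g \<odot> ?y)) \<bullet> (N Y \<triangleleft> I (TO Y) \<triangleleft> (\<phi> \<triangleright> ?y)) = (\<phi> \<triangleright> ?y) \<bullet> winv (lam_at Y (f \<odot> ?y))"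
    by (rule winv_lam_at_natural) simp_all
  have "lax_alg w X Y g h \<bullet> (N Y \<triangleleft> (T.wF \<phi> \<triangleright> h))
    = winv (lam_at Y (g \<odot> ?y)) \<bullet> (N Y \<triangleleft> (winv (i_at g ?y) \<bullet> ((TA g \<triangleleft> ?U h) \<bullet> (T.wF \<phi> \<triangleright> h))))"
    by (simp add: lax_alg_def)
  also have "\<dots> = winv (lam_at Y (g \<odot> ?y)) \<bullet> (N Y \<triangleleft> ((winv (i_at g ?y) \<bullet> (T.wF \<phi> \<triangleright> (I (TO X) \<odot> ?y))) \<bullet> (TA f \<triangleleft> ?U h)))"
    unfolding 1 by simp
  also have "\<dots> = (winv (lam_at Y (g \<odot> ?y)) \<bullet> (N Y \<triangleleft> I (TO Y) \<triangleleft> (\<phi> \<triangleright> ?y)))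
      \<bullet> (N Y \<triangleleft> winv (i_at f ?y)) \<bullet> (N Y \<triangleleft> TA f \<triangleleft> ?U h)"
    unfolding 2 by simp
  also have "\<dots> = (\<phi> \<triangleright> ?y) \<bullet> lax_alg w X Y f h"
    unfolding 3 by (simp add: lax_alg_def)
  finally show ?thesis .
qed

section \<open>Extension along the unit as the inverse of restriction\<close>

definition lax_ext where
  "lax_ext w X Y g \<psi> = (ru g \<bullet> (g \<triangleleft> wrho X)) \<bullet> lax_alg w X Y g (TA (I X))
    \<bullet> (N Y \<triangleleft> winv (T.wm g (I X))) \<bullet> (N Y \<triangleleft> T.wF \<psi>)"

lemma lax_ext_simps [simp]:
  "wdom (lax_ext w X Y g \<psi>) = N Y \<odot> TA (wdom \<psi>)" "wcod (lax_ext w X Y g \<psi>) = g" "wnormal (lax_ext w X Y g \<psi>)"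
  by (simp_all add: lax_ext_def)

lemma valid_lax_ext:
  assumes "adj_unit X w" "X \<in> Obj C" "Y \<in> Obj C" "g \<in> Arr C" "src C g = TO X" "trg C g = TO Y"
    "valid \<psi>" "wcod \<psi> = g \<odot> I X"
  shows "valid (lax_ext w X Y g \<psi>)"
proof -
  note v = validD(3-6)[OF assms(7)]
  have "trg C (wdom \<psi>) = TO Y" using v(4) assms by simp
  then show ?thesis
    using assms v adj_unitD(1-3)[OF assms(1)]
    by (simp add: lax_ext_def lax_alg_def valid_unit_at)
qed

text \<open>Restriction to \<open>I X\<close> lets naturality of \<open>i\<close> and of the
  structure bring the factors of \<open>lax_ext\<close> next to the unit; \<open>lax_alg_I\<close>
  then leaves \<open>g\<close> whiskered with the composite that \<open>lam_rho_id\<close> shows to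
  be an identity.\<close>

lemma lax_ext_eta:
  assumes w: "adj_unit X w" and [simp]: "X \<in> Obj C" "Y \<in> Obj C" "f \<in> Arr C" "g \<in> Arr C"
    and t: "src C f = X" "trg C f = TO Y" "src C g = TO X" "trg C g = TO Y"
    and v: "valid \<psi>" "wdom \<psi> = f" "wcod \<psi> = g \<odot> I X"
  shows "(lax_ext w X Y g \<psi> \<triangleright> I X) \<bullet> weta Y f = \<psi>"
proof -
  note [simp] = t v
  let ?i = "TA (I X)"
  have 1: "(ru g \<bullet> (g \<triangleleft> wrho X)) \<triangleright> I X = (g \<triangleleft> rho_at X (I X)) \<bullet> as2 g (N X) ?i (I X)"
    unfolding rho_at_def by (rule nt20_lw_rw) (simp_all add: comp3_def)
  have 2: "as2 g (N X) ?i (I X) \<bullet> (lax_alg w X Y g ?i \<triangleright> I X)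
    = lax_alg w X Y g (?i \<odot> I X) \<bullet> as2 (N Y) (TA g) ?i (I X)"
    by (rule lax_alg_rw[OF w]) simp_all
  have mid: "as (N Y) b' (I X) \<bullet> ((N Y \<triangleleft> \<chi>) \<triangleright> I X) = (N Y \<triangleleft> (\<chi> \<triangleright> I X)) \<bullet> as (N Y) b (I X)"
    if "wdom \<chi> = b" "wcod \<chi> = b'" for \<chi> b b'
    using that by (rule as_natural_mid)
  have 3: "as2 (N Y) (TA g) ?i (I X) \<bullet> ((N Y \<triangleleft> winv (T.wm g (I X))) \<triangleright> I X)
    = (N Y \<triangleleft> winv (T.wM g (I X) (I X))) \<bullet> as (N Y) (TA (g \<odot> I X)) (I X)"
    using mid[of "winv (T.wm g (I X))", OF refl refl] by (simp add: as2_def T.wM_def comp3_def)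
  have "(lax_ext w X Y g \<psi> \<triangleright> I X) \<bullet> weta Y f
    = ((ru g \<bullet> (g \<triangleleft> wrho X)) \<triangleright> I X) \<bullet> (lax_alg w X Y g ?i \<triangleright> I X)
      \<bullet> ((N Y \<triangleleft> winv (T.wm g (I X))) \<triangleright> I X) \<bullet> ((N Y \<triangleleft> T.wF \<psi>) \<triangleright> I X) \<bullet> weta Y f"
    by (simp add: lax_ext_def del: wiso_lw(2) wiso_rw(2))
  also have "\<dots> = (g \<triangleleft> rho_at X (I X)) \<bullet> lax_alg w X Y g (?i \<odot> I X)
      \<bullet> (N Y \<triangleleft> winv (T.wM g (I X) (I X))) \<bullet> as (N Y) (TA (g \<odot> I X)) (I X)
      \<bullet> ((N Y \<triangleleft> T.wF \<psi>) \<triangleright> I X) \<bullet> weta Y f"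
    unfolding 1 vc_assoc 2[THEN vc_tail] 3[THEN vc_tail] ..
  also have "\<dots> = (g \<triangleleft> rho_at X (I X)) \<bullet> lax_alg w X Y g (?i \<odot> I X)
      \<bullet> (N Y \<triangleleft> (winv (T.wM g (I X) (I X)) \<bullet> (T.wF \<psi> \<triangleright> I X) \<bullet> wi f)) \<bullet> lam_at Y f"
    using mid[of "T.wF \<psi>", OF refl refl, THEN vc_tail] by (simp add: weta_def comp3_def)
  \<comment> \<open>Here \<open>\<psi>\<close> comes out of \<open>T\<close>; naturality of
    \<lambda> later takes it to the right end.\<close>
  also have "(T.wF \<psi> \<triangleright> I X) \<bullet> wi f = wi (g \<odot> I X) \<bullet> (I (TO Y) \<triangleleft> \<psi>)"
    using wi_natural[of \<psi> f "g \<odot> I X"] by simp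
  also have "winv (T.wM g (I X) (I X)) \<bullet> wi (g \<odot> I X) \<bullet> (I (TO Y) \<triangleleft> \<psi>)
    = (TA g \<triangleleft> wi (I X)) \<bullet> i_at g (I X) \<bullet> (I (TO Y) \<triangleleft> \<psi>)"
    by (simp add: wi_comp)
  also have "(g \<triangleleft> rho_at X (I X)) \<bullet> lax_alg w X Y g (?i \<odot> I X)
      \<bullet> (N Y \<triangleleft> ((TA g \<triangleleft> wi (I X)) \<bullet> i_at g (I X) \<bullet> (I (TO Y) \<triangleleft> \<psi>))) \<bullet> lam_at Y f
    = (g \<triangleleft> rho_at X (I X)) \<bullet> (lax_alg w X Y g (?i \<odot> I X) \<bullet> (N Y \<triangleleft> TA g \<triangleleft> wi (I X)))
      \<bullet> (N Y \<triangleleft> i_at g (I X)) \<bullet> ((N Y \<triangleleft> I (TO Y) \<triangleleft> \<psi>) \<bullet> lam_at Y f)"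
    by simp
  also have "lax_alg w X Y g (?i \<odot> I X) \<bullet> (N Y \<triangleleft> TA g \<triangleleft> wi (I X))
    = (g \<triangleleft> N X \<triangleleft> wi (I X)) \<bullet> lax_alg w X Y g (I (TO X) \<odot> I X)"
    by (rule lax_alg_natural[OF w]) simp_all
  also have "(N Y \<triangleleft> I (TO Y) \<triangleleft> \<psi>) \<bullet> lam_at Y f = lam_at Y (g \<odot> I X) \<bullet> \<psi>"
    by (rule lam_at_natural[symmetric]) simp_all
  also have "(g \<triangleleft> rho_at X (I X)) \<bullet> ((g \<triangleleft> N X \<triangleleft> wi (I X)) \<bullet> lax_alg w X Y g (I (TO X) \<odot> I X))
      \<bullet> (N Y \<triangleleft> i_at g (I X)) \<bullet> lam_at Y (g \<odot> I X) \<bullet> \<psi>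
    = (g \<triangleleft> rho_at X (I X)) \<bullet> (g \<triangleleft> N X \<triangleleft> wi (I X)) \<bullet> (lax_alg w X Y g (I (TO X) \<odot> I X)
      \<bullet> (N Y \<triangleleft> i_at g (I X)) \<bullet> lam_at Y (g \<odot> I X)) \<bullet> \<psi>"
    by simp
  also have "lax_alg w X Y g (I (TO X) \<odot> I X) \<bullet> (N Y \<triangleleft> i_at g (I X)) \<bullet> lam_at Y (g \<odot> I X) = g \<triangleleft> lam_at X (I X)"
    by (rule lax_alg_I[OF w]) simp_all
  also have "(g \<triangleleft> rho_at X (I X)) \<bullet> (g \<triangleleft> N X \<triangleleft> wi (I X)) \<bullet> (g \<triangleleft> lam_at X (I X)) \<bullet> \<psi>
    = (g \<triangleleft> (rho_at X (I X) \<bullet> (N X \<triangleleft> wi (I X)) \<bullet> lam_at X (I X))) \<bullet> \<psi>"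
    by simp
  also have "\<dots> = \<psi>"
    unfolding lam_rho_id[OF assms(2)] by simp
  finally show ?thesis .
qed

text \<open>Prepares \<open>lax_ext_eta_id\<close>: \<open>T\<close> of the unit cell has to be
  split into \<open>Ti\<close> and \<open>Tlam_at\<close>, the cells that occur in the \<rho>
  modification axiom and in the unit axiom.\<close>

lemma wF_eta:
  assumes [simp]: "X \<in> Obj C" "Y \<in> Obj C" "f \<in> Arr C" and t: "src C f = X" "trg C f = TO Y"
  shows "winv (T.wm (N Y \<odot> TA f) (I X)) \<bullet> T.wF (weta Y f)
    = T.wM (N Y) (TA f) (TA (I X)) \<bullet> (TA (N Y) \<triangleleft> Ti f) \<bullet> Tlam_at Y (TA f)"
proof -
  note [simp] = t
  let ?a = "as (N Y) (TA f) (I X)"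
  have 1: "winv (T.wm (N Y \<odot> TA f) (I X)) \<bullet> winv (T.wF ?a)
    = T.wM (N Y) (TA f) (TA (I X)) \<bullet> winv (T.wmm (N Y) (TA f) (I X))"
  proof -
    have "T.wF ?a \<bullet> T.wm (N Y \<odot> TA f) (I X) = T.wmm (N Y) (TA f) (I X) \<bullet> winv (T.wM (N Y) (TA f) (TA (I X)))"
      using T.wF_as_wm[of "N Y" "TA f" "I X"] by (simp add: T.wM_def comp3_def)
    then have "winv (T.wF ?a \<bullet> T.wm (N Y \<odot> TA f) (I X))
      = winv (T.wmm (N Y) (TA f) (I X) \<bullet> winv (T.wM (N Y) (TA f) (TA (I X))))"
      by (simp only:)
    then show ?thesis by (simp add: comp3_def)
  qed
  have 2: "T.wF (lam_at Y f) = T.wmm (N Y) (I (TO Y)) f \<bullet> Tlam_at Y (TA f)"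
    unfolding lam_at_def Tlam_at_def Tlam_def by (rule T.wF_nt02) (simp_all add: comp3_def)
  have 3: "T.wF (N Y \<triangleleft> wi f) \<bullet> T.wm (N Y) (I (TO Y) \<odot> f) = T.wm (N Y) (TA f \<odot> I X) \<bullet> (TA (N Y) \<triangleleft> T.wF (wi f))"
    using T.wm_natural_right[of "wi f" "I (TO Y) \<odot> f" "TA f \<odot> I X" "N Y"] by simp
  have "winv (T.wm (N Y \<odot> TA f) (I X)) \<bullet> T.wF (weta Y f) = (winv (T.wm (N Y \<odot> TA f) (I X)) \<bullet> winv (T.wF ?a))
      \<bullet> (T.wF (N Y \<triangleleft> wi f) \<bullet> T.wm (N Y) (I (TO Y) \<odot> f)) \<bullet> (TA (N Y) \<triangleleft> T.wm (I (TO Y)) f) \<bullet> Tlam_at Y (TA f)"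
    by (simp add: weta_def 2 T.wmm_def comp3_def)
  also have "\<dots> = T.wM (N Y) (TA f) (TA (I X)) \<bullet> winv (T.wmm (N Y) (TA f) (I X))
      \<bullet> T.wm (N Y) (TA f \<odot> I X) \<bullet> (TA (N Y) \<triangleleft> (T.wF (wi f) \<bullet> T.wm (I (TO Y)) f)) \<bullet> Tlam_at Y (TA f)"
    unfolding 1 3 by simp
  also have "\<dots> = T.wM (N Y) (TA f) (TA (I X)) \<bullet> (TA (N Y) \<triangleleft> Ti f) \<bullet> Tlam_at Y (TA f)"
    by (simp add: T.wmm_def Ti_def)
  finally show ?thesis .
qed

text \<open>\<open>lax_alg_comp\<close> eliminates the mate, and with it \<open>w\<close>. Of the
  cells that remain, \<open>rho_modification_raw\<close> contracts \<open>n_at\<close>,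
  \<open>Ti\<close> and \<rho> to a single \<open>rho_at\<close>, as the unit axiom
  requires.\<close>

lemma lax_ext_eta_id:
  assumes w: "adj_unit X w" and [simp]: "X \<in> Obj C" "Y \<in> Obj C" "f \<in> Arr C" and t: "src C f = X" "trg C f = TO Y"
  shows "lax_ext w X Y (N Y \<odot> TA f) (weta Y f) = wid (N Y \<odot> TA f)"
proof -
  note [simp] = t
  let ?i = "TA (I X)" and ?t = "N Y \<odot> TA f"
  have 1: "ru ?t \<bullet> (?t \<triangleleft> wrho X) = (N Y \<triangleleft> (ru (TA f) \<bullet> (TA f \<triangleleft> wrho X))) \<bullet> as (N Y) (TA f) (N X \<odot> ?i)"
    using ru_comp[of "N Y" "TA f" "TO X"] as_natural[of "wrho X" "N X \<odot> ?i" "id1 C (TO X)" "N Y" "TA f"]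
    by simp
  have 2: "as (N Y) (TA f) (N X \<odot> ?i) \<bullet> lax_alg w X Y ?t ?i \<bullet> (N Y \<triangleleft> T.wM (N Y) (TA f) ?i)
    = (N Y \<triangleleft> n_at f ?i) \<bullet> assoc_at Y (TA (TA f) \<odot> ?i)"
    by (rule lax_alg_comp[OF w]) simp_all
  have 3: "assoc_at Y (TA (TA f) \<odot> ?i) \<bullet> (N Y \<triangleleft> TA (N Y) \<triangleleft> Ti f)
    = (N Y \<triangleleft> N (TO Y) \<triangleleft> Ti f) \<bullet> assoc_at Y (TA (I (TO Y)) \<odot> TA f)"
    by (rule assoc_at_natural) simp_all
  have "lax_ext w X Y ?t (weta Y f) = (ru ?t \<bullet> (?t \<triangleleft> wrho X)) \<bullet> lax_alg w X Y ?t ?i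
      \<bullet> (N Y \<triangleleft> (winv (T.wm ?t (I X)) \<bullet> T.wF (weta Y f)))"
    by (simp add: lax_ext_def)
  also have "\<dots> = (N Y \<triangleleft> (ru (TA f) \<bullet> (TA f \<triangleleft> wrho X)))
      \<bullet> (as (N Y) (TA f) (N X \<odot> ?i) \<bullet> lax_alg w X Y ?t ?i \<bullet> (N Y \<triangleleft> T.wM (N Y) (TA f) ?i))
      \<bullet> (N Y \<triangleleft> TA (N Y) \<triangleleft> Ti f) \<bullet> (N Y \<triangleleft> Tlam_at Y (TA f))"
    unfolding wF_eta[OF assms(2-)] 1 by simp
  also have "\<dots> = (N Y \<triangleleft> (ru (TA f) \<bullet> (TA f \<triangleleft> wrho X))) \<bullet> (N Y \<triangleleft> n_at f ?i)
      \<bullet> (assoc_at Y (TA (TA f) \<odot> ?i) \<bullet> (N Y \<triangleleft> TA (N Y) \<triangleleft> Ti f)) \<bullet> (N Y \<triangleleft> Tlam_at Y (TA f))"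
    unfolding 2 vc_assoc ..
  also have "\<dots> = (N Y \<triangleleft> ((ru (TA f) \<bullet> (TA f \<triangleleft> wrho X)) \<bullet> n_at f ?i \<bullet> (N (TO Y) \<triangleleft> Ti f)))
      \<bullet> assoc_at Y (TA (I (TO Y)) \<odot> TA f) \<bullet> (N Y \<triangleleft> Tlam_at Y (TA f))"
    unfolding 3 by simp
  also have "(ru (TA f) \<bullet> (TA f \<triangleleft> wrho X)) \<bullet> n_at f ?i \<bullet> (N (TO Y) \<triangleleft> Ti f) = rho_at (TO Y) (TA f)"
    using rho_modification_raw[of f] by simp
  also have "(N Y \<triangleleft> rho_at (TO Y) (TA f)) \<bullet> assoc_at Y (TA (I (TO Y)) \<odot> TA f) \<bullet> (N Y \<triangleleft> Tlam_at Y (TA f)) = wid ?t"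
    by (rule coherence_unit_at) simp_all
  finally show ?thesis .
qed

text \<open>Naturality of all factors of \<open>lax_ext\<close> pulls \<open>\<phi>\<close> out to
  the left, which reduces the claim to \<open>lax_ext_eta_id\<close>.\<close>

lemma lax_ext_restrict:
  assumes w: "adj_unit X w" and [simp]: "X \<in> Obj C" "Y \<in> Obj C" "f \<in> Arr C" and t: "src C f = X" "trg C f = TO Y"
    and v: "valid \<phi>" "wdom \<phi> = N Y \<odot> TA f" "wcod \<phi> = g"
  shows "lax_ext w X Y g ((\<phi> \<triangleright> I X) \<bullet> weta Y f) = \<phi>"
proof -
  note [simp] = t v
  let ?i = "TA (I X)" and ?t = "N Y \<odot> TA f"
  have g [simp]: "g \<in> Arr C" "src C g = TO X" "trg C g = TO Y"
    using validD(3-6)[OF v(1)] by simp_all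
  have 1: "winv (T.wm g (I X)) \<bullet> T.wF (\<phi> \<triangleright> I X) = (T.wF \<phi> \<triangleright> ?i) \<bullet> winv (T.wm ?t (I X))"
    by (rule winv_swap[OF T.wm_natural_left]) simp_all
  have 2: "lax_alg w X Y g ?i \<bullet> (N Y \<triangleleft> (T.wF \<phi> \<triangleright> ?i)) = (\<phi> \<triangleright> (N X \<odot> ?i)) \<bullet> lax_alg w X Y ?t ?i"
    by (rule lax_alg_whisker[OF w]) simp_all
  have 3: "(ru g \<bullet> (g \<triangleleft> wrho X)) \<bullet> (\<phi> \<triangleright> (N X \<odot> ?i)) = \<phi> \<bullet> ru ?t \<bullet> (?t \<triangleleft> wrho X)"
  proof -
    have "(g \<triangleleft> wrho X) \<bullet> (\<phi> \<triangleright> (N X \<odot> ?i)) = (\<phi> \<triangleright> id1 C (TO X)) \<bullet> (?t \<triangleleft> wrho X)"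
      by (rule whisker_interchange[symmetric]) simp_all
    then show ?thesis
      using ru_natural[of \<phi> ?t g, THEN vc_tail] by simp
  qed
  have "lax_ext w X Y g ((\<phi> \<triangleright> I X) \<bullet> weta Y f) = (ru g \<bullet> (g \<triangleleft> wrho X)) \<bullet> lax_alg w X Y g ?i
      \<bullet> (N Y \<triangleleft> ((winv (T.wm g (I X)) \<bullet> T.wF (\<phi> \<triangleright> I X)) \<bullet> T.wF (weta Y f)))"
    by (simp add: lax_ext_def)
  also have "\<dots> = (ru g \<bullet> (g \<triangleleft> wrho X)) \<bullet> (lax_alg w X Y g ?i \<bullet> (N Y \<triangleleft> (T.wF \<phi> \<triangleright> ?i)))
      \<bullet> (N Y \<triangleleft> winv (T.wm ?t (I X))) \<bullet> (N Y \<triangleleft> T.wF (weta Y f))"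
    unfolding 1 by simp
  also have "\<dots> = ((ru g \<bullet> (g \<triangleleft> wrho X)) \<bullet> (\<phi> \<triangleright> (N X \<odot> ?i))) \<bullet> lax_alg w X Y ?t ?i
      \<bullet> (N Y \<triangleleft> winv (T.wm ?t (I X))) \<bullet> (N Y \<triangleleft> T.wF (weta Y f))"
    unfolding 2 vc_assoc ..
  also have "\<dots> = \<phi> \<bullet> lax_ext w X Y ?t (weta Y f)"
    unfolding 3 by (simp add: lax_ext_def)
  also have "\<dots> = \<phi>"
    unfolding lax_ext_eta_id[OF assms(1-6)] by simp
  finally show ?thesis .
qed

lemma left_extension_eta:
  assumes X: "X \<in> Obj C" and Y: "Y \<in> Obj C" and f: "f \<in> hom1 C X (TO Y)" and w: "adj_unit X w"
  shows "left_extension C X (TO X) (TO Y) (I X) f (N Y \<odot> TA f) (associated_\<eta> C T n i \<l> X Y f)"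
proof -
  have [simp]: "f \<in> Arr C" "src C f = X" "trg C f = TO Y" using f by (auto simp: hom1_iff)
  note [simp] = X Y
  have "left_extension C X (TO X) (TO Y) (I X) f (N Y \<odot> TA f) (wval (weta Y f))"
  proof (rule left_extensionI)
    fix g \<psi> assume a: "g \<in> hom1 C (TO X) (TO Y)" "valid \<psi>" "wdom \<psi> = f" "wcod \<psi> = g \<odot> I X"
    then have [simp]: "g \<in> Arr C" "src C g = TO X" "trg C g = TO Y" by (auto simp: hom1_iff)
    show "\<exists>\<phi>. valid \<phi> \<and> wdom \<phi> = N Y \<odot> TA f \<and> wcod \<phi> = g \<and> (\<phi> \<triangleright> I X) \<bullet> weta Y f = \<psi>"
      using a by (intro exI[of _ "lax_ext w X Y g \<psi>"]) (simp add: valid_lax_ext[OF w] lax_ext_eta[OF w])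
  next
    fix g \<phi> \<phi>' assume a: "valid \<phi>" "wdom \<phi> = N Y \<odot> TA f" "wcod \<phi> = g"
      and b: "valid \<phi>'" "wdom \<phi>' = N Y \<odot> TA f" "wcod \<phi>' = g"
      and e: "(\<phi> \<triangleright> I X) \<bullet> weta Y f = (\<phi>' \<triangleright> I X) \<bullet> weta Y f"
    have "\<phi> = lax_ext w X Y g ((\<phi> \<triangleright> I X) \<bullet> weta Y f)"
      by (rule lax_ext_restrict[OF w _ _ _ _ _ a, symmetric]) simp_all
    also have "\<dots> = \<phi>'"
      unfolding e by (rule lax_ext_restrict[OF w _ _ _ _ _ b]) simp_all
    finally show "\<phi> = \<phi>'" .
  qed (simp_all add: hom1_iff)
  then show ?thesis
    by (simp add: wval_weta)
qed

section \<open>From the adjunctions to the relative conditions\<close>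

theorem lax_idempotent_relative_of_pseudomonad:
  assumes L: "lax_idempotent_pseudomonad C T n i \<l>"
  shows "lax_idempotent_relative C (associated_relative C T n i \<alpha> \<l> \<rho>)"
  unfolding lax_idempotent_relative_def associated_relative_def rel_psmonad.simps
proof (intro conjI ballI)
  fix X Y f assume "X \<in> Obj C" "Y \<in> Obj C" "f \<in> hom1 C X (TO Y)"
  then show "left_extension C X (TO X) (TO Y) (I X) f (N Y \<odot> TA f) (associated_\<eta> C T n i \<l> X Y f)"
    using adj_unit_exists[OF _ L] left_extension_eta by blast
next
  fix X Y Z f g assume "X \<in> Obj C" and o [simp]: "Y \<in> Obj C" "Z \<in> Obj C"
    and fg: "f \<in> hom1 C X (TO Y)" "g \<in> hom1 C Y (TO Z)"
  have [simp]: "f \<in> Arr C" "src C f = X" "trg C f = TO Y" "g \<in> Arr C" "src C g = Y" "trg C g = TO Z"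
    using fg by (auto simp: hom1_iff)
  show "assoc C (N Z \<odot> TA g) (N Y \<odot> TA f) (I X) \<cdot> (associated_\<mu> C T n \<alpha> X Y Z g f \<rhd> I X)
      \<cdot> associated_\<eta> C T n i \<l> X Z ((N Z \<odot> TA g) \<odot> f)
    = (N Z \<odot> TA g) \<lhd> associated_\<eta> C T n i \<l> X Y f"
    using arg_cong[OF mu_eta[of f g Y Z X], of wval] \<open>X \<in> Obj C\<close>
    by (simp add: comp3_def wval_wmu[where X = X] wval_weta)
next
  fix X assume [simp]: "X \<in> Obj C"
  show "lunit C (I X) \<cdot> (\<rho> X \<rhd> I X) \<cdot> associated_\<eta> C T n i \<l> X X (I X) = id2 C (I X)"
    using arg_cong[OF rho_eta[of X], of wval] by (simp add: wval_weta)
qed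

section \<open>From left extensions to the adjunctions\<close>

text \<open>A component at an identity 1-cell returns the raw cell; \<open>lu_id1\<close> reconciles
  the left unitor inside \<open>lam_at\<close> with the right unitor of
  \<open>ru_natural\<close>.\<close>

lemma lam_at_id1:
  assumes [simp]: "X \<in> Obj C"
  shows "lam_at X (id1 C (TO X)) = (N X \<triangleleft> winv (ru (I (TO X)))) \<bullet> wlam X"
proof -
  have "(N X \<triangleleft> ru (I (TO X))) \<bullet> lam_at X (id1 C (TO X))
    = ru (N X \<odot> I (TO X)) \<bullet> (wlam X \<triangleright> id1 C (TO X)) \<bullet> winv (lu (id1 C (TO X)))"
    using ru_comp[of "N X" "I (TO X)" "TO X"] by (simp add: lam_at_def nt02_def)
  also have "\<dots> = wlam X"
    using ru_natural[of "wlam X" "id1 C (TO X)" "N X \<odot> I (TO X)", THEN vc_tail] by (simp add: lu_id1)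
  finally have "(N X \<triangleleft> winv (ru (I (TO X)))) \<bullet> (N X \<triangleleft> ru (I (TO X))) \<bullet> lam_at X (id1 C (TO X))
    = (N X \<triangleleft> winv (ru (I (TO X)))) \<bullet> wlam X"
    by (simp only:)
  then show ?thesis by simp
qed

text \<open>The unit constraints of \<open>T\<close> and of the bicategory identify
  \<open>N X \<odot> TA (id1 C (TO X))\<close> with \<open>N X\<close>; along this isomorphism
  \<lambda> serves as the unit cell exhibiting \<open>N X\<close> as the extension of an
  identity.\<close>

lemma weta_id1:
  assumes [simp]: "X \<in> Obj C"
  shows "((ru (N X) \<bullet> (N X \<triangleleft> winv (T.wu (TO X)))) \<triangleright> I (TO X)) \<bullet> weta X (id1 C (TO X)) = wlam X"
proof -
  let ?I = "I (TO X)" let ?J = "id1 C (TO (TO X))"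
  have 1: "((N X \<triangleleft> winv (T.wu (TO X))) \<triangleright> ?I) \<bullet> winv (as (N X) (TA (id1 C (TO X))) ?I)
    = winv (as (N X) ?J ?I) \<bullet> (N X \<triangleleft> (winv (T.wu (TO X)) \<triangleright> ?I))"
    using winv_swap[OF as_natural_mid[of "winv (T.wu (TO X))" "TA (id1 C (TO X))" ?J "N X" ?I, OF _ _]]
    by (simp add: comp3_def del: wiso_lw(2) wiso_rw(2))
  have 2: "(ru (N X) \<triangleright> ?I) \<bullet> winv (as (N X) ?J ?I) = N X \<triangleleft> lu ?I"
    using triangle_as[of "N X" ?I "TO (TO X)", symmetric] by (simp add: comp3_def)
  have "((ru (N X) \<bullet> (N X \<triangleleft> winv (T.wu (TO X)))) \<triangleright> ?I) \<bullet> weta X (id1 C (TO X))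
    = (ru (N X) \<triangleright> ?I) \<bullet> (((N X \<triangleleft> winv (T.wu (TO X))) \<triangleright> ?I) \<bullet> winv (as (N X) (TA (id1 C (TO X))) ?I))
      \<bullet> (N X \<triangleleft> wi (id1 C (TO X))) \<bullet> lam_at X (id1 C (TO X))"
    by (simp add: weta_def del: wiso_lw(2) wiso_rw(2))
  also have "\<dots> = ((ru (N X) \<triangleright> ?I) \<bullet> winv (as (N X) ?J ?I))
      \<bullet> (N X \<triangleleft> ((winv (T.wu (TO X)) \<triangleright> ?I) \<bullet> wi (id1 C (TO X)))) \<bullet> lam_at X (id1 C (TO X))"
    unfolding 1 by (simp del: wiso_lw(2) wiso_rw(2))
  also have "\<dots> = wlam X"
    unfolding 2 by (simp add: wi_id1 lam_at_id1)
  finally show ?thesis .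
qed

lemma extension_along_I_unique:
  assumes L: "lax_idempotent_relative C (associated_relative C T n i \<alpha> \<l> \<rho>)" and [simp]: "X \<in> Obj C"
    and v: "valid \<phi>" "wdom \<phi> = N X" "wcod \<phi> = N X" and v': "valid \<phi>'" "wdom \<phi>' = N X" "wcod \<phi>' = N X"
    and e: "(\<phi> \<triangleright> I (TO X)) \<bullet> wlam X = (\<phi>' \<triangleright> I (TO X)) \<bullet> wlam X"
  shows "\<phi> = \<phi>'"
proof -
  let ?q = "ru (N X) \<bullet> (N X \<triangleleft> winv (T.wu (TO X)))" let ?J = "id1 C (TO X)"
  have "\<forall>X\<in>Obj C. \<forall>Y\<in>Obj C. \<forall>f\<in>hom1 C X (TO Y).
      left_extension C X (TO X) (TO Y) (I X) f (N Y \<odot> TA f) (associated_\<eta> C T n i \<l> X Y f)"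
    using L by (simp add: lax_idempotent_relative_def associated_relative_def)
  then have "left_extension C (TO X) (TO (TO X)) (TO X) (I (TO X)) ?J (N X \<odot> TA ?J) (wval (weta X ?J))"
    by (simp add: wval_weta hom1_iff)
  \<comment> \<open>\<open>?q\<close> is the invertible comparison of \<open>weta_id1\<close>;
    composing with it turns cells out of \<open>N X\<close> into cells out of the extension.\<close>
  from left_extension_unique[OF this, of "N X" "\<phi> \<bullet> ?q" "\<phi>' \<bullet> ?q"]
  have "\<phi> \<bullet> ?q = \<phi>' \<bullet> ?q"
    using v v' e weta_id1[of X] by (simp add: hom1_iff)
  then show ?thesis
    by (rule vc_right_cancel) (use v v' in simp_all)
qed

lemma unit_of_relative:
  assumes L: "lax_idempotent_relative C (associated_relative C T n i \<alpha> \<l> \<rho>)" and [simp]: "X \<in> Obj C"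
  shows "\<exists>w. valid w \<and> wdom w = id1 C (TO (TO X)) \<and> wcod w = I (TO X) \<odot> N X
    \<and> nt02 (I (TO X)) (N X) w (I (TO X)) = (I (TO X) \<triangleleft> wlam X) \<bullet> winv (ru (I (TO X)))"
proof -
  let ?TX = "TO X" let ?I = "I (TO X)"
  \<comment> \<open>The restriction along \<open>?I\<close> that the triangle identity on
    \<open>?I\<close> prescribes for the unit.\<close>
  let ?\<psi> = "winv (as ?I (N X) ?I) \<bullet> (?I \<triangleleft> wlam X) \<bullet> winv (ru ?I)"
  have "\<forall>X\<in>Obj C. \<forall>Y\<in>Obj C. \<forall>f\<in>hom1 C X (TO Y).
      left_extension C X (TO X) (TO Y) (I X) f (N Y \<odot> TA f) (associated_\<eta> C T n i \<l> X Y f)"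
    using L by (simp add: lax_idempotent_relative_def associated_relative_def)
  then have "left_extension C ?TX (TO ?TX) (TO ?TX) ?I ?I (N ?TX \<odot> TA ?I) (wval (weta ?TX ?I))"
    by (simp add: wval_weta hom1_iff)
  from left_extension_exists[OF this, of "?I \<odot> N X" ?\<psi>]
  obtain \<phi> where p: "valid \<phi>" "wdom \<phi> = N ?TX \<odot> TA ?I" "wcod \<phi> = ?I \<odot> N X" "(\<phi> \<triangleright> ?I) \<bullet> weta ?TX ?I = ?\<psi>"
    by (auto simp: hom1_iff comp3_def)
  \<comment> \<open>The extension starts at \<open>N ?TX \<odot> TA ?I\<close>, which is isomorphic
    to the required identity 1-cell by \<rho>.\<close>
  define w where "w = \<phi> \<bullet> winv (wrho ?TX)"
  \<comment> \<open>The same isomorphism reduces the unit cell of the extension to an inverse left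
    unitor, so that restricting \<open>w\<close> gives \<open>?\<psi>\<close>.\<close>
  have "lu ?I \<bullet> (wrho ?TX \<triangleright> ?I) \<bullet> weta ?TX ?I = wid ?I"
    by (rule rho_eta) simp
  from arg_cong[OF this, of "\<lambda>x. winv (wrho ?TX \<triangleright> ?I) \<bullet> winv (lu ?I) \<bullet> x"]
  have "weta ?TX ?I = winv (wrho ?TX \<triangleright> ?I) \<bullet> winv (lu ?I)"
    by simp
  then have "(w \<triangleright> ?I) \<bullet> winv (lu ?I) = ?\<psi>"
    using p by (simp add: w_def)
  then have "nt02 ?I (N X) w ?I = as ?I (N X) ?I \<bullet> ?\<psi>"
    by (simp add: nt02_def)
  then show ?thesis
    using p by (intro exI[of _ w]) (simp add: w_def comp3_def)
qed

theorem lax_idempotent_pseudomonad_of_relative: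
  assumes L: "lax_idempotent_relative C (associated_relative C T n i \<alpha> \<l> \<rho>)"
  shows "lax_idempotent_pseudomonad C T n i \<l>"
  unfolding lax_idempotent_pseudomonad_def
proof
  fix X assume X [simp]: "X \<in> Obj C"
  let ?N = "N X" and ?I = "I (TO X)"
  obtain w where w [simp]: "valid w" "wdom w = id1 C (TO (TO X))" "wcod w = ?I \<odot> ?N"
    and U: "nt02 ?I ?N w ?I = (?I \<triangleleft> wlam X) \<bullet> winv (ru ?I)"
    using unit_of_relative[OF L X] by blast
  \<comment> \<open>The composite that the triangle identity on \<open>?N\<close> requires to be an
    identity.\<close>
  define z where "z = nt20 ?N ?I (winv (wlam X)) ?N \<bullet> ((?N \<triangleleft> w) \<bullet> winv (ru ?N))"
  have z [simp]: "valid z" "wdom z = ?N" "wcod z = ?N"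
    by (simp_all add: z_def valid_nt20[where X = "TO X"] comp3_def)
  have "z = wid ?N"
  proof (rule extension_along_I_unique[OF L X])
    have "z \<triangleright> ?I = (nt20 ?N ?I (winv (wlam X)) ?N \<triangleright> ?I) \<bullet> (((?N \<triangleleft> w) \<bullet> winv (ru ?N)) \<triangleright> ?I)"
      by (simp add: z_def)
    also have "nt20 ?N ?I (winv (wlam X)) ?N \<triangleright> ?I = nt20 ?N ?I (winv (wlam X)) (?N \<odot> ?I) \<bullet> as2 ?N ?I ?N ?I"
      by (rule nt20_rw[where X = "TO X"]) (simp_all add: comp3_def)
    also have "\<dots> \<bullet> (((?N \<triangleleft> w) \<bullet> winv (ru ?N)) \<triangleright> ?I) = winv (lam_at X (?N \<odot> ?I)) \<bullet> (?N \<triangleleft> nt02 ?I ?N w ?I)"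
      using nt02_lw_rw[of w "TO (TO X)" ?I ?N ?I ?N] by (simp add: nt20_winv_wlam comp3_def)
    \<comment> \<open>Restriction along \<open>?I\<close> has brought in the component of
      \<open>w\<close> that \<open>U\<close> evaluates.\<close>
    also have "\<dots> = winv (lam_at X (?N \<odot> ?I)) \<bullet> (?N \<triangleleft> ?I \<triangleleft> wlam X) \<bullet> (?N \<triangleleft> winv (ru ?I))"
      unfolding U by simp
    finally have "(z \<triangleright> ?I) \<bullet> wlam X = winv (lam_at X (?N \<odot> ?I)) \<bullet> (?N \<triangleleft> ?I \<triangleleft> wlam X) \<bullet> lam_at X (id1 C (TO X))"
      by (simp add: lam_at_id1)
    \<comment> \<open>Naturality of \<lambda> at the 2-cell \<open>wlam X\<close> itself.\<close>
    also have "(?N \<triangleleft> ?I \<triangleleft> wlam X) \<bullet> lam_at X (id1 C (TO X)) = lam_at X (?N \<odot> ?I) \<bullet> wlam X"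
      by (rule lam_at_natural[symmetric]) simp_all
    finally show "(z \<triangleright> ?I) \<bullet> wlam X = (wid ?N \<triangleright> ?I) \<bullet> wlam X"
      by simp
  qed simp_all
  then have t1: "lu ?N \<bullet> (winv (wlam X) \<triangleright> ?N) \<bullet> winv (as ?N ?I ?N) \<bullet> (?N \<triangleleft> w) \<bullet> winv (ru ?N) = wid ?N"
    by (simp add: z_def nt20_def)
  have "ru ?I \<bullet> (?I \<triangleleft> winv (wlam X)) \<bullet> nt02 ?I ?N w ?I = wid ?I"
    unfolding U by simp
  then have t2: "ru ?I \<bullet> (?I \<triangleleft> winv (wlam X)) \<bullet> as ?I ?N ?I \<bullet> (w \<triangleright> ?I) \<bullet> winv (lu ?I) = wid ?I"
    by (simp add: nt02_def)
  show "left_adjoint_with_counit C (TO (TO X)) (TO X) ?N ?I (inv2 C (\<l> X))"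
    unfolding left_adjoint_with_counit_def
  proof (intro conjI bexI[of _ "wval w"])
    show "inv2 C (\<l> X) \<in> hom2 C (?N \<odot> ?I) (id1 C (TO X))"
      using validD(1)[of "winv (wlam X)"] by (simp add: wval_winv)
    show "wval w \<in> hom2 C (id1 C (TO (TO X))) (?I \<odot> ?N)"
      using validD(1)[of w] by simp
    show "lunit C ?N \<cdot> (inv2 C (\<l> X) \<rhd> ?N) \<cdot> assoc_inv C ?N ?I ?N \<cdot> (?N \<lhd> wval w) \<cdot> inv2 C (runit C ?N) = id2 C ?N"
      using arg_cong[OF t1, of wval] by (simp add: comp3_def wval_winv del: wiso_lw(2) wiso_rw(2))
    show "runit C ?I \<cdot> (?I \<lhd> inv2 C (\<l> X)) \<cdot> assoc C ?I ?N ?I \<cdot> (wval w \<rhd> ?I) \<cdot> inv2 C (lunit C ?I) = id2 C ?I"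
      using arg_cong[OF t2, of wval] by (simp add: comp3_def wval_winv del: wiso_lw(2) wiso_rw(2))
  qed (simp_all add: hom1_iff)
qed

end

theorem mainTheorem12:
  fixes C :: "('o, 'm, 'c) bicat"
    and T :: "('o, 'm, 'c) psfun"
    and n i :: "('o, 'm, 'c) pstrans"
    and \<alpha> \<l> \<rho> :: "'o \<Rightarrow> 'c"
  assumes "bicategory C"
    and "pseudomonad C T n i \<alpha> \<l> \<rho>"
  shows "lax_idempotent_pseudomonad C T n i \<l> \<longleftrightarrow>
         lax_idempotent_relative C (associated_relative C T n i \<alpha> \<l> \<rho>)"
  using pseudomonad.lax_idempotent_relative_of_pseudomonad[OF assms(2)]
    pseudomonad.lax_idempotent_pseudomonad_of_relative[OF assms(2)] by blast

end
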